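(* Assume that $z\in Z$ is a critical point of $f\circ\mu$ (called an $f$-extremal point). Then: (1) $df|_{\mu(z)}\in\mathfrak{k}_z=\{\xi\in\mathfrak{k}:\sigma_z(\xi)=0\}$. (2) $\mathrm{ad}^*_{df|_{\mu(z)}}\mu(z)=0$. (3) $\mathfrak{g}_z=\bigoplus_{\lambda\le0}\mathfrak{g}_\lambda$, where $\mathfrak{g}_\lambda=\{\xi\in\mathfrak{g}_z:\sqrt{-1}\,\mathrm{ad}_{df|_{\mu(z)}}\xi=\lambda\xi\}$. (4) In particular, $\mathfrak{g}_0=\mathfrak{k}_z\otimes_{\mathbb{R}}\mathbb{C}\cong\mathfrak{g}_{\rm red}:=\mathfrak{g}_z/(\mathfrak{g}_z)_{\rm solv}$, where $(\mathfrak{g}_z)_{\rm solv}\subseteq\mathfrak{g}_z$ is the maximal solvable subalgebra.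
   Context: Let $G$ be a reductive linear algebraic group, $K\subset G$ a maximal compact subgroup, $\mathfrak{k}=\mathrm{Lie}(K)$, and $\mathfrak{g}=\mathrm{Lie}(G)=\mathfrak{k}\otimes_{\mathbb{R}}\mathbb{C}$. Let $\langle\cdot,\cdot\rangle:\mathfrak{k}^*\times\mathfrak{k}\to\mathbb{R}$ be the natural pairing; the coadjoint action satisfies $\langle \mathrm{Ad}_k^*\xi^*,\mathrm{Ad}_k\eta\rangle=\langle\xi^*,\eta\rangle$, and $\mathrm{ad}^*_\eta=\frac{d}{dt}\big|_{t=0}\mathrm{Ad}^*_{\exp(t\eta)}$. Let $(Z,\omega,J)$ be a Kähler manifold with Kähler form $\omega$, complex structure $J$ and Riemannian metric $\langle u,v\rangle_{TZ}=\omega(u,Jv)$. The compact group $K$ acts on $Z$ isometrically, and this action is complexified to a holomorphic $G$-action. Let $\sigma_z:\mathfrak{k}\to T_zZ$ be the infinitesimal action. Let $\mu:Z\to\mathfrak{k}^*$ be a moment map: $\mu(k\cdot z)=\mathrm{Ad}^*_k\mu(z)$ for $k\in K$, and $\langle d\mu_z(v),\eta\rangle=\omega(v,\sigma_z(\eta))$ for $v\in T_zZ$, $\eta\in\mathfrak{k}$. Put $\mathfrak{g}_z=\{\xi_1+\sqrt{-1}\xi_2\in\mathfrak{g}:\xi_1,\xi_2\in\mathfrak{k},\ \sigma_z(\xi_1)+J\sigma_z(\xi_2)=0\}$. Let $f:\mathfrak{k}^*\to\mathbb{R}$ be a smooth $\mathrm{Ad}_K^*$-invariant function which is strictly convex,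 meaning that its Hessian $\nabla^2 f|_{\alpha^*}$ is positive definite at every $\alpha^*\in\mathfrak{k}^*$. Its differential $df|_{\alpha^*}$ is regarded as an element of $\mathfrak{k}$.
   Formalization: In (4) "maximal solvable subalgebra" is read as the largest solvable ideal of nilpotent matrices (unipotent-radical part), since with the solvable radical the claim fails: for U(1) acting trivially on a point, g_0 = C but the quotient is 0. *)

theory Defs
  imports "HOL-Analysis.Analysis" "HOL-Library.Function_Algebras"
begin

section \<open>Smooth functions between normed spaces\<close>

text \<open>
  On the finite-dimensional spaces used below, \<open>C_k k f S\<close> on an open set \<open>S\<close> is the usual
  \<open>C\<^sup>k\<close> condition: all iterated directional derivatives of order up to \<open>k\<close> exist and are continuous.
\<close>

fun C_k :: "nat \<Rightarrow> ('a::real_normed_vector \<Rightarrow> 'b::real_normed_vector) \<Rightarrow> 'a set \<Rightarrow> bool" where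
  "C_k 0 f S \<longleftrightarrow> continuous_on S f"
| "C_k (Suc k) f S \<longleftrightarrow>
     (\<forall>x\<in>S. f differentiable (at x)) \<and> (\<forall>v. C_k k (\<lambda>x. frechet_derivative f (at x) v) S)"

definition smooth_on :: "('a::real_normed_vector \<Rightarrow> 'b::real_normed_vector) \<Rightarrow> 'a set \<Rightarrow> bool" where
  "smooth_on f S \<longleftrightarrow> (\<forall>k. C_k k f S)"


section \<open>Linear algebraic groups and their Lie algebras\<close>

type_synonym 'n cmat = "complex^'n^'n"

definition cscale :: "complex \<Rightarrow> 'n::finite cmat \<Rightarrow> 'n cmat" where
  "cscale c X = (\<chi> i j. c * X $ i $ j)"

definition mpow :: "'n::finite cmat \<Rightarrow> nat \<Rightarrow> 'n cmat" where
  "mpow X k = (((**) X) ^^ k) (mat 1)"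

definition mexp :: "'n::finite cmat \<Rightarrow> 'n cmat" where
  "mexp X = (\<Sum>k. (1 / fact k) *\<^sub>R mpow X k)"

definition commutator :: "'n::finite cmat \<Rightarrow> 'n cmat \<Rightarrow> 'n cmat" where
  "commutator X Y = X ** Y - Y ** X"

definition matrix_group :: "'n::finite cmat set \<Rightarrow> bool" where
  "matrix_group G \<longleftrightarrow> (\<forall>g\<in>G. invertible g) \<and> mat 1 \<in> G \<and>
     (\<forall>g\<in>G. \<forall>h\<in>G. g ** h \<in> G) \<and> (\<forall>g\<in>G. matrix_inv g \<in> G)"

inductive polynomial_on_matrices :: "('n::finite cmat \<Rightarrow> complex) \<Rightarrow> bool" where
  const: "polynomial_on_matrices (\<lambda>_. c)"
| entry: "polynomial_on_matrices (\<lambda>X. X $ i $ j)"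
| add: "polynomial_on_matrices p \<Longrightarrow> polynomial_on_matrices q \<Longrightarrow> polynomial_on_matrices (\<lambda>X. p X + q X)"
| mult: "polynomial_on_matrices p \<Longrightarrow> polynomial_on_matrices q \<Longrightarrow> polynomial_on_matrices (\<lambda>X. p X * q X)"

definition linear_algebraic_group :: "'n::finite cmat set \<Rightarrow> bool" where
  "linear_algebraic_group G \<longleftrightarrow> matrix_group G \<and>
     (\<exists>P. (\<forall>p\<in>P. polynomial_on_matrices p) \<and> G = {g. invertible g \<and> (\<forall>p\<in>P. p g = 0)})"

definition unipotent :: "'n::finite cmat \<Rightarrow> bool" where
  "unipotent g \<longleftrightarrow> (\<exists>k. mpow (g - mat 1) k = 0)"

text \<open>
  Reductive: the unipotent radical is trivial. The group is not required to be connected.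
  For algebraic subgroups of \<open>GL\<^sub>n(\<complex>)\<close>, connectedness in the Euclidean and in the Zariski
  topology agree.
\<close>

definition reductive :: "'n::finite cmat set \<Rightarrow> bool" where
  "reductive G \<longleftrightarrow> linear_algebraic_group G \<and>
     (\<forall>N. linear_algebraic_group N \<and> N \<subseteq> G \<and> connected N \<and> (\<forall>u\<in>N. unipotent u) \<and>
          (\<forall>g\<in>G. \<forall>u\<in>N. g ** u ** matrix_inv g \<in> N) \<longrightarrow> N = {mat 1})"

definition maximal_compact_subgroup :: "'n::finite cmat set \<Rightarrow> 'n cmat set \<Rightarrow> bool" where
  "maximal_compact_subgroup K G \<longleftrightarrow> matrix_group K \<and> compact K \<and> K \<subseteq> G \<and>
     (\<forall>L. matrix_group L \<and> compact L \<and> K \<subseteq> L \<and> L \<subseteq> G \<longrightarrow> L = K)"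

definition lie_algebra :: "'n::finite cmat set \<Rightarrow> 'n cmat set" where
  "lie_algebra G = {X. \<forall>t::real. mexp (t *\<^sub>R X) \<in> G}"

text \<open>
  So that the dual of \<open>\<kk> = Lie(K)\<close> is the library type \<^typ>\<open>'k \<Rightarrow>\<^sub>L real\<close>, the Lie algebra
  is carried by a type \<^typ>\<open>'k\<close> together with a linear isomorphism \<open>emb\<close> onto the space of matrices
  \<open>Lie(K)\<close>. (\<^typ>\<open>'k\<close> is then finite-dimensional; the dimension \<open>0\<close> is allowed, and the norm
  of \<^typ>\<open>'k\<close> is irrelevant.)
\<close>

definition lie_algebra_iso :: "('k::real_normed_vector \<Rightarrow> 'n::finite cmat) \<Rightarrow> 'n cmat set \<Rightarrow> bool" where
  "lie_algebra_iso emb K \<longleftrightarrow> bounded_linear emb \<and> inj emb \<and> range emb = lie_algebra K"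

definition Ad :: "('k::real_normed_vector \<Rightarrow> 'n::finite cmat) \<Rightarrow> 'n cmat \<Rightarrow> 'k \<Rightarrow> 'k" where
  "Ad emb k \<eta> = inv emb (k ** emb \<eta> ** matrix_inv k)"

text \<open>The coadjoint action, normalised by \<open>\<langle>Ad\<^sup>*\<^sub>k \<alpha>, Ad\<^sub>k \<eta>\<rangle> = \<langle>\<alpha>, \<eta>\<rangle>\<close>.\<close>

definition Ad_star ::
    "('k::real_normed_vector \<Rightarrow> 'n::finite cmat) \<Rightarrow> 'n cmat \<Rightarrow> ('k \<Rightarrow>\<^sub>L real) \<Rightarrow> ('k \<Rightarrow>\<^sub>L real)" where
  "Ad_star emb k \<alpha> = Blinfun (\<lambda>\<eta>. blinfun_apply \<alpha> (Ad emb (matrix_inv k) \<eta>))"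

definition ad_star ::
    "('k::real_normed_vector \<Rightarrow> 'n::finite cmat) \<Rightarrow> 'k \<Rightarrow> ('k \<Rightarrow>\<^sub>L real) \<Rightarrow> ('k \<Rightarrow>\<^sub>L real)" where
  "ad_star emb \<eta> \<alpha> = vector_derivative (\<lambda>t. Ad_star emb (mexp (t *\<^sub>R emb \<eta>)) \<alpha>) (at 0)"

text \<open>
  The complexification of a real subspace \<open>S\<close> of \<open>\<kk>\<close>, as a subspace of \<open>\<gg> = \<kk> \<oplus> \<i>\<kk>\<close>.
  For \<open>S = \<kk>\<close> this is all of \<open>Lie(G)\<close>, since \<open>K\<close> is a maximal compact subgroup of the reductive
  group \<open>G\<close>.
\<close>

definition complexification ::
    "('k::real_normed_vector \<Rightarrow> 'n::finite cmat) \<Rightarrow> 'k set \<Rightarrow> 'n cmat set" where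
  "complexification emb S = {emb \<xi>1 + cscale \<i> (emb \<xi>2) | \<xi>1 \<xi>2. \<xi>1 \<in> S \<and> \<xi>2 \<in> S}"


section \<open>Functions on the dual of the Lie algebra\<close>

definition differential :: "(('k::real_normed_vector \<Rightarrow>\<^sub>L real) \<Rightarrow> real) \<Rightarrow> ('k \<Rightarrow>\<^sub>L real) \<Rightarrow> 'k" where
  "differential f \<alpha> = (THE \<eta>. \<forall>\<beta>. frechet_derivative f (at \<alpha>) \<beta> = blinfun_apply \<beta> \<eta>)"

definition hessian :: "('v::real_normed_vector \<Rightarrow> real) \<Rightarrow> 'v \<Rightarrow> 'v \<Rightarrow> 'v \<Rightarrow> real" where
  "hessian f \<alpha> \<beta> \<gamma> = frechet_derivative (\<lambda>a. frechet_derivative f (at a) \<gamma>) (at \<alpha>) \<beta>"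

definition hessian_positive_definite :: "('v::real_normed_vector \<Rightarrow> real) \<Rightarrow> bool" where
  "hessian_positive_definite f \<longleftrightarrow> (\<forall>\<alpha> \<beta>. \<beta> \<noteq> 0 \<longrightarrow> hessian f \<alpha> \<beta> \<beta> > 0)"

definition Ad_star_invariant ::
    "('k::real_normed_vector \<Rightarrow> 'n::finite cmat) \<Rightarrow> 'n cmat set \<Rightarrow> (('k \<Rightarrow>\<^sub>L real) \<Rightarrow> real) \<Rightarrow> bool" where
  "Ad_star_invariant emb K f \<longleftrightarrow> (\<forall>k\<in>K. \<forall>\<alpha>. f (Ad_star emb k \<alpha>) = f \<alpha>)"


section \<open>Complex manifolds\<close>

text \<open>
  The manifold is a whole type \<^typ>\<open>'z\<close>. It is modelled on a finite-dimensional complex vector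
  space, given as a real normed space \<^typ>\<open>'e\<close> with multiplication by the imaginary unit \<open>J0\<close>;
  this includes dimension \<open>0\<close>, unlike \<open>complex^'m\<close>.
\<close>

definition complex_model_space :: "('e::real_normed_vector \<Rightarrow> 'e) \<Rightarrow> bool" where
  "complex_model_space J0 \<longleftrightarrow> bounded_linear J0 \<and> (\<forall>v. J0 (J0 v) = - v) \<and>
     (\<exists>B::'e set. finite B \<and> span B = UNIV)"

definition complex_differentiable_at ::
    "('e::real_normed_vector \<Rightarrow> 'e) \<Rightarrow> ('e \<Rightarrow> 'e) \<Rightarrow> 'e \<Rightarrow> bool" where
  "complex_differentiable_at J0 F x \<longleftrightarrow>
     (\<exists>D. (F has_derivative D) (at x) \<and> (\<forall>v. D (J0 v) = J0 (D v)))"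

type_synonym ('z, 'e) chart = "'z set \<times> ('z \<Rightarrow> 'e)"

abbreviation chart_dom :: "('z, 'e) chart \<Rightarrow> 'z set" where
  "chart_dom c \<equiv> fst c"

abbreviation chart_map :: "('z, 'e) chart \<Rightarrow> 'z \<Rightarrow> 'e" where
  "chart_map c \<equiv> snd c"

abbreviation chart_inv :: "('z, 'e) chart \<Rightarrow> 'e \<Rightarrow> 'z" where
  "chart_inv c \<equiv> inv_into (chart_dom c) (chart_map c)"

abbreviation transition :: "('z, 'e) chart \<Rightarrow> ('z, 'e) chart \<Rightarrow> 'e \<Rightarrow> 'e" where
  "transition c c' \<equiv> (\<lambda>x. chart_map c' (chart_inv c x))"

definition charts_at :: "('z, 'e) chart set \<Rightarrow> 'z \<Rightarrow> ('z, 'e) chart set" where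
  "charts_at A z = {c \<in> A. z \<in> chart_dom c}"

definition chart_at :: "('z, 'e) chart set \<Rightarrow> 'z \<Rightarrow> ('z, 'e) chart" where
  "chart_at A z = (SOME c. c \<in> charts_at A z)"

definition complex_manifold ::
    "('e::real_normed_vector \<Rightarrow> 'e) \<Rightarrow>
     ('z::{t2_space, second_countable_topology}, 'e) chart set \<Rightarrow> bool" where
  "complex_manifold J0 A \<longleftrightarrow> complex_model_space J0 \<and>
     (\<Union>c\<in>A. chart_dom c) = UNIV \<and>
     (\<forall>c\<in>A. open (chart_dom c) \<and> open (chart_map c ` chart_dom c) \<and>
        homeomorphism (chart_dom c) (chart_map c ` chart_dom c) (chart_map c) (chart_inv c)) \<and>
     (\<forall>c\<in>A. \<forall>c'\<in>A. \<forall>z\<in>chart_dom c \<inter> chart_dom c'.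
        complex_differentiable_at J0 (transition c c') (chart_map c z))"

text \<open>
  A tangent vector at \<open>z\<close> is the family of its components in all charts around \<open>z\<close>; the components
  are related by the derivatives of the transition maps. (The entries for charts that do not
  contain \<open>z\<close> carry no information and are set to \<open>0\<close>.) Vector space operations on tangent vectors
  are the pointwise ones of \<^theory>\<open>HOL-Library.Function_Algebras\<close>.
\<close>

type_synonym ('z, 'e) tangent = "('z, 'e) chart \<Rightarrow> 'e"

definition tangent_space ::
    "('z, 'e::real_normed_vector) chart set \<Rightarrow> 'z \<Rightarrow> ('z, 'e) tangent set" where
  "tangent_space A z = {v.
     (\<forall>c\<in>charts_at A z. \<forall>c'\<in>charts_at A z.
        v c' = frechet_derivative (transition c c') (at (chart_map c z)) (v c)) \<and>
     (\<forall>c. c \<notin> charts_at A z \<longrightarrow> v c = 0)}"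

definition tangent_J :: "('e \<Rightarrow> 'e) \<Rightarrow> ('z, 'e) tangent \<Rightarrow> ('z, 'e) tangent" where
  "tangent_J J0 v = (\<lambda>c. J0 (v c))"

text \<open>The tangent vector at \<open>z\<close> whose component in the chart \<open>c\<close> is \<open>u\<close>.\<close>

definition coordinate_vector ::
    "('z, 'e::real_normed_vector) chart set \<Rightarrow> ('z, 'e) chart \<Rightarrow> 'z \<Rightarrow> 'e \<Rightarrow> ('z, 'e) tangent" where
  "coordinate_vector A c z u = (\<lambda>c'. if c' \<in> charts_at A z
     then frechet_derivative (transition c c') (at (chart_map c z)) u else 0)"

text \<open>
  Differentials of a map to a vector space and of a map from the manifold to itself. They are
  computed in one chart around \<open>z\<close>; on \<^const>\<open>tangent_space\<close> the choice does not matter.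
\<close>

definition mderiv ::
    "('z, 'e::real_normed_vector) chart set \<Rightarrow> ('z \<Rightarrow> 'b::real_normed_vector) \<Rightarrow>
     'z \<Rightarrow> ('z, 'e) tangent \<Rightarrow> 'b" where
  "mderiv A F z v = (let c = chart_at A z in
     frechet_derivative (\<lambda>x. F (chart_inv c x)) (at (chart_map c z)) (v c))"

definition tangent_map ::
    "('z, 'e::real_normed_vector) chart set \<Rightarrow> ('z \<Rightarrow> 'z) \<Rightarrow>
     'z \<Rightarrow> ('z, 'e) tangent \<Rightarrow> ('z, 'e) tangent" where
  "tangent_map A F z v = (let c = chart_at A z in
     (\<lambda>c'. if c' \<in> charts_at A (F z)
       then frechet_derivative (\<lambda>x. chart_map c' (F (chart_inv c x))) (at (chart_map c z)) (v c)
       else 0))"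

definition curve_velocity ::
    "('z, 'e::real_normed_vector) chart set \<Rightarrow> (real \<Rightarrow> 'z) \<Rightarrow> ('z, 'e) tangent" where
  "curve_velocity A \<gamma> = (\<lambda>c. if c \<in> charts_at A (\<gamma> 0)
     then vector_derivative (\<lambda>t. chart_map c (\<gamma> t)) (at 0) else 0)"

definition smooth_map ::
    "('z, 'e::real_normed_vector) chart set \<Rightarrow> ('z \<Rightarrow> 'b::real_normed_vector) \<Rightarrow> bool" where
  "smooth_map A F \<longleftrightarrow> (\<forall>c\<in>A. smooth_on (\<lambda>x. F (chart_inv c x)) (chart_map c ` chart_dom c))"

definition critical_point ::
    "('z, 'e::real_normed_vector) chart set \<Rightarrow> ('z \<Rightarrow> real) \<Rightarrow> 'z \<Rightarrow> bool" where
  "critical_point A F z \<longleftrightarrow> (\<forall>v\<in>tangent_space A z. mderiv A F z v = 0)"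


section \<open>Kaehler forms\<close>

definition form_component ::
    "('z, 'e::real_normed_vector) chart set \<Rightarrow> ('z \<Rightarrow> ('z, 'e) tangent \<Rightarrow> ('z, 'e) tangent \<Rightarrow> real) \<Rightarrow>
     ('z, 'e) chart \<Rightarrow> 'e \<Rightarrow> 'e \<Rightarrow> 'e \<Rightarrow> real" where
  "form_component A \<omega> c u v x =
     \<omega> (chart_inv c x) (coordinate_vector A c (chart_inv c x) u)
                       (coordinate_vector A c (chart_inv c x) v)"

definition kaehler_form ::
    "('e::real_normed_vector \<Rightarrow> 'e) \<Rightarrow> ('z, 'e) chart set \<Rightarrow>
     ('z \<Rightarrow> ('z, 'e) tangent \<Rightarrow> ('z, 'e) tangent \<Rightarrow> real) \<Rightarrow> bool" where
  "kaehler_form J0 A \<omega> \<longleftrightarrow>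
     (\<forall>z. \<forall>c\<in>charts_at A z.
        bilinear (\<lambda>u v. \<omega> z (coordinate_vector A c z u) (coordinate_vector A c z v))) \<and>
     (\<forall>z. \<forall>u\<in>tangent_space A z. \<forall>v\<in>tangent_space A z. \<omega> z u v = - \<omega> z v u) \<and>
     (\<forall>z. \<forall>u\<in>tangent_space A z. \<forall>v\<in>tangent_space A z.
        \<omega> z (tangent_J J0 u) (tangent_J J0 v) = \<omega> z u v) \<and>
     (\<forall>z. \<forall>u\<in>tangent_space A z. u \<noteq> 0 \<longrightarrow> \<omega> z u (tangent_J J0 u) > 0) \<and>
     (\<forall>c\<in>A. \<forall>u v. smooth_on (form_component A \<omega> c u v) (chart_map c ` chart_dom c)) \<and>
     (\<forall>c\<in>A. \<forall>x\<in>chart_map c ` chart_dom c. \<forall>u v w.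
        frechet_derivative (form_component A \<omega> c v w) (at x) u
        + frechet_derivative (form_component A \<omega> c w u) (at x) v
        + frechet_derivative (form_component A \<omega> c u v) (at x) w = 0)"

definition kaehler_metric ::
    "('e::real_normed_vector \<Rightarrow> 'e) \<Rightarrow> ('z \<Rightarrow> ('z, 'e) tangent \<Rightarrow> ('z, 'e) tangent \<Rightarrow> real) \<Rightarrow>
     'z \<Rightarrow> ('z, 'e) tangent \<Rightarrow> ('z, 'e) tangent \<Rightarrow> real" where
  "kaehler_metric J0 \<omega> z u v = \<omega> z u (tangent_J J0 v)"


section \<open>Group actions and moment maps\<close>

definition group_action :: "'n::finite cmat set \<Rightarrow> ('n cmat \<Rightarrow> 'z \<Rightarrow> 'z) \<Rightarrow> bool" where
  "group_action G act \<longleftrightarrow> (\<forall>z. act (mat 1) z = z) \<and>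
     (\<forall>g\<in>G. \<forall>h\<in>G. \<forall>z. act (g ** h) z = act g (act h z))"

text \<open>
  Holomorphy of \<open>G \<times> Z \<rightarrow> Z\<close>: continuity, and complex differentiability at every point \<open>(g, z)\<close>,
  where \<open>X \<mapsto> exp(X) g\<close> with \<open>X \<in> Lie(G)\<close> near \<open>0\<close> serves as the holomorphic chart of \<open>G\<close>
  around \<open>g\<close>. The derivative is taken within the subspace \<open>Lie(G)\<close> of the space of all matrices.
\<close>

definition holomorphic_action ::
    "('e::real_normed_vector \<Rightarrow> 'e) \<Rightarrow> ('z::topological_space, 'e) chart set \<Rightarrow>
     'n::finite cmat set \<Rightarrow> ('n cmat \<Rightarrow> 'z \<Rightarrow> 'z) \<Rightarrow> bool" where
  "holomorphic_action J0 A G act \<longleftrightarrow> group_action G act \<and>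
     continuous_on (G \<times> UNIV) (\<lambda>(g, z). act g z) \<and>
     (\<forall>g\<in>G. \<forall>z. \<forall>c\<in>charts_at A z. \<forall>c'\<in>charts_at A (act g z). \<exists>D.
        ((\<lambda>(X, x). chart_map c' (act (mexp X ** g) (chart_inv c x))) has_derivative D)
          (at (0, chart_map c z) within lie_algebra G \<times> UNIV) \<and>
        (\<forall>X\<in>lie_algebra G. \<forall>v. D (cscale \<i> X, J0 v) = J0 (D (X, v))))"

definition isometric_action ::
    "('e::real_normed_vector \<Rightarrow> 'e) \<Rightarrow> ('z, 'e) chart set \<Rightarrow>
     ('z \<Rightarrow> ('z, 'e) tangent \<Rightarrow> ('z, 'e) tangent \<Rightarrow> real) \<Rightarrow>
     'n::finite cmat set \<Rightarrow> ('n cmat \<Rightarrow> 'z \<Rightarrow> 'z) \<Rightarrow> bool" where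
  "isometric_action J0 A \<omega> K act \<longleftrightarrow>
     (\<forall>k\<in>K. \<forall>z. \<forall>u\<in>tangent_space A z. \<forall>v\<in>tangent_space A z.
        kaehler_metric J0 \<omega> (act k z) (tangent_map A (act k) z u) (tangent_map A (act k) z v)
        = kaehler_metric J0 \<omega> z u v)"

definition inf_action ::
    "('z, 'e::real_normed_vector) chart set \<Rightarrow> ('k::real_normed_vector \<Rightarrow> 'n::finite cmat) \<Rightarrow>
     ('n cmat \<Rightarrow> 'z \<Rightarrow> 'z) \<Rightarrow> 'z \<Rightarrow> 'k \<Rightarrow> ('z, 'e) tangent" where
  "inf_action A emb act z \<eta> = curve_velocity A (\<lambda>t. act (mexp (t *\<^sub>R emb \<eta>)) z)"

definition moment_map ::
    "('z, 'e::real_normed_vector) chart set \<Rightarrow>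
     ('z \<Rightarrow> ('z, 'e) tangent \<Rightarrow> ('z, 'e) tangent \<Rightarrow> real) \<Rightarrow>
     ('k::real_normed_vector \<Rightarrow> 'n::finite cmat) \<Rightarrow> 'n cmat set \<Rightarrow>
     ('n cmat \<Rightarrow> 'z \<Rightarrow> 'z) \<Rightarrow> ('z \<Rightarrow> ('k \<Rightarrow>\<^sub>L real)) \<Rightarrow> bool" where
  "moment_map A \<omega> emb K act \<mu> \<longleftrightarrow> smooth_map A \<mu> \<and>
     (\<forall>k\<in>K. \<forall>z. \<mu> (act k z) = Ad_star emb k (\<mu> z)) \<and>
     (\<forall>z. \<forall>v\<in>tangent_space A z. \<forall>\<eta>.
        blinfun_apply (mderiv A \<mu> z v) \<eta> = \<omega> z v (inf_action A emb act z \<eta>))"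


section \<open>Stabilizer algebras\<close>

definition stab_k ::
    "('z, 'e::real_normed_vector) chart set \<Rightarrow> ('k::real_normed_vector \<Rightarrow> 'n::finite cmat) \<Rightarrow>
     ('n cmat \<Rightarrow> 'z \<Rightarrow> 'z) \<Rightarrow> 'z \<Rightarrow> 'k set" where
  "stab_k A emb act z = {\<xi>. inf_action A emb act z \<xi> = 0}"

definition stab_g ::
    "('e::real_normed_vector \<Rightarrow> 'e) \<Rightarrow> ('z, 'e) chart set \<Rightarrow>
     ('k::real_normed_vector \<Rightarrow> 'n::finite cmat) \<Rightarrow> 'n cmat set \<Rightarrow>
     ('n cmat \<Rightarrow> 'z \<Rightarrow> 'z) \<Rightarrow> 'z \<Rightarrow> 'n cmat set" where
  "stab_g J0 A emb G act z = {\<xi> \<in> lie_algebra G. \<exists>\<xi>1 \<xi>2. \<xi> = emb \<xi>1 + cscale \<i> (emb \<xi>2) \<and>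
     inf_action A emb act z \<xi>1 + tangent_J J0 (inf_action A emb act z \<xi>2) = 0}"

text \<open>The \<open>\<lambda>\<close>-eigenspace of \<open>\<i> ad\<^sub>H\<close> in \<open>L\<close>.\<close>

definition ad_eigenspace :: "'n::finite cmat set \<Rightarrow> 'n cmat \<Rightarrow> real \<Rightarrow> 'n cmat set" where
  "ad_eigenspace L H l = {\<xi> \<in> L. cscale \<i> (commutator H \<xi>) = cscale (complex_of_real l) \<xi>}"


section \<open>Complex Lie algebras of matrices\<close>

definition complex_subspace :: "'n::finite cmat set \<Rightarrow> bool" where
  "complex_subspace V \<longleftrightarrow> 0 \<in> V \<and> (\<forall>x\<in>V. \<forall>y\<in>V. x + y \<in> V) \<and> (\<forall>c. \<forall>x\<in>V. cscale c x \<in> V)"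

definition is_direct_sum ::
    "'n::finite cmat set \<Rightarrow> 'i set \<Rightarrow> ('i \<Rightarrow> 'n cmat set) \<Rightarrow> bool" where
  "is_direct_sum V I W \<longleftrightarrow> complex_subspace V \<and>
     (\<forall>i\<in>I. complex_subspace (W i) \<and> W i \<subseteq> V) \<and>
     (\<forall>v\<in>V. \<exists>!x. (\<forall>i\<in>I. x i \<in> W i) \<and> (\<forall>i. i \<notin> I \<longrightarrow> x i = 0) \<and>
        finite {i. x i \<noteq> 0} \<and> v = (\<Sum>i | x i \<noteq> 0. x i))"

definition lie_ideal :: "'n::finite cmat set \<Rightarrow> 'n cmat set \<Rightarrow> bool" where
  "lie_ideal S L \<longleftrightarrow> complex_subspace S \<and> S \<subseteq> L \<and> (\<forall>x\<in>L. \<forall>s\<in>S. commutator x s \<in> S)"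

text \<open>For a complex subspace \<open>S\<close> the real span below is the complex span of all commutators.\<close>

definition derived_algebra :: "'n::finite cmat set \<Rightarrow> 'n cmat set" where
  "derived_algebra S = span {commutator x y | x y. x \<in> S \<and> y \<in> S}"

definition lie_solvable :: "'n::finite cmat set \<Rightarrow> bool" where
  "lie_solvable S \<longleftrightarrow> (\<exists>k. (derived_algebra ^^ k) S = {0})"

text \<open>
  \<open>solv_part S L\<close>: \<open>S\<close> is the largest solvable ideal of \<open>L\<close> consisting of nilpotent matrices.
  For the Lie algebra \<open>L\<close> of a linear algebraic group this is the Lie algebra of the unipotent
  radical, so that \<open>L / S\<close> is the reductive quotient of \<open>L\<close>. The full solvable radical of \<open>L\<close>
  also contains the centre of a Levi factor; the quotient by it is only the semisimple quotient.
  For \<open>L = \<complex>\<close>, the Lie algebra of \<open>\<complex>\<^sup>*\<close>, the former quotient is \<open>L\<close> and the latter is \<open>0\<close>.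
\<close>

definition solv_part :: "'n::finite cmat set \<Rightarrow> 'n cmat set \<Rightarrow> bool" where
  "solv_part S L \<longleftrightarrow>
     lie_ideal S L \<and> lie_solvable S \<and> (\<forall>X\<in>S. \<exists>k. mpow X k = 0) \<and>
     (\<forall>T. lie_ideal T L \<and> lie_solvable T \<and> (\<forall>X\<in>T. \<exists>k. mpow X k = 0) \<longrightarrow> T \<subseteq> S)"

definition lie_quotient :: "'n::finite cmat set \<Rightarrow> 'n cmat set \<Rightarrow> 'n cmat set set" where
  "lie_quotient L S = (\<lambda>x. (+) x ` S) ` L"

text \<open>
  \<open>M\<close> and \<open>L / S\<close> are isomorphic complex Lie algebras. The operations of \<open>L / S\<close> are those on
  representatives: for instance, \<open>\<phi> x + \<phi> y\<close> is the coset that contains \<open>a + b\<close> for all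
  \<open>a \<in> \<phi> x\<close> and \<open>b \<in> \<phi> y\<close>.
\<close>

definition isomorphic_to_quotient ::
    "'n::finite cmat set \<Rightarrow> 'n cmat set \<Rightarrow> 'n cmat set \<Rightarrow> bool" where
  "isomorphic_to_quotient M L S \<longleftrightarrow> (\<exists>\<phi>. bij_betw \<phi> M (lie_quotient L S) \<and>
     (\<forall>x\<in>M. \<forall>y\<in>M. \<forall>a\<in>\<phi> x. \<forall>b\<in>\<phi> y.
        a + b \<in> \<phi> (x + y) \<and> commutator a b \<in> \<phi> (commutator x y)) \<and>
     (\<forall>x\<in>M. \<forall>c. \<forall>a\<in>\<phi> x. cscale c a \<in> \<phi> (cscale c x)))"

end

theory Submission
  imports Defs "HOL-Complex_Analysis.Complex_Analysis"
    "HOL-Computational_Algebra.Fundamental_Theorem_Algebra"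
begin

text \<open>
  Let \<open>s\<close> be the infinitesimal action at \<open>z\<close>, let \<open>\<langle>u, v\<rangle> = \<omega>(u, J v)\<close>, and write \<open>L x = d\<mu>(J (s x))\<close> up to
  sign, so that \<open>\<langle>L x, y\<rangle> = \<langle>s x, s y\<rangle>\<close>. Differentiating the equivariance of \<open>df\<close> along \<open>exp(t x)\<close>
  shows that the Hessian of \<open>f\<close> at \<open>\<mu>(z)\<close>, viewed as a map \<open>B\<close> from the dual of \<open>\<kk>\<close> to \<open>\<kk>\<close>,
  sends \<open>d\<mu>(s x)\<close> to \<open>[x, H]\<close>. For \<open>x + \<i> y \<in> \<gg>\<^sub>z\<close> one has \<open>s x = - J (s y)\<close>, and therefore
  \<open>\<i> ad\<^sub>H = - B L\<close> on \<open>\<gg>\<^sub>z\<close>. As \<open>B\<close> is positive definite and \<open>L\<close> is positive semidefinite with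
  kernel \<open>\<kk>\<^sub>z\<close>, this operator is diagonalizable, its eigenvalues are \<open>\<le> 0\<close>, and its kernel is the
  complexification of \<open>\<kk>\<^sub>z\<close>.

  The sum of the eigenspaces for negative eigenvalues is an ideal, and a product of many of its
  elements has a weight that \<open>\<i> ad\<^sub>H\<close> does not attain on matrices; so the ideal is solvable and
  consists of nilpotent matrices. An ideal of nilpotent matrices is \<open>ad\<^sub>H\<close>-invariant, and its weight
  zero part vanishes: if it contains \<open>x + \<i> y\<close> with \<open>x, y \<in> \<kk>\<^sub>z\<close>, it contains
  \<open>[x, y] \<in> Lie(K)\<close>, which must be \<open>0\<close> because one-parameter groups of \<open>K\<close> are bounded; then \<open>x\<close> and
  \<open>y\<close> commute, and the same boundedness forces \<open>x = y = 0\<close>.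
\<close>

section \<open>Matrices\<close>

lemma matrix_mul_diff_left: "(A - B) ** C = A ** C - B ** (C :: 'n::finite cmat)"
  by (simp add: matrix_matrix_mult_def vec_eq_iff sum_subtractf algebra_simps)

lemma matrix_mul_diff_right: "C ** (A - B) = C ** A - C ** (B :: 'n::finite cmat)"
  by (simp add: matrix_matrix_mult_def vec_eq_iff sum_subtractf algebra_simps)

lemma matrix_mul_add_left: "(A + B) ** C = A ** C + B ** (C :: 'n::finite cmat)"
  by (simp add: matrix_matrix_mult_def vec_eq_iff sum.distrib algebra_simps)

lemma matrix_mul_minus_left: "(- A) ** B = - (A ** (B :: 'n::finite cmat))"
  by (simp add: matrix_matrix_mult_def vec_eq_iff sum_negf)

lemma matrix_mul_minus_right: "A ** (- B) = - (A ** (B :: 'n::finite cmat))"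
  by (simp add: matrix_matrix_mult_def vec_eq_iff sum_negf)

lemma matrix_mul_zero_left [simp]: "0 ** A = (0 :: 'n::finite cmat)"
  by (simp add: matrix_matrix_mult_def vec_eq_iff)

lemma matrix_mul_zero_right [simp]: "A ** 0 = (0 :: 'n::finite cmat)"
  by (simp add: matrix_matrix_mult_def vec_eq_iff)

lemma matrix_mul_scaleR_left: "(r *\<^sub>R A) ** B = r *\<^sub>R (A ** (B :: 'n::finite cmat))"
  by (simp add: matrix_matrix_mult_def vec_eq_iff scaleR_sum_right)

lemma matrix_mul_scaleR_right: "A ** (r *\<^sub>R B) = r *\<^sub>R (A ** (B :: 'n::finite cmat))"
  by (simp add: matrix_matrix_mult_def vec_eq_iff scaleR_sum_right)

lemma matrix_mul_cscale_left: "cscale c A ** B = cscale c (A ** B)"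
  by (simp add: matrix_matrix_mult_def cscale_def vec_eq_iff sum_distrib_left mult.assoc)

lemma matrix_mul_cscale_right: "A ** cscale c B = cscale c (A ** B)"
  by (simp add: matrix_matrix_mult_def cscale_def vec_eq_iff sum_distrib_left algebra_simps)

lemmas matrix_mul_algebra =
  matrix_mul_diff_left matrix_mul_diff_right matrix_mul_add_left matrix_add_ldistrib
  matrix_mul_minus_left matrix_mul_minus_right matrix_mul_scaleR_left matrix_mul_scaleR_right
  matrix_mul_cscale_left matrix_mul_cscale_right

lemma bounded_bilinear_matrix_mul:
  "bounded_bilinear ((**) :: 'n::finite cmat \<Rightarrow> 'n cmat \<Rightarrow> 'n cmat)"
  unfolding bilinear_conv_bounded_bilinear [symmetric] bilinear_def
  by (auto intro!: linearI simp: matrix_mul_algebra)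

section \<open>Complex scalars and commutators\<close>

lemma cscale_add_right: "cscale c (X + Y) = cscale c X + cscale c Y"
  and cscale_diff_right: "cscale c (X - Y) = cscale c X - cscale c Y"
  and cscale_minus_right: "cscale c (- X) = - cscale c X"
  and cscale_add_left: "cscale (c + d) X = cscale c X + cscale d X"
  and cscale_minus_left: "cscale (- c) X = - cscale c X"
  and cscale_scaleR: "cscale c (r *\<^sub>R X) = r *\<^sub>R cscale c X"
  and cscale_cscale: "cscale c (cscale d X) = cscale (c * d) X"
  by (simp_all add: cscale_def vec_eq_iff algebra_simps)

lemma cscale_zero_right [simp]: "cscale c 0 = 0"
  and cscale_zero_left [simp]: "cscale 0 X = 0"
  and cscale_one [simp]: "cscale 1 X = X"
  by (simp_all add: cscale_def vec_eq_iff)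

lemma cscale_of_real: "cscale (complex_of_real r) X = r *\<^sub>R X"
  by (simp add: cscale_def vec_eq_iff scaleR_conv_of_real [symmetric])

lemma cscale_eq_0_iff: "cscale c X = 0 \<longleftrightarrow> c = 0 \<or> X = 0"
  by (auto simp: cscale_def vec_eq_iff)

lemma cscale_eq: "cscale c X = Re c *\<^sub>R X + Im c *\<^sub>R cscale \<i> X"
  by (simp add: cscale_def vec_eq_iff complex_eq_iff)

lemmas cscale_algebra =
  cscale_add_right cscale_diff_right cscale_minus_right cscale_add_left cscale_minus_left
  cscale_scaleR cscale_cscale

lemma linear_cscale: "linear (cscale c)"
  by (auto intro!: linearI simp: cscale_algebra)

lemma commutator_add_left: "commutator (X + Y) Z = commutator X Z + commutator Y Z"
  and commutator_add_right: "commutator X (Y + Z) = commutator X Y + commutator X Z"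
  and commutator_diff_right: "commutator X (Y - Z) = commutator X Y - commutator X Z"
  and commutator_diff_left: "commutator (X - Y) Z = commutator X Z - commutator Y Z"
  and commutator_minus_left: "commutator (- X) Y = - commutator X Y"
  and commutator_minus_right: "commutator X (- Y) = - commutator X Y"
  and commutator_scaleR_left: "commutator (r *\<^sub>R X) Y = r *\<^sub>R commutator X Y"
  and commutator_scaleR_right: "commutator X (r *\<^sub>R Y) = r *\<^sub>R commutator X Y"
  and commutator_cscale_left: "commutator (cscale c X) Y = cscale c (commutator X Y)"
  and commutator_cscale_right: "commutator X (cscale c Y) = cscale c (commutator X Y)"
  by (simp_all add: commutator_def matrix_mul_algebra cscale_algebra algebra_simps)

lemma commutator_zero [simp]: "commutator X 0 = 0" "commutator 0 X = 0"
  by (simp_all add: commutator_def)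

lemma commutator_self [simp]: "commutator X X = 0"
  by (simp add: commutator_def)

lemma commutator_antisym: "commutator X Y = - commutator Y X"
  by (simp add: commutator_def)

lemmas commutator_algebra =
  commutator_add_left commutator_add_right commutator_diff_left commutator_diff_right commutator_minus_left
  commutator_minus_right commutator_scaleR_left commutator_scaleR_right
  commutator_cscale_left commutator_cscale_right

lemma commutator_jacobi:
  "commutator X (commutator Y Z) = commutator (commutator X Y) Z + commutator Y (commutator X Z)"
  by (simp add: commutator_def matrix_mul_algebra matrix_mul_assoc)

lemma commutator_derivation: "commutator H (X ** Y) = commutator H X ** Y + X ** commutator H Y"
  by (simp add: commutator_def matrix_mul_algebra matrix_mul_assoc)

lemma linear_commutator: "linear (commutator X)"
  by (auto intro!: linearI simp: commutator_algebra)

lemma mpow_0 [simp]: "mpow X 0 = mat 1"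
  and mpow_Suc: "mpow X (Suc k) = X ** mpow X k"
  by (simp_all add: mpow_def)

lemma mpow_commute: "X ** Y = Y ** X \<Longrightarrow> mpow X k ** Y = Y ** mpow X k"
  by (induction k) (simp_all add: mpow_Suc matrix_mul_assoc, metis matrix_mul_assoc)

lemma mpow_cscale: "mpow (cscale c X) k = cscale (c ^ k) (mpow X k)"
  by (induction k) (simp_all add: mpow_Suc matrix_mul_algebra cscale_cscale mult.commute)

lemma mpow_zero: "0 < k \<Longrightarrow> mpow 0 k = 0"
  by (cases k) (simp_all add: mpow_Suc)

lemma matrix_invI:
  fixes A B :: "'n::finite cmat"
  assumes "A ** B = mat 1" "B ** A = mat 1"
  shows "invertible A" "matrix_inv A = B"
proof -
  show inv: "invertible A"
    using assms by (auto simp: invertible_def)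
  then have "A ** matrix_inv A = mat 1"
    by (metis (mono_tags, lifting) invertible_def matrix_inv_def someI_ex)
  then show "matrix_inv A = B"
    by (metis assms(2) matrix_mul_assoc matrix_mul_lid matrix_mul_rid)
qed

lemma matrix_inv_mult:
  fixes A :: "'n::finite cmat"
  assumes "invertible A"
  shows "A ** matrix_inv A = mat 1" "matrix_inv A ** A = mat 1"
  using assms unfolding invertible_def matrix_inv_def
  by (metis (mono_tags, lifting) someI_ex)+

section \<open>The matrix exponential\<close>

text \<open>An entry of a matrix product is a sum of \<open>CARD('n)\<close> terms, so each further
  factor costs at most \<open>CARD('n) * M\<close>. This dominates the exponential series entrywise
  by a scalar one.\<close>

lemma norm_mpow_entry_le:
  fixes X :: "'n::finite cmat"
  assumes "\<And>i j. norm (X $ i $ j) \<le> M"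
  shows "norm (mpow X k $ i $ j) \<le> (of_nat CARD('n) * M) ^ k"
proof (induction k arbitrary: i j)
  case 0
  then show ?case by (simp add: mat_def)
next
  case (Suc k)
  have "norm (mpow X (Suc k) $ i $ j) \<le> (\<Sum>l\<in>UNIV. norm (X $ i $ l * mpow X k $ l $ j))"
    by (simp add: mpow_Suc matrix_matrix_mult_def norm_sum)
  also have "\<dots> \<le> (\<Sum>l\<in>(UNIV::'n set). M * (of_nat CARD('n) * M) ^ k)"
    by (intro sum_mono) (simp add: norm_mult mult_mono' assms Suc)
  finally show ?case by simp
qed

text \<open>These Taylor coefficients make each entry of exp(w X) an entire scalar power series in
  the complex variable w, so convergence and complex differentiation come from the scalar
  theory.\<close>

definition exp_coeff :: "'n::finite cmat \<Rightarrow> 'n \<Rightarrow> 'n \<Rightarrow> nat \<Rightarrow> complex" where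
  "exp_coeff X i j k = mpow X k $ i $ j / fact k"

lemma summable_exp_coeff: "summable (\<lambda>k. exp_coeff X i j k * w ^ k)"
proof -
  obtain M where M: "norm (X $ i $ j) \<le> M" for i j
    using order_trans [OF Finite_Cartesian_Product.norm_nth_le Finite_Cartesian_Product.norm_nth_le] by blast
  let ?C = "of_nat CARD('a) * M * norm w"
  have "norm (exp_coeff X i j k * w ^ k) \<le> inverse (fact k) * ?C ^ k" for k
    using norm_mpow_entry_le [OF M, of k i j]
    by (simp add: exp_coeff_def norm_mult norm_divide norm_power divide_simps power_mult_distrib
        mult_right_mono)
  then show ?thesis
    by (intro summable_comparison_test' [OF summable_exp [of ?C]]) auto
qed

lemma mexp_cscale_entry: "mexp (cscale w X) $ i $ j = (\<Sum>k. exp_coeff X i j k * w ^ k)"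
proof -
  let ?t = "\<lambda>k. (1 / fact k) *\<^sub>R mpow (cscale w X) k"
  have t: "?t k $ i $ j = exp_coeff X i j k * w ^ k" for k i j
    by (simp add: exp_coeff_def mpow_cscale, simp add: cscale_def scaleR_conv_of_real)
  have "?t sums (\<chi> i j. \<Sum>k. exp_coeff X i j k * w ^ k)"
    unfolding sums_def
  proof (intro vec_tendstoI)
    fix i j
    show "(\<lambda>n. (\<Sum>k<n. ?t k) $ i $ j)
        \<longlonglongrightarrow> (\<chi> i j. \<Sum>k. exp_coeff X i j k * w ^ k) $ i $ j"
      using summable_LIMSEQ [OF summable_exp_coeff [of X i j w]] by (simp only: sum_component t) simp
  qed
  then show ?thesis
    by (simp add: mexp_def sums_iff)
qed

lemma matrix_mul_mexp_entry:
  "(Y ** mexp (cscale w X)) $ i $ j = (\<Sum>k. (\<Sum>l\<in>UNIV. Y $ i $ l * exp_coeff X l j k) * w ^ k)"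
  by (simp add: matrix_matrix_mult_def mexp_cscale_entry suminf_mult [symmetric] summable_exp_coeff
      suminf_sum [symmetric] summable_mult sum_distrib_right mult.assoc)

lemma mexp_matrix_mul_entry:
  "(mexp (cscale w X) ** Y) $ i $ j = (\<Sum>k. (\<Sum>l\<in>UNIV. exp_coeff X i l k * Y $ l $ j) * w ^ k)"
proof -
  have "(mexp (cscale w X) ** Y) $ i $ j = (\<Sum>l\<in>UNIV. \<Sum>k. exp_coeff X i l k * w ^ k * Y $ l $ j)"
    by (simp add: matrix_matrix_mult_def mexp_cscale_entry suminf_mult2 summable_exp_coeff)
  also have "\<dots> = (\<Sum>k. \<Sum>l\<in>UNIV. exp_coeff X i l k * w ^ k * Y $ l $ j)"
    by (intro suminf_sum [symmetric] summable_mult2 summable_exp_coeff)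
  finally show ?thesis
    by (simp add: sum_distrib_right mult.assoc mult.commute [of _ "Y $ _ $ _"])
qed

lemma mexp_cscale_commute:
  assumes "X ** Y = Y ** X"
  shows "mexp (cscale w X) ** Y = Y ** mexp (cscale w X)"
proof -
  have "(\<Sum>l\<in>UNIV. exp_coeff X i l k * Y $ l $ j) = (\<Sum>l\<in>UNIV. Y $ i $ l * exp_coeff X l j k)"
    for i j k
    using arg_cong [OF mpow_commute [OF assms, of k], of "\<lambda>M. M $ i $ j / fact k"]
    by (simp add: matrix_matrix_mult_def exp_coeff_def sum_divide_distrib)
  then show ?thesis
    by (simp add: vec_eq_iff matrix_mul_mexp_entry mexp_matrix_mul_entry)
qed

text \<open>In termwise differentiation \<open>diffs\<close> moves each coefficient down one place,
  and its factor cancels against the factorial; what remains is one extra factor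
  \<open>X\<close>.\<close>

lemma mexp_cscale_has_field_derivative:
  "((\<lambda>w. mexp (cscale w X) $ i $ j) has_field_derivative (X ** mexp (cscale w X)) $ i $ j) (at w)"
proof -
  have "((\<lambda>w. \<Sum>k. exp_coeff X i j k * w ^ k) has_field_derivative
      (\<Sum>k. diffs (exp_coeff X i j) k * w ^ k)) (at w)"
    by (intro termdiffs_strong_converges_everywhere summable_exp_coeff)
  moreover have "diffs (exp_coeff X i j) k = (\<Sum>l\<in>UNIV. X $ i $ l * exp_coeff X l j k)" for k
    by (simp add: diffs_def exp_coeff_def mpow_Suc matrix_matrix_mult_def sum_divide_distrib
        sum_distrib_left del: of_nat_Suc)
  ultimately show ?thesis
    by (simp add: matrix_mul_mexp_entry mexp_cscale_entry)
qed

section \<open>Real one-parameter groups\<close>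

lemma has_vector_derivative_matrix:
  fixes M :: "real \<Rightarrow> 'n::finite cmat"
  assumes "\<And>i j. ((\<lambda>t. M t $ i $ j) has_vector_derivative M' $ i $ j) (at t)"
  shows "(M has_vector_derivative M') (at t)"
  unfolding has_vector_derivative_def has_derivative_within
proof (intro conjI vec_tendstoI)
  fix i j
  have "((\<lambda>s. (1 / norm (s - t)) *\<^sub>R (M s $ i $ j - (M t $ i $ j + (s - t) *\<^sub>R M' $ i $ j)))
      \<longlongrightarrow> 0) (at t)"
    using assms unfolding has_vector_derivative_def has_derivative_within by blast
  then show "((\<lambda>s. ((1 / norm (s - t)) *\<^sub>R (M s - (M t + (s - t) *\<^sub>R M'))) $ i $ j)
      \<longlongrightarrow> 0 $ i $ j) (at t)"
    by simp
qed (rule bounded_linear_scaleR_left)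

lemma has_vector_derivative_zero_imp_eq:
  fixes \<phi> :: "real \<Rightarrow> 'a::real_normed_vector"
  assumes "\<And>t. (\<phi> has_vector_derivative 0) (at t)"
  shows "\<phi> s = \<phi> t"
proof -
  have "(\<phi> has_derivative (\<lambda>h. 0)) (at r within UNIV)" for r
    using assms by (simp add: has_vector_derivative_def)
  then show ?thesis
    using has_derivative_zero_constant [OF convex_UNIV, of \<phi>] by auto
qed

lemma mexp_has_vector_derivative:
  "((\<lambda>t. mexp (t *\<^sub>R X)) has_vector_derivative (X ** mexp (t *\<^sub>R X))) (at t)"
proof (rule has_vector_derivative_matrix)
  fix i j
  have "((\<lambda>w. mexp (cscale w X) $ i $ j) \<circ> complex_of_real has_vector_derivative
      1 * (X ** mexp (cscale (complex_of_real t) X)) $ i $ j) (at t)"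
    by (rule field_vector_diff_chain_at [OF _ mexp_cscale_has_field_derivative])
      (auto intro!: derivative_eq_intros)
  then show "((\<lambda>t. mexp (t *\<^sub>R X) $ i $ j) has_vector_derivative (X ** mexp (t *\<^sub>R X)) $ i $ j) (at t)"
    by (simp add: o_def cscale_of_real)
qed

lemma mexp_zero [simp]: "mexp 0 = mat 1"
proof -
  have "mexp (cscale 0 0) $ i $ j = mat 1 $ i $ j" for i j :: 'a
    unfolding mexp_cscale_entry powser_zero by (simp add: exp_coeff_def)
  then show ?thesis
    by (simp add: vec_eq_iff)
qed

lemma mexp_scaleR_commute:
  "X ** Y = Y ** X \<Longrightarrow> mexp (t *\<^sub>R X) ** Y = Y ** mexp (t *\<^sub>R X)"
  using mexp_cscale_commute [of X Y "complex_of_real t"] by (simp add: cscale_of_real)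

lemmas has_vector_derivative_matrix_mul =
  bounded_bilinear.has_vector_derivative [OF bounded_bilinear_matrix_mul]

text \<open>The product \<open>\<phi> r\<close> is constant: its factors contribute \<open>X\<close>
  and \<open>- X\<close>, which cancel because \<open>X\<close> commutes with its exponential. Its
  values at 0 and at \<open>s\<close> are the two sides.\<close>

lemma mexp_add: "mexp ((s + t) *\<^sub>R X) = mexp (s *\<^sub>R X) ** mexp (t *\<^sub>R X)"
proof -
  define \<phi> where "\<phi> r = mexp (r *\<^sub>R X) ** mexp ((s + t - r) *\<^sub>R X)" for r
  have "(\<phi> has_vector_derivative 0) (at r)" for r
  proof -
    have "((\<lambda>r. mexp ((s + t - r) *\<^sub>R X)) has_vector_derivative
        (- 1) *\<^sub>R (X ** mexp ((s + t - r) *\<^sub>R X))) (at r)"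
      using vector_diff_chain_at [OF _ mexp_has_vector_derivative, of "\<lambda>r. s + t - r" "- 1" r X]
      using has_vector_derivative_diff [OF has_vector_derivative_const [of "s + t"]
          has_vector_derivative_id] by (simp add: o_def)
    note has_vector_derivative_matrix_mul [OF mexp_has_vector_derivative [of X r] this]
    moreover have "mexp (r *\<^sub>R X) ** X = X ** mexp (r *\<^sub>R X)"
      by (rule mexp_scaleR_commute) simp
    ultimately show ?thesis
      by (simp add: \<phi>_def [abs_def] matrix_mul_minus_right matrix_mul_assoc)
  qed
  then have "\<phi> 0 = \<phi> s"
    by (rule has_vector_derivative_zero_imp_eq)
  then show ?thesis
    by (simp add: \<phi>_def)
qed

lemma mexp_neg: "mexp (t *\<^sub>R X) ** mexp (- (t *\<^sub>R X)) = mat 1" "mexp (- (t *\<^sub>R X)) ** mexp (t *\<^sub>R X) = mat 1"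
  using mexp_add [of t "- t" X] mexp_add [of "- t" t X] by simp_all

lemma invertible_mexp: "invertible (mexp X)"
  using mexp_neg [of 1 X] by (auto simp: invertible_def)

lemma matrix_inv_mexp: "matrix_inv (mexp X) = mexp (- X)"
  using mexp_neg [of 1 X] by (auto intro: matrix_invI)

text \<open>Both sides, along t \<open>X\<close>, solve the same linear differential equation. Hence
  \<open>\<phi>\<close>, the inverse of one solution times the other, is constant, and it is
  compared at 0 and 1.\<close>

lemma mexp_conj:
  fixes X g h :: "'n::finite cmat"
  assumes "h ** g = mat 1" "g ** h = mat 1"
  shows "mexp (g ** X ** h) = g ** mexp X ** h"
proof -
  define \<phi> where "\<phi> t = mexp (t *\<^sub>R - (g ** X ** h)) ** (g ** mexp (t *\<^sub>R X) ** h)" for t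
  have "(\<phi> has_vector_derivative 0) (at t)" for t
  proof -
    let ?Y = "g ** X ** h"
    have "((\<lambda>t. g ** mexp (t *\<^sub>R X) ** h) has_vector_derivative g ** (X ** mexp (t *\<^sub>R X)) ** h) (at t)"
      by (intro bounded_linear.has_vector_derivative
          [OF bounded_linear_compose [OF
            bounded_bilinear.bounded_linear_left [OF bounded_bilinear_matrix_mul]
            bounded_bilinear.bounded_linear_right [OF bounded_bilinear_matrix_mul]]]
          mexp_has_vector_derivative)
    moreover have "g ** (X ** mexp (t *\<^sub>R X)) ** h = ?Y ** (g ** mexp (t *\<^sub>R X) ** h)"
      by (metis assms(1) matrix_mul_assoc matrix_mul_lid)
    ultimately have "((\<lambda>t. g ** mexp (t *\<^sub>R X) ** h) has_vector_derivative
        ?Y ** (g ** mexp (t *\<^sub>R X) ** h)) (at t)"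
      by simp
    from has_vector_derivative_matrix_mul [OF mexp_has_vector_derivative [of "- ?Y" t] this]
    have "(\<phi> has_vector_derivative mexp (t *\<^sub>R - ?Y) ** (?Y ** (g ** mexp (t *\<^sub>R X) ** h))
        + - ?Y ** mexp (t *\<^sub>R - ?Y) ** (g ** mexp (t *\<^sub>R X) ** h)) (at t)"
      by (simp add: \<phi>_def [abs_def])
    moreover have "mexp (t *\<^sub>R - ?Y) ** ?Y = ?Y ** mexp (t *\<^sub>R - ?Y)"
      by (intro mexp_scaleR_commute) (simp add: matrix_mul_algebra)
    then have "mexp (t *\<^sub>R - ?Y) ** (?Y ** (g ** mexp (t *\<^sub>R X) ** h))
        + - ?Y ** mexp (t *\<^sub>R - ?Y) ** (g ** mexp (t *\<^sub>R X) ** h) = 0"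
      unfolding matrix_mul_assoc by (simp add: matrix_mul_assoc matrix_mul_minus_left)
    ultimately show ?thesis
      by simp
  qed
  then have "\<phi> 0 = \<phi> 1"
    by (rule has_vector_derivative_zero_imp_eq)
  then have "mexp (- (g ** X ** h)) ** (g ** mexp X ** h) = mat 1"
    using assms by (simp add: \<phi>_def)
  then show ?thesis
    using mexp_neg [of 1 "g ** X ** h"] by (metis matrix_mul_assoc matrix_mul_lid matrix_mul_rid scaleR_one)
qed

lemma mexp_Ad_has_vector_derivative:
  "((\<lambda>t. mexp (t *\<^sub>R X) ** Y ** mexp (- (t *\<^sub>R X))) has_vector_derivative commutator X Y) (at 0)"
proof -
  have "((\<lambda>t. mexp (t *\<^sub>R X) ** Y) has_vector_derivative X ** Y) (at 0)"
    using has_vector_derivative_matrix_mul [OF mexp_has_vector_derivative [of X 0]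
        has_vector_derivative_const [of Y]] by simp
  moreover have "((\<lambda>t. mexp (- (t *\<^sub>R X))) has_vector_derivative - X) (at 0)"
    using mexp_has_vector_derivative [of "- X" 0] by simp
  ultimately show ?thesis
    using has_vector_derivative_matrix_mul [of "\<lambda>t. mexp (t *\<^sub>R X) ** Y" "X ** Y" 0 UNIV]
    by (fastforce simp: commutator_def matrix_mul_minus_right)
qed

section \<open>Diagonalizable operators\<close>

text \<open>Linear dependence is a property of sets, so a sequence with a repeated vector needs its
  own case, with coefficients 1 and -1 at two equal terms.\<close>

lemma sequence_dependent:
  fixes x :: "nat \<Rightarrow> 'a::euclidean_space"
  obtains c where "\<exists>k\<le>DIM('a). c k \<noteq> 0" "(\<Sum>k\<le>DIM('a). c k *\<^sub>R x k) = 0"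
proof (cases "inj_on x {..DIM('a)}")
  case True
  then have "dependent (x ` {..DIM('a)})"
    by (intro dependent_biggerset) (simp add: card_image)
  then obtain u where u: "\<exists>v\<in>x ` {..DIM('a)}. u v \<noteq> 0" "(\<Sum>v\<in>x ` {..DIM('a)}. u v *\<^sub>R v) = 0"
    by (auto simp: dependent_finite)
  show ?thesis
  proof (rule that [of "u \<circ> x"])
    show "\<exists>k\<le>DIM('a). (u \<circ> x) k \<noteq> 0"
      using u(1) by auto
    show "(\<Sum>k\<le>DIM('a). (u \<circ> x) k *\<^sub>R x k) = 0"
      using u(2) by (simp add: sum.reindex [OF True])
  qed
next
  case False
  then obtain i j where ij: "i \<le> DIM('a)" "j \<le> DIM('a)" "i \<noteq> j" "x i = x j"
    by (auto simp: inj_on_def)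
  let ?c = "\<lambda>k. if k = i then 1 else if k = j then - 1 else (0::real)"
  have "(\<Sum>k\<le>DIM('a). ?c k *\<^sub>R x k) = (\<Sum>k\<le>DIM('a). (if k = i then x i else 0) - (if k = j then x j else 0))"
    using ij by (intro sum.cong) auto
  also have "\<dots> = 0"
    using ij by (simp add: sum_subtractf)
  finally show ?thesis
  proof (intro that [of ?c])
    show "\<exists>k\<le>DIM('a). ?c k \<noteq> 0"
      using ij(1) by (intro exI [of _ i]) simp
  qed
qed

context
  fixes T :: "'n::finite cmat \<Rightarrow> 'n cmat"
  assumes lin: "linear T" and clin: "\<And>c X. T (cscale c X) = cscale c (T X)"
begin

lemma linear_funpow: "linear (T ^^ k)"
proof (induction k)
  case 0
  then show ?case using linear_id by (simp add: id_def)
next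
  case (Suc k)
  then show ?case using linear_compose [OF Suc lin] by (simp add: o_def)
qed

lemma funpow_cscale: "(T ^^ k) (cscale c X) = cscale c ((T ^^ k) X)"
  by (induction k) (simp_all add: clin)

text \<open>The sum is P(T) v. Over the complex numbers P splits off a root a, and P(T) v = Q(T) (T
  - a) v, so the induction continues with \<open>Q\<close> and the vector (T - a) v.\<close>

lemma annihilating_polynomial_factors:
  "P \<noteq> 0 \<Longrightarrow> degree P = n \<Longrightarrow> (\<Sum>k\<le>n. cscale (coeff P k) ((T ^^ k) v)) = 0
    \<Longrightarrow> \<exists>as. fold (\<lambda>a u. T u - cscale a u) as v = 0"
proof (induction n arbitrary: P v)
  case 0
  then have "coeff P 0 \<noteq> 0"
    by (metis leading_coeff_0_iff)
  with 0 have "v = 0"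
    by (simp add: cscale_eq_0_iff)
  then show ?case
    by (intro exI [of _ "[]"]) simp
next
  case (Suc n)
  have "\<not> constant (poly P)"
    using Suc.prems by (simp add: constant_degree)
  then obtain a where "poly P a = 0"
    using fundamental_theorem_of_algebra by blast
  then obtain Q where P: "P = [:- a, 1:] * Q"
    by (metis poly_eq_0_iff_dvd dvdE)
  have Q: "Q \<noteq> 0" "degree Q = n"
    using Suc.prems(1,2) degree_mult_eq [of "[:- a, 1:]" Q] by (auto simp: P simp del: mult_pCons_left)
  have Qn: "coeff Q (Suc n) = 0"
    using Q by (simp add: coeff_eq_0)
  let ?t = "\<lambda>k. (T ^^ k) v"
  \<comment> \<open>The case expression is the coefficient of the variable times
    \<open>Q\<close>.\<close>
  have cP: "coeff P k = (case k of 0 \<Rightarrow> 0 | Suc j \<Rightarrow> coeff Q j) - a * coeff Q k" for k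
    by (cases k) (simp_all add: P coeff_pCons)
  have "(\<Sum>k\<le>Suc n. cscale (coeff P k) (?t k))
      = (\<Sum>k\<le>Suc n. cscale (case k of 0 \<Rightarrow> 0 | Suc j \<Rightarrow> coeff Q j) (?t k))
        - (\<Sum>k\<le>Suc n. cscale (a * coeff Q k) (?t k))"
    unfolding cP by (simp add: sum_subtractf [symmetric] cscale_def vec_eq_iff algebra_simps
        del: sum.atMost_Suc)
  also have "(\<Sum>k\<le>Suc n. cscale (case k of 0 \<Rightarrow> 0 | Suc j \<Rightarrow> coeff Q j) (?t k))
      = (\<Sum>k\<le>n. cscale (coeff Q k) (?t (Suc k)))"
    by (subst sum.atMost_Suc_shift) simp
  also have "(\<Sum>k\<le>Suc n. cscale (a * coeff Q k) (?t k)) = (\<Sum>k\<le>n. cscale (a * coeff Q k) (?t k))"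
    by (simp add: Qn)
  also have "(\<Sum>k\<le>n. cscale (coeff Q k) (?t (Suc k))) - (\<Sum>k\<le>n. cscale (a * coeff Q k) (?t k))
      = (\<Sum>k\<le>n. cscale (coeff Q k) ((T ^^ k) (T v - cscale a v)))"
    by (simp add: sum_subtractf [symmetric] linear_diff [OF linear_funpow] funpow_cscale
        cscale_diff_right cscale_cscale funpow_swap1 mult.commute)
  finally have "(\<Sum>k\<le>n. cscale (coeff Q k) ((T ^^ k) (T v - cscale a v))) = 0"
    using Suc.prems by simp
  from Suc.IH [OF Q this] obtain as where "fold (\<lambda>a u. T u - cscale a u) as (T v - cscale a v) = 0"
    by blast
  then show ?case
    by (intro exI [of _ "a # as"]) simp
qed

text \<open>One more iterate of \<open>v\<close> than the real dimension gives a real linear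
  relation, which is read as a complex polynomial in \<open>T\<close> and then factored.\<close>

lemma annihilating_factors: "\<exists>as. fold (\<lambda>a u. T u - cscale a u) as v = 0"
proof -
  let ?N = "DIM('n cmat)"
  obtain c where c: "\<exists>k\<le>?N. c k \<noteq> 0" "(\<Sum>k\<le>?N. c k *\<^sub>R (T ^^ k) v) = 0"
    by (rule sequence_dependent)
  define P where "P = (\<Sum>k\<le>?N. monom (complex_of_real (c k)) k)"
  have cP: "coeff P k = (if k \<le> ?N then complex_of_real (c k) else 0)" for k
    by (simp add: P_def coeff_sum)
  then have "P \<noteq> 0"
    using c(1) by (metis coeff_0 of_real_eq_0_iff)
  have "degree P \<le> ?N"
    by (rule degree_le) (simp add: cP)
  then have "(\<Sum>k\<le>degree P. cscale (coeff P k) ((T ^^ k) v))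
      = (\<Sum>k\<le>?N. cscale (coeff P k) ((T ^^ k) v))"
    by (intro sum.mono_neutral_left) (auto simp: coeff_eq_0)
  also have "\<dots> = (\<Sum>k\<le>?N. c k *\<^sub>R (T ^^ k) v)"
    by (intro sum.cong) (simp_all add: cP cscale_of_real)
  finally show ?thesis
    using annihilating_polynomial_factors [OF \<open>P \<noteq> 0\<close> refl] c(2) by simp
qed

text \<open>Induction over the factors T - a that annihilate \<open>v\<close>. The hypothesis
  \<open>semisimple\<close> excludes Jordan blocks: the kernel of (T - l)^2 is that of T - l. So
  removing one factor never leads out of the span of the eigenvectors.\<close>

lemma span_eigenvectors:
  assumes V: "complex_subspace V" "\<And>v. v \<in> V \<Longrightarrow> T v \<in> V"
    and ev: "\<And>v a. v \<in> V \<Longrightarrow> v \<noteq> 0 \<Longrightarrow> T v = cscale a v \<Longrightarrow> \<exists>l\<in>I. a = complex_of_real l"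
    and semisimple: "\<And>v l. v \<in> V \<Longrightarrow> T (T v - l *\<^sub>R v) = l *\<^sub>R (T v - l *\<^sub>R v) \<Longrightarrow> T v = l *\<^sub>R v"
    and "v \<in> V"
  shows "v \<in> span (\<Union>l\<in>I. {u \<in> V. T u = l *\<^sub>R u})"
proof -
  let ?E = "\<Union>l\<in>I. {u \<in> V. T u = l *\<^sub>R u}"
  have subV: "subspace V"
    using V(1) unfolding complex_subspace_def subspace_def by (metis cscale_of_real)
  have spanV: "span ?E \<subseteq> V"
    by (intro span_minimal subV) auto
  obtain as where "fold (\<lambda>a u. T u - cscale a u) as v = 0"
    using annihilating_factors by blast
  then show ?thesis
    using \<open>v \<in> V\<close>
  proof (induction as arbitrary: v)
    case Nil
    then show ?case by (simp add: span_zero)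
  next
    case (Cons a as)
    let ?D = "\<lambda>u. T u - cscale a u"
    have linD: "linear ?D"
      by (intro linear_compose_sub lin linear_cscale)
    have DV: "?D w \<in> V" if "w \<in> V" for w
      using that V subspace_diff [OF subV] by (auto simp: complex_subspace_def)
    have "?D v \<in> span ?E"
      using Cons.IH [of "?D v"] Cons.prems DV by simp
    \<comment> \<open>\<open>?S\<close> collects the vectors that are, up to an a-eigenvector
      \<open>u0\<close>, the image under \<open>?D\<close> of an element of the span. It is a
      subspace, so it suffices to place the eigenvectors in it.\<close>
    moreover have "subspace {u. \<exists>v1\<in>span ?E. \<exists>u0\<in>V. ?D v1 = u - u0 \<and> T u0 = cscale a u0}"
      (is "subspace ?S")
      unfolding subspace_def
    proof (intro conjI ballI allI)
      show "0 \<in> ?S"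
        using linear_0 [OF lin] by (auto intro!: bexI [of _ 0] simp: span_zero subspace_0 subV)
    next
      fix x y assume "x \<in> ?S" "y \<in> ?S"
      then obtain x1 x0 y1 y0 where "x1 \<in> span ?E" "x0 \<in> V" "?D x1 = x - x0" "T x0 = cscale a x0"
        "y1 \<in> span ?E" "y0 \<in> V" "?D y1 = y - y0" "T y0 = cscale a y0"
        by blast
      then have "x1 + y1 \<in> span ?E" "x0 + y0 \<in> V" "?D (x1 + y1) = (x + y) - (x0 + y0)"
        "T (x0 + y0) = cscale a (x0 + y0)"
        using linear_add [OF lin] linear_add [OF linD, of x1 y1]
        by (simp_all add: span_add subspace_add [OF subV] cscale_add_right)
      then show "x + y \<in> ?S"
        by blast
    next
      fix r x assume "x \<in> ?S"
      then obtain x1 x0 where "x1 \<in> span ?E" "x0 \<in> V" "?D x1 = x - x0" "T x0 = cscale a x0"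
        by blast
      then have "r *\<^sub>R x1 \<in> span ?E" "r *\<^sub>R x0 \<in> V" "?D (r *\<^sub>R x1) = r *\<^sub>R x - r *\<^sub>R x0"
        "T (r *\<^sub>R x0) = cscale a (r *\<^sub>R x0)"
        using linear_scale [OF lin] linear_scale [OF linD, of r x1]
        by (simp_all add: span_scale subspace_scale [OF subV] cscale_scaleR flip: scaleR_diff_right)
      then show "r *\<^sub>R x \<in> ?S"
        by blast
    qed
    moreover have "u \<in> ?S" if "u \<in> ?E" for u
    proof -
      from that obtain l where l: "l \<in> I" "u \<in> V" "T u = l *\<^sub>R u"
        by blast
      show ?thesis
      proof (cases "complex_of_real l = a")
        case True
        have "0 \<in> span ?E" "?D 0 = u - u" "T u = cscale a u"
          using l True linear_0 [OF lin] by (simp_all add: span_zero cscale_of_real [symmetric])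
        with l(2) show ?thesis by blast
      next
        case False
        \<comment> \<open>On the eigenspace of \<open>l\<close> the operator \<open>?D\<close> is
          multiplication by l - a, which is inverted here.\<close>
        let ?w = "cscale (1 / (complex_of_real l - a)) u"
        have "T ?w = l *\<^sub>R ?w"
          by (simp add: clin l cscale_scaleR)
        then have "?w \<in> span ?E"
          using l V by (intro span_base) (auto simp: complex_subspace_def)
        moreover have "?D ?w = u - 0"
          using False
          by (simp add: clin l cscale_of_real [symmetric] cscale_cscale)
            (simp add: cscale_def vec_eq_iff divide_simps, simp add: algebra_simps)
        ultimately show ?thesis
          using linear_0 [OF lin] subspace_0 [OF subV] by force
      qed
    qed
    ultimately have "?D v \<in> ?S"
      using span_minimal [of ?E ?S] by blast
    then obtain v1 u0 where v1: "v1 \<in> span ?E" "u0 \<in> V" "?D v1 = ?D v - u0" "T u0 = cscale a u0"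
      by blast
    have v': "v - v1 \<in> V" "?D (v - v1) = u0"
      using v1 spanV Cons.prems linear_diff [OF linD, of v v1] by (auto intro: subspace_diff [OF subV])
    \<comment> \<open>Otherwise \<open>a\<close> is real and \<open>v - v1\<close> is a generalized
      eigenvector of height two, contrary to \<open>semisimple\<close>.\<close>
    have "u0 = 0"
    proof (rule ccontr)
      assume "u0 \<noteq> 0"
      then obtain l where "a = complex_of_real l"
        using ev v1 by blast
      with v' v1 semisimple [of "v - v1" l] \<open>u0 \<noteq> 0\<close> show False
        by (simp add: cscale_of_real)
    qed
    then have "v - v1 \<in> span ?E"
      using ev [of "v - v1" a] v'
      by (cases "v - v1 = 0") (auto simp: span_zero cscale_of_real intro!: span_base)
    then show ?case
      using span_add [OF _ v1(1)] by fastforce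
  qed
qed

end

text \<open>Applying T - l to the sum deletes the component at \<open>l\<close> and multiplies each
  other component by k - l, which is nonzero; the result stays in the invariant subspace, and
  induction on \<open>F\<close> applies.\<close>

lemma eigenvector_components:
  fixes T :: "'a::real_vector \<Rightarrow> 'a"
  assumes "linear T" "subspace W" "\<And>w. w \<in> W \<Longrightarrow> T w \<in> W" "finite F"
  shows "\<forall>l\<in>F. T (x l) = l *\<^sub>R x l \<Longrightarrow> (\<Sum>l\<in>F. x l) \<in> W \<Longrightarrow> \<forall>l\<in>F. x l \<in> W"
  using \<open>finite F\<close>
proof (induction F arbitrary: x)
  case (insert l F)
  let ?v = "\<Sum>k\<in>insert l F. x k"
  have "T ?v - l *\<^sub>R ?v \<in> W"
    using assms insert.prems by (intro subspace_diff subspace_scale) auto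
  also have "T ?v - l *\<^sub>R ?v = (\<Sum>k\<in>insert l F. (k - l) *\<^sub>R x k)"
    using insert.prems
    by (simp only: linear_sum [OF \<open>linear T\<close>] scaleR_sum_right sum_subtractf [symmetric])
      (intro sum.cong, auto simp: algebra_simps)
  also have "\<dots> = (\<Sum>k\<in>F. (k - l) *\<^sub>R x k)"
    using insert by simp
  finally have F: "\<forall>k\<in>F. (k - l) *\<^sub>R x k \<in> W"
    using insert.prems linear_scale [OF \<open>linear T\<close>] by (intro insert.IH) auto
  have x: "x k \<in> W" if "k \<in> F" for k
  proof -
    have "k - l \<noteq> 0"
      using that insert.hyps by auto
    then have "x k = (1 / (k - l)) *\<^sub>R (k - l) *\<^sub>R x k"
      by simp
    with F that show ?thesis
      using subspace_scale [OF \<open>subspace W\<close>] by metis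
  qed
  have "(\<Sum>k\<in>F. x k) \<in> W"
    by (intro x subspace_sum assms)
  then have "?v - (\<Sum>k\<in>F. x k) \<in> W"
    using insert.prems assms by (intro subspace_diff) auto
  with x insert.hyps show ?case
    by auto
qed simp

text \<open>Eigenvectors for different eigenvalues are independent, by the preceding lemma with the
  zero subspace as \<open>W\<close>; an independent set is finite in finite dimension.\<close>

lemma finite_eigenvalues:
  fixes T :: "'a::euclidean_space \<Rightarrow> 'a"
  assumes "linear T"
  shows "finite {l. \<exists>v. v \<noteq> 0 \<and> T v = l *\<^sub>R v}"
proof -
  let ?L = "{l. \<exists>v. v \<noteq> 0 \<and> T v = l *\<^sub>R v}"
  obtain y where y: "\<And>l. l \<in> ?L \<Longrightarrow> y l \<noteq> 0 \<and> T (y l) = l *\<^sub>R y l"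
    by (rule that [of "\<lambda>l. SOME v. v \<noteq> 0 \<and> T v = l *\<^sub>R v"]) (metis (mono_tags, lifting) mem_Collect_eq someI_ex)
  have inj: "inj_on y ?L"
    by (rule inj_onI) (metis y scaleR_cancel_right)
  have "independent (y ` ?L)"
    unfolding dependent_explicit
  proof clarify
    fix t u v assume t: "finite t" "t \<subseteq> y ` ?L" "(\<Sum>v\<in>t. u v *\<^sub>R v) = 0" "v \<in> t" "u v \<noteq> 0"
    then obtain F where F: "F \<subseteq> ?L" "t = y ` F"
      by (meson subset_imageE)
    then have injF: "inj_on y F"
      using inj by (rule_tac inj_on_subset)
    then have "finite F"
      using t F by (simp add: finite_image_iff)
    moreover have "(\<Sum>l\<in>F. u (y l) *\<^sub>R y l) \<in> {0}"
      using t F by (simp add: sum.reindex [OF injF])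
    moreover have "\<forall>l\<in>F. T (u (y l) *\<^sub>R y l) = l *\<^sub>R (u (y l) *\<^sub>R y l)"
    proof
      fix l assume "l \<in> F"
      then have "T (y l) = l *\<^sub>R y l"
        using F y by blast
      then show "T (u (y l) *\<^sub>R y l) = l *\<^sub>R (u (y l) *\<^sub>R y l)"
        by (simp add: linear_scale [OF assms] mult.commute)
    qed
    ultimately have "\<forall>l\<in>F. u (y l) *\<^sub>R y l \<in> {0}"
      using eigenvector_components [OF assms subspace_single_0, of F "\<lambda>l. u (y l) *\<^sub>R y l"]
        linear_0 [OF assms] by simp
    moreover obtain l where "l \<in> F" "v = y l"
      using t F by blast
    moreover have "y l \<noteq> 0"
      using F \<open>l \<in> F\<close> y by blast
    ultimately show False
      using t by auto
  qed
  then show ?thesis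
    using inj independent_imp_finite finite_imageD by blast
qed

lemma span_Union_decomposition:
  fixes E :: "'i \<Rightarrow> 'a::real_vector set"
  assumes "\<And>l. l \<in> I \<Longrightarrow> subspace (E l)" "v \<in> span (\<Union>l\<in>I. E l)"
  shows "\<exists>x. (\<forall>l\<in>I. x l \<in> E l) \<and> (\<forall>l. l \<notin> I \<longrightarrow> x l = 0) \<and> finite {l. x l \<noteq> 0} \<and>
    v = (\<Sum>l | x l \<noteq> 0. x l)"
  using assms(2)
proof (induction rule: span_induct_alt)
  case base
  show ?case
    using assms(1) by (intro exI [of _ "\<lambda>_. 0"]) (simp add: subspace_0)
next
  case (step c u w)
  then obtain x k where x: "\<forall>l\<in>I. x l \<in> E l" "\<forall>l. l \<notin> I \<longrightarrow> x l = 0" "finite {l. x l \<noteq> 0}"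
    "w = (\<Sum>l | x l \<noteq> 0. x l)" and k: "k \<in> I" "u \<in> E k"
    by blast
  \<comment> \<open>The new multiple of \<open>u\<close> is absorbed into the component at
    \<open>k\<close>; that component may have been zero before or become zero now, hence the sum
    over the larger set \<open>?F\<close>.\<close>
  define y where "y = x(k := c *\<^sub>R u + x k)"
  let ?F = "insert k {l. x l \<noteq> 0}"
  have y: "{l. y l \<noteq> 0} \<subseteq> ?F" "finite ?F"
    using x by (auto simp: y_def)
  have "(\<Sum>l | y l \<noteq> 0. y l) = (\<Sum>l\<in>?F. y l)"
    using y by (intro sum.mono_neutral_left) auto
  also have "\<dots> = (\<Sum>l\<in>?F. (if l = k then c *\<^sub>R u else 0) + x l)"
    by (intro sum.cong) (auto simp: y_def)
  also have "\<dots> = c *\<^sub>R u + (\<Sum>l\<in>?F. x l)"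
    unfolding sum.distrib using y(2) by (subst sum.delta) auto
  also have "(\<Sum>l\<in>?F. x l) = w"
    unfolding x(4) using y by (intro sum.mono_neutral_right) auto
  finally have "c *\<^sub>R u + w = (\<Sum>l | y l \<noteq> 0. y l)"
    by simp
  moreover have "\<forall>l\<in>I. y l \<in> E l" "\<forall>l. l \<notin> I \<longrightarrow> y l = 0"
    using x k assms(1) by (auto simp: y_def intro!: subspace_add subspace_scale)
  ultimately show ?case
    using y finite_subset by blast
qed

section \<open>Lie algebras of matrix groups\<close>

text \<open>Pairing the curve with a vector orthogonal to \<open>S\<close> gives the zero function,
  so the derivative is orthogonal to it as well; in finite dimension \<open>S\<close> is its own
  double orthogonal complement.\<close>

lemma has_vector_derivative_in_subspace:
  fixes S :: "'a::euclidean_space set"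
  assumes "subspace S" "\<And>t. c t \<in> S" "(c has_vector_derivative d) (at t)"
  shows "d \<in> S"
proof -
  have "d \<in> (S\<^sup>\<bottom>)\<^sup>\<bottom>"
    unfolding orthogonal_comp_def
  proof clarify
    fix x assume "\<forall>y\<in>S. orthogonal y x"
    then have "x \<bullet> c t = 0" for t
      using assms(2) by (metis orthogonal_def inner_commute)
    then have "(\<lambda>t. x \<bullet> c t) = (\<lambda>t. 0)"
      by simp
    moreover have "((\<lambda>t. x \<bullet> c t) has_vector_derivative x \<bullet> d) (at t)"
      by (rule bounded_linear.has_vector_derivative [OF bounded_linear_inner_right assms(3)])
    ultimately have "((\<lambda>t::real. 0) has_vector_derivative x \<bullet> d) (at t)"
      by metis
    then show "orthogonal x d"
      using vector_derivative_unique_at [OF _ has_vector_derivative_const]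
      unfolding orthogonal_def by blast
  qed
  then show ?thesis
    using orthogonal_comp_self [OF assms(1)] by simp
qed

lemma lie_algebra_scaleR: "X \<in> lie_algebra G \<Longrightarrow> r *\<^sub>R X \<in> lie_algebra G"
  by (simp add: lie_algebra_def)

lemma mexp_lie_algebra: "X \<in> lie_algebra G \<Longrightarrow> mexp (t *\<^sub>R X) \<in> G"
  by (simp add: lie_algebra_def)

lemma lie_algebra_mono: "K \<subseteq> G \<Longrightarrow> lie_algebra K \<subseteq> lie_algebra G"
  by (auto simp: lie_algebra_def)

lemma lie_algebra_Ad:
  assumes "matrix_group G" "X \<in> lie_algebra G" "g \<in> G"
  shows "g ** X ** matrix_inv g \<in> lie_algebra G"
  unfolding lie_algebra_def
proof clarify
  fix t
  have "t *\<^sub>R (g ** X ** matrix_inv g) = g ** (t *\<^sub>R X) ** matrix_inv g"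
    by (simp add: matrix_mul_algebra)
  then have "mexp (t *\<^sub>R (g ** X ** matrix_inv g)) = g ** mexp (t *\<^sub>R X) ** matrix_inv g"
    using assms matrix_inv_mult [of g] by (simp add: mexp_conj matrix_group_def)
  then show "mexp (t *\<^sub>R (g ** X ** matrix_inv g)) \<in> G"
    using assms by (simp add: matrix_group_def lie_algebra_def)
qed

text \<open>The commutator is the derivative at 0 of Ad(exp(t X)) Y, a curve that stays in the Lie
  algebra.\<close>

lemma lie_algebra_commutator:
  assumes "matrix_group G" "subspace (lie_algebra G)" "X \<in> lie_algebra G" "Y \<in> lie_algebra G"
  shows "commutator X Y \<in> lie_algebra G"
proof (rule has_vector_derivative_in_subspace [OF assms(2) _ mexp_Ad_has_vector_derivative])
  fix t
  show "mexp (t *\<^sub>R X) ** Y ** mexp (- (t *\<^sub>R X)) \<in> lie_algebra G"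
    using lie_algebra_Ad [OF assms(1,4) mexp_lie_algebra [OF assms(3)], of t]
    by (simp add: matrix_inv_mexp)
qed

section \<open>Lie algebras of linear algebraic groups\<close>

lemma polynomial_on_matrices_sum:
  assumes "finite I" "\<And>i. i \<in> I \<Longrightarrow> polynomial_on_matrices (p i)"
  shows "polynomial_on_matrices (\<lambda>X. \<Sum>i\<in>I. p i X)"
  using assms
  by (induction I rule: finite_induct)
    (auto intro: polynomial_on_matrices.const polynomial_on_matrices.add)

text \<open>\<open>dp g X\<close> is the derivative of \<open>p\<close> at \<open>g\<close> along
  the left-invariant vector field of \<open>X\<close>, built by the sum and product rules. The last
  clause covers every curve with M' = M X, hence all translates of one-parameter groups.\<close>

lemma polynomial_on_matrices_derivation:
  fixes p :: "'n::finite cmat \<Rightarrow> complex"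
  assumes "polynomial_on_matrices p"
  obtains dp where
    "\<And>X. polynomial_on_matrices (\<lambda>g. dp g X)"
    "\<And>g X Y. dp g (X + cscale c Y) = dp g X + c * dp g Y"
    "\<And>M X w. (\<And>i j. ((\<lambda>w. M w $ i $ j) has_field_derivative (M w ** X) $ i $ j) (at w))
      \<Longrightarrow> ((\<lambda>w. p (M w)) has_field_derivative dp (M w) X) (at w)"
proof -
  let ?P = "\<lambda>p dp. (\<forall>X. polynomial_on_matrices (\<lambda>g. dp g X)) \<and>
    (\<forall>g X Y. dp g (X + cscale c Y) = dp g X + c * dp g Y) \<and>
    (\<forall>M X w. (\<forall>i j. ((\<lambda>w. M w $ i $ j) has_field_derivative (M w ** X) $ i $ j) (at w))
      \<longrightarrow> ((\<lambda>w. p (M w)) has_field_derivative dp (M w) X) (at w))"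
  have "\<exists>dp. ?P p dp"
    using assms
  proof (induction rule: polynomial_on_matrices.induct)
    case (const a)
    have "?P (\<lambda>_. a) (\<lambda>_ _. 0)"
      by (auto intro: polynomial_on_matrices.const)
    then show ?case by (rule exI [of _ "\<lambda>_ _. 0"])
  next
    case (entry i j)
    have "?P (\<lambda>X. X $ i $ j) (\<lambda>g X. (g ** X) $ i $ j)"
      by (auto simp: matrix_mul_algebra)
        (auto simp: cscale_def matrix_matrix_mult_def intro!: polynomial_on_matrices_sum
          polynomial_on_matrices.mult polynomial_on_matrices.const polynomial_on_matrices.entry)
    then show ?case by (rule exI [of _ "\<lambda>g X. (g ** X) $ i $ j"])
  next
    case (add p q)
    then obtain dp dq where *: "?P p dp" "?P q dq" by blast
    have "?P (\<lambda>X. p X + q X) (\<lambda>g X. dp g X + dq g X)"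
    proof (intro conjI allI impI)
      fix M :: "complex \<Rightarrow> 'n cmat" and X w assume "\<forall>i j. ((\<lambda>w. M w $ i $ j) has_field_derivative (M w ** X) $ i $ j) (at w)"
      with * show "((\<lambda>w. p (M w) + q (M w)) has_field_derivative dp (M w) X + dq (M w) X) (at w)"
        by (intro DERIV_add) blast+
    qed (use * in \<open>auto intro: polynomial_on_matrices.add simp: algebra_simps\<close>)
    then show ?case by (rule exI [of _ "\<lambda>g X. dp g X + dq g X"])
  next
    case (mult p q)
    then obtain dp dq where *: "?P p dp" "?P q dq" by blast
    have "?P (\<lambda>X. p X * q X) (\<lambda>g X. dp g X * q g + dq g X * p g)"
    proof (intro conjI allI impI)
      fix M :: "complex \<Rightarrow> 'n cmat" and X w assume "\<forall>i j. ((\<lambda>w. M w $ i $ j) has_field_derivative (M w ** X) $ i $ j) (at w)"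
      with * show "((\<lambda>w. p (M w) * q (M w)) has_field_derivative
          dp (M w) X * q (M w) + dq (M w) X * p (M w)) (at w)"
        by (intro DERIV_mult) blast+
    next
      show "polynomial_on_matrices (\<lambda>g. dp g X * q g + dq g X * p g)" for X
        by (intro polynomial_on_matrices.add polynomial_on_matrices.mult) (use * mult.hyps in auto)
    qed (use * in \<open>simp add: algebra_simps\<close>)
    then show ?case by (rule exI [of _ "\<lambda>g X. dp g X * q g + dq g X * p g"])
  qed
  then show ?thesis
    using that by blast
qed

lemma matrix_mul_mexp_cscale_has_field_derivative:
  "((\<lambda>w. (g ** mexp (cscale w X)) $ i $ j) has_field_derivative
    (g ** mexp (cscale w X) ** X) $ i $ j) (at w)"
proof -
  have "((\<lambda>w. (g ** mexp (cscale w X)) $ i $ j) has_field_derivative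
    (g ** (X ** mexp (cscale w X))) $ i $ j) (at w)"
    unfolding matrix_matrix_mult_def [of g]
    by (auto intro!: DERIV_sum DERIV_cmult mexp_cscale_has_field_derivative)
  then show ?thesis
    using mexp_cscale_commute [of X X w] by (simp add: matrix_mul_assoc [symmetric])
qed

lemma mexp_cscale_has_field_derivative':
  "((\<lambda>w. mexp (cscale w X) $ i $ j) has_field_derivative (mexp (cscale w X) ** X) $ i $ j) (at w)"
  using matrix_mul_mexp_cscale_has_field_derivative [of "mat 1"] by simp

text \<open>
  The Lie algebra of an algebraic group \<open>G\<close> consists of the \<open>X\<close> whose left-invariant derivation
  preserves the ideal of \<open>G\<close>; this condition is complex linear in \<open>X\<close>.
\<close>

lemma lie_algebra_add_cscale:
  assumes G: "linear_algebraic_group G" and XY: "X \<in> lie_algebra G" "Y \<in> lie_algebra G"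
  shows "X + cscale c Y \<in> lie_algebra G"
proof -
  define Z where "Z = X + cscale c Y"
  define I where "I = {p. polynomial_on_matrices p \<and> (\<forall>g\<in>G. p g = 0)}"
  have mg: "matrix_group G"
    using G by (simp add: linear_algebraic_group_def)
  \<comment> \<open>The derivation of \<open>Z\<close> maps the ideal \<open>I\<close> of
    \<open>G\<close> into itself: it is a combination of those of \<open>X\<close> and
    \<open>Y\<close>, which send \<open>p\<close> to functions vanishing on
    \<open>G\<close>.\<close>
  have step: "\<exists>q\<in>I. \<forall>w. ((\<lambda>w. p (mexp (cscale w Z))) has_field_derivative q (mexp (cscale w Z))) (at w)"
    if "p \<in> I" for p
  proof -
    obtain dp where dp: "\<And>X. polynomial_on_matrices (\<lambda>g. dp g X)"
      "\<And>g X Y. dp g (X + cscale c Y) = dp g X + c * dp g Y"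
      "\<And>M X w. (\<And>i j. ((\<lambda>w. M w $ i $ j) has_field_derivative (M w ** X) $ i $ j) (at w))
        \<Longrightarrow> ((\<lambda>w. p (M w)) has_field_derivative dp (M w) X) (at w)"
      using polynomial_on_matrices_derivation [of p c] \<open>p \<in> I\<close> unfolding I_def by blast
    \<comment> \<open>For real t the product of \<open>g\<close> and exp(t X) lies in
      \<open>G\<close>, so \<open>p\<close> vanishes along this curve and so does its derivative at
      0.\<close>
    have dp0: "dp g X = 0" if "X \<in> lie_algebra G" "g \<in> G" for g X
    proof -
      have "((\<lambda>w. p (g ** mexp (cscale w X))) has_field_derivative dp g X) (at (complex_of_real 0))"
        using dp(3) [where M = "\<lambda>w. g ** mexp (cscale w X)",
            OF matrix_mul_mexp_cscale_has_field_derivative, of 0] by simp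
      then have "((\<lambda>w. p (g ** mexp (cscale w X))) \<circ> complex_of_real has_vector_derivative
          1 * dp g X) (at 0)"
        by (intro field_vector_diff_chain_at) (auto intro!: derivative_eq_intros)
      moreover have "(\<lambda>w. p (g ** mexp (cscale w X))) \<circ> complex_of_real = (\<lambda>t. 0)"
        using \<open>p \<in> I\<close> that mg
        by (auto simp: I_def o_def cscale_of_real mexp_lie_algebra matrix_group_def)
      ultimately have "((\<lambda>t. 0) has_vector_derivative dp g X) (at (0::real))"
        by simp
      then show ?thesis
        using vector_derivative_unique_at [OF _ has_vector_derivative_const] by blast
    qed
    then have "dp g Z = 0" if "g \<in> G" for g
      using that by (simp add: Z_def dp(2) XY)
    then have "(\<lambda>g. dp g Z) \<in> I"
      using dp(1) by (simp add: I_def)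
    then show ?thesis
      using dp(3) mexp_cscale_has_field_derivative' by fast
  qed
  \<comment> \<open>All complex derivatives of \<open>?h\<close> are again elements of
    \<open>I\<close> along the exponential, so they vanish at w = 0, where the exponential is the
    identity; the entire function \<open>?h\<close> is therefore zero.\<close>
  have vanish: "p (mexp (cscale w Z)) = 0" if "p \<in> I" for p w
  proof -
    let ?h = "\<lambda>w. p (mexp (cscale w Z))"
    have "\<exists>q\<in>I. \<forall>w. (deriv ^^ n) ?h w = q (mexp (cscale w Z))" for n
    proof (induction n)
      case 0
      then show ?case using \<open>p \<in> I\<close> by auto
    next
      case (Suc n)
      then obtain q where q: "q \<in> I" "(deriv ^^ n) ?h = (\<lambda>w. q (mexp (cscale w Z)))"
        by blast
      obtain r where "r \<in> I"
        "\<forall>w. ((\<lambda>w. q (mexp (cscale w Z))) has_field_derivative r (mexp (cscale w Z))) (at w)"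
        using step [OF q(1)] by blast
      with q(2) show ?case
        by (auto intro!: DERIV_imp_deriv)
    qed
    moreover have "q (mexp (cscale 0 Z)) = 0" if "q \<in> I" for q
      using that mg by (simp add: I_def matrix_group_def)
    ultimately have "(deriv ^^ n) ?h 0 = 0" for n
      by metis
    moreover have "?h holomorphic_on UNIV"
      using step [OF \<open>p \<in> I\<close>] by (meson field_differentiable_def holomorphic_on_def
          field_differentiable_at_within)
    ultimately show ?thesis
      using holomorphic_fun_eq_0_on_connected [OF _ open_UNIV connected_UNIV, of ?h 0 w]
      by simp
  qed
  obtain P where P: "\<forall>p\<in>P. polynomial_on_matrices p" "G = {g. invertible g \<and> (\<forall>p\<in>P. p g = 0)}"
    using G by (auto simp: linear_algebraic_group_def)
  have "P \<subseteq> I"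
    using P by (auto simp: I_def)
  then have "mexp (t *\<^sub>R Z) \<in> G" for t
    using vanish [of _ "complex_of_real t"] by (auto simp: P(2) invertible_mexp cscale_of_real)
  then show ?thesis
    by (simp add: lie_algebra_def Z_def)
qed

section \<open>Lie algebras of compact groups\<close>

text \<open>Here \<open>Y\<close> is a matrix whose columns lie in an eigenspace of
  \<open>X\<close>. This form keeps eigenvectors within the matrix algebra.\<close>

lemma mexp_cscale_eigenvector:
  assumes "X ** Y = cscale c Y"
  shows "mexp (cscale w X) ** Y = cscale (exp (w * c)) Y"
proof -
  have pow: "mpow X k ** Y = cscale (c ^ k) Y" for k
    by (induction k) (simp_all add: mpow_Suc matrix_mul_assoc [symmetric] matrix_mul_cscale_right
        assms cscale_cscale mult.commute)
  have "(mexp (cscale w X) ** Y) $ i $ j = exp (w * c) * Y $ i $ j" for i j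
  proof -
    have "(\<Sum>l\<in>UNIV. exp_coeff X i l k * Y $ l $ j) = c ^ k / fact k * Y $ i $ j" for k
      using arg_cong [OF pow [of k], of "\<lambda>M. M $ i $ j / fact k"]
      by (simp add: matrix_matrix_mult_def exp_coeff_def sum_divide_distrib cscale_def)
    moreover have "(\<lambda>k. c ^ k / fact k * Y $ i $ j * w ^ k) sums (exp (w * c) * Y $ i $ j)"
      using sums_mult2 [OF exp_converges [of "w * c"], of "Y $ i $ j"]
      by (simp add: scaleR_conv_of_real power_mult_distrib field_simps)
    ultimately show ?thesis
      by (simp add: mexp_matrix_mul_entry sums_iff)
  qed
  then show ?thesis
    by (simp add: vec_eq_iff cscale_def)
qed

lemma mexp_scaleR_eigenvector:
  "X ** Y = cscale c Y \<Longrightarrow> mexp (t *\<^sub>R X) ** Y = cscale (exp (of_real t * c)) Y"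
  using mexp_cscale_eigenvector [of X Y c "of_real t"] by (simp add: cscale_of_real)

lemma mexp_bounded:
  fixes K :: "'n::finite cmat set"
  assumes "compact K"
  obtains C where "\<And>X t. X \<in> lie_algebra K \<Longrightarrow> norm (mexp (t *\<^sub>R X) ** (Y :: 'n cmat)) \<le> C"
proof -
  have "bounded ((\<lambda>M. M ** Y) ` K)"
    using bounded_bilinear.bounded_linear_left [OF bounded_bilinear_matrix_mul, of Y]
    by (intro bounded_linear_image compact_imp_bounded assms)
  then show ?thesis
    using that mexp_lie_algebra unfolding bounded_iff by blast
qed

lemma affine_bounded_imp_zero:
  fixes W :: "'a::real_normed_vector"
  assumes "\<And>t::real. norm (Y + t *\<^sub>R W) \<le> C"
  shows "W = 0"
proof (rule ccontr)
  assume "W \<noteq> 0"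
  let ?t = "(C + norm Y + 1) / norm W"
  have "C \<ge> 0"
    using assms [of 0] norm_ge_zero order_trans by blast
  then have "norm (?t *\<^sub>R W) = C + norm Y + 1"
    using \<open>W \<noteq> 0\<close> by (simp add: abs_of_nonneg)
  moreover have "norm (?t *\<^sub>R W) \<le> norm (Y + ?t *\<^sub>R W) + norm Y"
    using norm_triangle_ineq4 [of "Y + ?t *\<^sub>R W" Y] by simp
  ultimately show False
    using assms [of ?t] by simp
qed

text \<open>On \<open>Y\<close> the group exp(t X) acts by exp(t c), which must stay bounded for t
  of both signs.\<close>

lemma compact_eigenvalue_imaginary:
  assumes "compact K" "X \<in> lie_algebra K" "X ** Y = cscale c Y" "Y \<noteq> 0"
  shows "Re c = 0"
proof (rule ccontr)
  assume "Re c \<noteq> 0"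
  obtain C where C: "\<And>t. norm (mexp (t *\<^sub>R X) ** Y) \<le> C"
    using mexp_bounded [OF assms(1)] assms(2) by metis
  obtain i j where ij: "Y $ i $ j \<noteq> 0"
    using \<open>Y \<noteq> 0\<close> by (auto simp: vec_eq_iff)
  have *: "exp (t * Re c) * norm (Y $ i $ j) \<le> C" for t
  proof -
    have "exp (t * Re c) * norm (Y $ i $ j) = norm ((mexp (t *\<^sub>R X) ** Y) $ i $ j)"
      by (simp add: mexp_scaleR_eigenvector [OF assms(3)]) (simp add: cscale_def norm_mult)
    also have "\<dots> \<le> C"
      using C order_trans [OF Finite_Cartesian_Product.norm_nth_le Finite_Cartesian_Product.norm_nth_le]
        order_trans by blast
    finally show ?thesis .
  qed
  \<comment> \<open>At t = \<open>?x / Re c\<close> the bound reads exp x \<le> x, against 1 + x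
    \<le> exp x; dividing by \<open>Re c\<close> treats both signs at once.\<close>
  let ?x = "C / norm (Y $ i $ j)"
  have "exp ?x \<le> ?x"
    using * [of "?x / Re c"] ij \<open>Re c \<noteq> 0\<close> by (simp add: divide_simps)
  then show False
    using exp_ge_add_one_self [of ?x] by linarith
qed

text \<open>The last nonzero matrix among the powers of \<open>X\<close> applied to \<open>Y\<close>
  lies in the kernel of \<open>X\<close>.\<close>

lemma mpow_least_annihilating:
  assumes "mpow X m ** Y = 0" "Y \<noteq> 0"
  obtains k where "mpow X k ** Y \<noteq> 0" "X ** (mpow X k ** Y) = 0"
proof -
  let ?n = "LEAST n. mpow X n ** Y = 0"
  have n: "mpow X ?n ** Y = 0"
    by (rule LeastI [of _ m]) (rule assms)
  then have "?n \<noteq> 0"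
    using assms(2) by (metis mpow_0 matrix_mul_lid)
  then obtain k where k: "?n = Suc k"
    using not0_implies_Suc by blast
  then have "mpow X k ** Y \<noteq> 0"
    using not_less_Least [of k "\<lambda>n. mpow X n ** Y = 0"] by simp
  moreover have "X ** (mpow X k ** Y) = 0"
    using n by (simp only: k mpow_Suc matrix_mul_assoc)
  ultimately show ?thesis
    using that by blast
qed

text \<open>If \<open>X\<close> to the power k + 1 is the last nonzero power, then exp(t X) times
  the k-th power is affine in t with that power as slope. Boundedness on the compact group makes the
  slope zero.\<close>

lemma compact_nilpotent:
  assumes "compact K" "X \<in> lie_algebra K" "mpow X m = 0"
  shows "X = 0"
proof (rule ccontr)
  assume "X \<noteq> 0"
  obtain k where k: "mpow X k ** X \<noteq> 0" "X ** (mpow X k ** X) = 0"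
    using mpow_least_annihilating [of X m X thesis] assms(3) \<open>X \<noteq> 0\<close> by simp
  have comm: "mpow X k ** X = X ** mpow X k"
    by (rule mpow_commute) simp
  let ?Y = "mpow X k" and ?W = "X ** mpow X k"
  have W: "mexp (t *\<^sub>R X) ** ?W = ?W" for t
    using mexp_scaleR_eigenvector [of X ?W 0 t] k(2) comm by simp
  have "((\<lambda>t. mexp (t *\<^sub>R X) ** ?Y - t *\<^sub>R ?W) has_vector_derivative 0) (at t)" for t
  proof -
    have "((\<lambda>t. mexp (t *\<^sub>R X) ** ?Y) has_vector_derivative X ** mexp (t *\<^sub>R X) ** ?Y) (at t)"
      using has_vector_derivative_matrix_mul [OF mexp_has_vector_derivative [of X t]
          has_vector_derivative_const [of ?Y]] by simp
    moreover have "X ** mexp (t *\<^sub>R X) ** ?Y = ?W"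
      using W [of t] mexp_scaleR_commute [of X X t] by (simp add: matrix_mul_assoc)
    moreover have "((\<lambda>t. t *\<^sub>R ?W) has_vector_derivative ?W) (at t)"
      by (auto intro!: derivative_eq_intros)
    ultimately show ?thesis
      using has_vector_derivative_diff by fastforce
  qed
  then have c: "mexp (t *\<^sub>R X) ** ?Y - t *\<^sub>R ?W = mexp (0 *\<^sub>R X) ** ?Y - 0 *\<^sub>R ?W" for t
    by (rule has_vector_derivative_zero_imp_eq)
  obtain C where C: "\<And>t. norm (mexp (t *\<^sub>R X) ** ?Y) \<le> C"
    using mexp_bounded [OF assms(1)] assms(2) by metis
  then have "norm (?Y + t *\<^sub>R ?W) \<le> C" for t
    using c [of t] C [of t] by (simp add: diff_eq_eq)
  then have "?W = 0"
    by (rule affine_bounded_imp_zero)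
  then show False
    using k(1) comm by simp
qed

text \<open>All eigenvalues of \<open>B\<close> turn out to be zero, so \<open>B\<close> is
  nilpotent and hence 0 by compactness; then \<open>A\<close> is itself nilpotent and vanishes for
  the same reason.\<close>

lemma compact_complex_nilpotent:
  assumes K: "compact K" "A \<in> lie_algebra K" "B \<in> lie_algebra K"
    and comm: "A ** B = B ** A" and nil: "mpow (A + cscale \<i> B) m = 0"
  shows "A = 0 \<and> B = 0"
proof -
  let ?X = "A + cscale \<i> B"
  have XB: "?X ** B = B ** ?X"
    by (simp add: matrix_mul_algebra comm)
  \<comment> \<open>On the \<open>c\<close>-eigenspace of \<open>B\<close> the nilpotent \<open>A + \<i> B\<close> has a kernel, where \<open>A = - \<i> c\<close>;
    as \<open>A\<close> and \<open>B\<close> both have imaginary eigenvalues, \<open>c = 0\<close>.\<close>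
  have eigen: "c = 0" if U: "B ** U = cscale c U" "U \<noteq> 0" for c U
  proof -
    obtain k where k: "mpow ?X k ** U \<noteq> 0" "?X ** (mpow ?X k ** U) = 0"
      using mpow_least_annihilating [of ?X m U thesis] nil U(2) by simp
    let ?V = "mpow ?X k ** U"
    have BV: "B ** ?V = cscale c ?V"
      using mpow_commute [OF XB, of k] U(1)
      by (metis matrix_mul_assoc matrix_mul_cscale_right)
    then have "A ** ?V = cscale (- (\<i> * c)) ?V"
      using k(2) by (simp add: matrix_mul_add_left matrix_mul_cscale_left cscale_cscale
          cscale_minus_left add_eq_0_iff2)
    then have "Re (- (\<i> * c)) = 0"
      using compact_eigenvalue_imaginary [OF K(1,2)] k(1) by blast
    moreover have "Re c = 0"
      using compact_eigenvalue_imaginary [OF K(1,3) U(1)] U(2) by blast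
    ultimately show ?thesis
      by (simp add: complex_eq_iff)
  qed
  have "\<exists>k. mpow B k ** U = 0" if "fold (\<lambda>a U. B ** U - cscale a U) as U = 0" for as U
    using that
  proof (induction as arbitrary: U)
    case Nil
    then show ?case by simp
  next
    case (Cons a as)
    then obtain k where k: "mpow B k ** (B ** U - cscale a U) = 0"
      by auto
    have BB: "mpow B k ** B = B ** mpow B k"
      by (rule mpow_commute) simp
    then have *: "B ** (mpow B k ** U) = cscale a (mpow B k ** U)"
      using k by (simp add: matrix_mul_diff_right matrix_mul_cscale_right matrix_mul_assoc)
    show ?case
    proof (cases "a = 0")
      case True
      then have "mpow B (Suc k) ** U = 0"
        using * by (simp add: mpow_Suc matrix_mul_assoc)
      then show ?thesis by blast
    next
      case False
      then show ?thesis using eigen [OF *] by blast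
    qed
  qed
  \<comment> \<open>The operator is left multiplication by \<open>B\<close>; starting at the
    identity matrix makes the conclusion one about \<open>B\<close> itself.\<close>
  moreover have "\<exists>as. fold (\<lambda>a U. B ** U - cscale a U) as (mat 1) = 0"
    by (intro annihilating_factors bounded_linear.linear matrix_mul_cscale_right
        bounded_bilinear.bounded_linear_right [OF bounded_bilinear_matrix_mul])
  ultimately obtain k where "mpow B k ** mat 1 = 0"
    by blast
  then have "mpow B k = 0"
    by simp
  then have "B = 0"
    by (rule compact_nilpotent [OF K(1,3)])
  moreover have "A = 0"
    using nil \<open>B = 0\<close> by (intro compact_nilpotent [OF K(1,2)]) simp
  ultimately show ?thesis by simp
qed

section \<open>Weight filtration\<close>

definition i_ad :: "'n::finite cmat \<Rightarrow> 'n cmat \<Rightarrow> 'n cmat" where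
  "i_ad H X = cscale \<i> (commutator H X)"

lemma linear_i_ad: "linear (i_ad H)"
  by (auto intro!: linearI simp: i_ad_def commutator_algebra cscale_algebra)

lemma i_ad_cscale: "i_ad H (cscale c X) = cscale c (i_ad H X)"
  by (simp add: i_ad_def commutator_algebra cscale_cscale mult.commute)

lemma i_ad_mul: "i_ad H (X ** Y) = i_ad H X ** Y + X ** i_ad H Y"
  by (simp add: i_ad_def commutator_derivation cscale_add_right matrix_mul_cscale_left
      matrix_mul_cscale_right)

lemma i_ad_commutator: "i_ad H (commutator X Y) = commutator (i_ad H X) Y + commutator X (i_ad H Y)"
  by (simp add: i_ad_def commutator_jacobi [of H] cscale_add_right commutator_algebra)

lemma ad_eigenspace_eq: "ad_eigenspace L H l = {X \<in> L. i_ad H X = l *\<^sub>R X}"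
  by (simp add: ad_eigenspace_def i_ad_def cscale_of_real)

lemma subspace_complex_subspace: "complex_subspace V \<Longrightarrow> subspace V"
  unfolding complex_subspace_def subspace_def by (metis cscale_of_real)

text \<open>The eigenvectors are taken among all matrices, not only in the stabilizer algebra, so
  that associative products have weights too.\<close>

definition weight_le :: "'n::finite cmat \<Rightarrow> real \<Rightarrow> 'n cmat set" where
  "weight_le H r = span {X. \<exists>l\<le>r. i_ad H X = l *\<^sub>R X}"

lemma subspace_weight_le: "subspace (weight_le H r)"
  by (simp add: weight_le_def)

lemma weight_le_mono: "r \<le> s \<Longrightarrow> weight_le H r \<subseteq> weight_le H s"
  unfolding weight_le_def by (intro span_mono) (auto intro: order_trans)

text \<open>\<open>i_ad H\<close> is a derivation of the matrix product, so eigenvalues add; the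
  spans are then exhausted one argument at a time.\<close>

lemma weight_le_mul:
  assumes "X \<in> weight_le H r" "Y \<in> weight_le H s"
  shows "X ** Y \<in> weight_le H (r + s)"
proof -
  let ?W = "weight_le H (r + s)"
  interpret mul: bounded_bilinear "(**) :: 'a cmat \<Rightarrow> 'a cmat \<Rightarrow> 'a cmat"
    by (rule bounded_bilinear_matrix_mul)
  have base: "X ** Y \<in> ?W" if "l \<le> r" "i_ad H X = l *\<^sub>R X" "m \<le> s" "i_ad H Y = m *\<^sub>R Y" for l m X Y
    unfolding weight_le_def using that
    by (intro span_base CollectI exI [of _ "l + m"])
      (simp add: i_ad_mul matrix_mul_scaleR_left matrix_mul_scaleR_right scaleR_add_left)
  have "X ** Y \<in> ?W" if X: "l \<le> r" "i_ad H X = l *\<^sub>R X" for l X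
  proof -
    have "weight_le H s \<subseteq> {Y. X ** Y \<in> ?W}"
      unfolding weight_le_def [of H s]
      using linear_subspace_vimage [OF bounded_linear.linear [OF mul.bounded_linear_right]
          subspace_weight_le, of X H "r + s"] base [OF X]
      by (intro span_minimal) (auto simp: vimage_def)
    then show ?thesis
      using assms(2) by blast
  qed
  then have "weight_le H r \<subseteq> {X. X ** Y \<in> ?W}"
    unfolding weight_le_def [of H r]
    using linear_subspace_vimage [OF bounded_linear.linear [OF mul.bounded_linear_left]
        subspace_weight_le, of Y H "r + s"]
    by (intro span_minimal) (auto simp: vimage_def)
  then show ?thesis
    using assms(1) by blast
qed

lemma weight_le_commutator:
  assumes "X \<in> weight_le H r" "Y \<in> weight_le H s"
  shows "commutator X Y \<in> weight_le H (r + s)"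
  unfolding commutator_def
  using weight_le_mul [OF assms] weight_le_mul [OF assms(2,1)]
  by (intro subspace_diff subspace_weight_le) (simp_all add: add.commute)

lemma weight_le_trivial: "\<exists>R. \<forall>r\<le>R. weight_le H r = {0}"
proof -
  let ?L = "{l. \<exists>X. X \<noteq> 0 \<and> i_ad H X = l *\<^sub>R X}"
  have fin: "finite ?L"
    by (rule finite_eigenvalues [OF linear_i_ad])
  have "\<exists>R. \<forall>l\<in>?L. R < l"
    using bdd_below_finite [OF fin] unfolding bdd_below_def by (meson lt_ex less_le_trans)
  then obtain R where R: "\<And>l. l \<in> ?L \<Longrightarrow> R < l"
    by blast
  have "weight_le H r = {0}" if "r \<le> R" for r
  proof -
    have "{X. \<exists>l\<le>r. i_ad H X = l *\<^sub>R X} \<subseteq> {0}"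
      using R that by force
    then show ?thesis
      unfolding weight_le_def using span_minimal [OF _ subspace_single_0] span_0 by blast
  qed
  then show ?thesis by blast
qed

text \<open>The finitely many negative eigenvalues stay away from 0, and this uniform gap
  \<open>e\<close> is what makes repeated products leave the spectrum.\<close>

lemma negative_weights:
  obtains e where "e > 0" "\<And>X l. l < 0 \<Longrightarrow> i_ad H X = l *\<^sub>R X \<Longrightarrow> X \<in> weight_le H (- e)"
proof -
  let ?L = "{l. \<exists>X. X \<noteq> 0 \<and> i_ad H X = l *\<^sub>R X} \<inter> {..<0}"
  have fin: "finite ?L"
    using finite_eigenvalues [OF linear_i_ad, of H] by blast
  have "\<exists>e>0. \<forall>l\<in>?L. l \<le> - e"
  proof (cases "?L = {}")
    case True
    then show ?thesis by (metis empty_iff zero_less_one)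
  next
    case False
    then have "Max ?L \<in> ?L" "\<forall>l\<in>?L. l \<le> Max ?L"
      using Max_in [OF fin] Max_ge [OF fin] by blast+
    then show ?thesis
      by (intro exI [of _ "- Max ?L"]) (auto simp only: Int_iff lessThan_iff minus_minus neg_0_less_iff_less)
  qed
  then obtain e where e: "e > 0" "\<And>l. l \<in> ?L \<Longrightarrow> l \<le> - e"
    by blast
  show ?thesis
  proof (rule that [OF e(1)])
    fix X l assume "l < 0" "i_ad H X = l *\<^sub>R X"
    then show "X \<in> weight_le H (- e)"
      using e(2) [of l] by (cases "X = 0") (auto simp: weight_le_def span_zero intro!: span_base)
  qed
qed

text \<open>Each factor lowers the weight by at least \<open>e\<close>, and below the smallest
  eigenvalue only the zero matrix remains.\<close>

lemma weight_le_neg_nilpotent: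
  assumes "e > 0" "X \<in> weight_le H (- e)"
  shows "\<exists>k. mpow X k = 0"
proof -
  have pow: "mpow X (Suc k) \<in> weight_le H (- (real (Suc k) * e))" for k
  proof (induction k)
    case 0
    then show ?case using assms by (simp add: mpow_Suc)
  next
    case (Suc k)
    have "- e + - (real (Suc k) * e) = - (real (Suc (Suc k)) * e)"
      by (simp add: algebra_simps)
    then show ?case
      using weight_le_mul [OF assms(2) Suc] unfolding mpow_Suc [of X "Suc k"] by metis
  qed
  obtain R where R: "\<And>r. r \<le> R \<Longrightarrow> weight_le H r = {0}"
    using weight_le_trivial by blast
  obtain k where "- R < real k * e"
    using reals_Archimedean3 [OF assms(1)] by blast
  moreover have "real k * e \<le> real (Suc k) * e"
    using assms(1) by simp
  ultimately have "- (real (Suc k) * e) \<le> R"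
    by linarith
  then show ?thesis
    using R pow [of k] by blast
qed

text \<open>Commutators add weights, so the derived series sinks below the smallest eigenvalue of
  \<open>i_ad H\<close>.\<close>

lemma weight_le_neg_solvable:
  assumes "e > 0" "S \<subseteq> weight_le H (- e)"
  shows "lie_solvable S"
proof -
  have der: "(derived_algebra ^^ k) S \<subseteq> weight_le H (- (real (Suc k) * e))" for k
  proof (induction k)
    case 0
    then show ?case using assms by simp
  next
    case (Suc k)
    have "commutator X Y \<in> weight_le H (- (real (Suc (Suc k)) * e))"
      if "X \<in> (derived_algebra ^^ k) S" "Y \<in> (derived_algebra ^^ k) S" for X Y
    proof -
      let ?r = "- (real (Suc k) * e)"
      have "commutator X Y \<in> weight_le H (?r + ?r)"
        using Suc that by (intro weight_le_commutator) auto
      \<comment> \<open>The weight even doubles, but 2 (k + 1) \<ge> k + 2 suffices.\<close>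
      moreover have "?r + ?r \<le> - (real (Suc (Suc k)) * e)"
        using assms(1) by (simp add: algebra_simps)
      ultimately show ?thesis
        using weight_le_mono by blast
    qed
    then show ?case
      unfolding funpow.simps o_apply derived_algebra_def
      by (intro span_minimal subspace_weight_le) auto
  qed
  obtain R where R: "\<And>r. r \<le> R \<Longrightarrow> weight_le H r = {0}"
    using weight_le_trivial by blast
  obtain k where "- R < real k * e"
    using reals_Archimedean3 [OF assms(1)] by blast
  moreover have "real k * e \<le> real (Suc (Suc k)) * e"
    using assms(1) by simp
  ultimately have "- (real (Suc (Suc k)) * e) \<le> R"
    by linarith
  \<comment> \<open>The index \<open>Suc k\<close> guarantees a span, which contains 0; the set
    \<open>S\<close> itself might not.\<close>
  then have "(derived_algebra ^^ Suc k) S \<subseteq> {0}"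
    using R der [of "Suc k"] by blast
  moreover have "0 \<in> (derived_algebra ^^ Suc k) S"
    by (simp add: derived_algebra_def span_zero)
  ultimately show ?thesis
    unfolding lie_solvable_def by blast
qed

section \<open>The stabilizer algebra of an extremal point\<close>

text \<open>
  \<open>s\<close> is the infinitesimal action at the extremal point \<open>z\<close>, in coordinates, \<open>\<Omega>\<close> the Kaehler form
  at \<open>z\<close>, \<open>V\<close> the algebra \<open>\<gg>\<^sub>z\<close> and \<open>H\<close> the differential of \<open>f\<close> at \<open>\<mu>(z)\<close>. The form
  \<open>(x, y) \<mapsto> \<Omega> (s y) (s (br x H))\<close> is the Hessian of \<open>f\<close> evaluated at \<open>d\<mu>(s x)\<close> and \<open>d\<mu>(s y)\<close>.
\<close>

locale extremal_stabilizer =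
  fixes K :: "'n::finite cmat set"
    and emb :: "'k::real_normed_vector \<Rightarrow> 'n cmat"
    and br :: "'k \<Rightarrow> 'k \<Rightarrow> 'k"
    and H :: 'k
    and s :: "'k \<Rightarrow> 'e::real_vector"
    and J :: "'e \<Rightarrow> 'e"
    and \<Omega> :: "'e \<Rightarrow> 'e \<Rightarrow> real"
    and V :: "'n cmat set"
  assumes compact: "compact K"
    and iso: "lie_algebra_iso emb K"
    and br: "emb (br x y) = commutator (emb x) (emb y)"
    and lin_s: "linear s"
    and lin_J: "linear J"
    and JJ: "J (J u) = - u"
    and lin_\<Omega>: "bilinear \<Omega>"
    and \<Omega>_antisym: "\<Omega> u v = - \<Omega> v u"
    and \<Omega>_J: "\<Omega> (J u) (J v) = \<Omega> u v"
    and \<Omega>_pos: "u \<noteq> 0 \<Longrightarrow> \<Omega> u (J u) > 0"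
    and V: "V = {emb x + cscale \<i> (emb y) | x y. s x + J (s y) = 0}"
    and V_commutator: "X \<in> V \<Longrightarrow> Y \<in> V \<Longrightarrow> commutator X Y \<in> V"
    and s_H: "s H = 0"
    and hess_sym: "\<Omega> (s y) (s (br x H)) = \<Omega> (s x) (s (br y H))"
    and hess_nonneg: "\<Omega> (s x) (s (br x H)) \<ge> 0"
    and hess_0: "\<Omega> (s x) (s (br x H)) = 0 \<Longrightarrow> \<Omega> (s x) (s y) = 0"
    and s_0: "s x = 0 \<Longrightarrow> br x H = 0"
begin

abbreviation "mk x y \<equiv> emb x + cscale \<i> (emb y)"
abbreviation "T \<equiv> i_ad (emb H)"
abbreviation "E \<equiv> ad_eigenspace V (emb H)"

lemma lin_emb: "linear emb"
  using iso bounded_linear.linear unfolding lie_algebra_iso_def by blast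

lemma emb_lie: "emb x \<in> lie_algebra K"
  using iso unfolding lie_algebra_iso_def by blast

lemma emb_eq_0: "emb x = 0 \<longleftrightarrow> x = 0"
proof
  assume "emb x = 0"
  then have "emb x = emb 0"
    by (simp add: linear_0 [OF lin_emb])
  then show "x = 0"
    using iso by (simp add: lie_algebra_iso_def inj_eq)
qed (simp add: linear_0 [OF lin_emb])

lemmas emb_simps = linear_0 [OF lin_emb] linear_add [OF lin_emb] linear_diff [OF lin_emb]
  linear_neg [OF lin_emb] linear_scale [OF lin_emb]

lemmas s_simps = linear_0 [OF lin_s] linear_add [OF lin_s] linear_diff [OF lin_s]
  linear_neg [OF lin_s] linear_scale [OF lin_s]

lemmas J_simps = linear_0 [OF lin_J] linear_add [OF lin_J] linear_diff [OF lin_J]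
  linear_neg [OF lin_J] linear_scale [OF lin_J] JJ

lemmas \<Omega>_simps = bilinear_ladd [OF lin_\<Omega>] bilinear_radd [OF lin_\<Omega>] bilinear_lmul [OF lin_\<Omega>]
  bilinear_rmul [OF lin_\<Omega>] bilinear_lneg [OF lin_\<Omega>] bilinear_rneg [OF lin_\<Omega>]
  bilinear_lzero [OF lin_\<Omega>] bilinear_rzero [OF lin_\<Omega>] bilinear_lsub [OF lin_\<Omega>] bilinear_rsub [OF lin_\<Omega>]

text \<open>This is the independence of Lie(K) and i Lie(K): the relation makes the two matrices
  commute, and the zero matrix is nilpotent.\<close>

lemma mk_eq_0:
  assumes "mk x y = 0"
  shows "x = 0 \<and> y = 0"
proof -
  have "emb x = - cscale \<i> (emb y)"
    using assms by (simp add: eq_neg_iff_add_eq_0)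
  then have "emb x ** emb y = emb y ** emb x"
    by (simp add: matrix_mul_algebra)
  moreover have "mpow (mk x y) 1 = 0"
    unfolding assms by (rule mpow_zero) simp
  ultimately show ?thesis
    using compact_complex_nilpotent [OF compact emb_lie emb_lie] emb_eq_0 by blast
qed

lemma mk_eq: "mk x y = mk x' y' \<longleftrightarrow> x = x' \<and> y = y'"
proof
  assume "mk x y = mk x' y'"
  moreover have "mk (x - x') (y - y') = mk x y - mk x' y'"
    by (simp add: emb_simps cscale_diff_right)
  ultimately have "mk (x - x') (y - y') = 0"
    by simp
  then show "x = x' \<and> y = y'"
    using mk_eq_0 by fastforce
qed simp

lemma mk_in_V: "mk x y \<in> V \<longleftrightarrow> s x + J (s y) = 0"
  unfolding V mem_Collect_eq mk_eq by simp

lemma V_cases: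
  assumes "X \<in> V"
  obtains x y where "X = mk x y" "s x = - J (s y)" "J (s x) = s y"
proof -
  obtain x y where "X = mk x y" "s x + J (s y) = 0"
    using assms unfolding V by blast
  moreover from this have "s x = - J (s y)"
    by (simp add: eq_neg_iff_add_eq_0)
  ultimately show ?thesis
    using that by (simp add: J_simps)
qed

lemma cscale_mk: "cscale c (mk x y) = mk (Re c *\<^sub>R x - Im c *\<^sub>R y) (Re c *\<^sub>R y + Im c *\<^sub>R x)"
  by (simp add: emb_simps cscale_add_right cscale_diff_right cscale_cscale cscale_eq [of c]
      cscale_eq [of "c * \<i>"] cscale_scaleR)

lemma complex_subspace_V: "complex_subspace V"
  unfolding complex_subspace_def
proof (intro conjI ballI allI)
  have "mk 0 0 \<in> V"
    by (simp only: mk_in_V) (simp add: s_simps J_simps)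
  then show "0 \<in> V"
    by (simp add: emb_simps)
next
  fix X Y assume "X \<in> V" "Y \<in> V"
  then obtain x y x' y' where X: "X = mk x y" "s x = - J (s y)" and Y: "Y = mk x' y'" "s x' = - J (s y')"
    using V_cases by metis
  have "mk (x + x') (y + y') \<in> V"
    by (simp only: mk_in_V) (simp add: s_simps J_simps X Y)
  then show "X + Y \<in> V"
    by (simp add: X Y emb_simps cscale_add_right algebra_simps)
next
  fix c X assume "X \<in> V"
  then obtain x y where X: "X = mk x y" "s x = - J (s y)"
    using V_cases by metis
  show "cscale c X \<in> V"
    unfolding X(1) cscale_mk mk_in_V by (simp add: s_simps J_simps X(2))
qed

lemma subspace_V: "subspace V"
  by (rule subspace_complex_subspace [OF complex_subspace_V])

text \<open>In real and imaginary parts \<open>T\<close> exchanges the two components up to sign, so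
  the spectral estimates can be made in Lie(K).\<close>

lemma T_mk: "T (mk x y) = mk (br y H) (- br x H)"
proof -
  have "T (mk x y) = cscale \<i> (commutator (emb H) (emb x)) - commutator (emb H) (emb y)"
    by (simp add: i_ad_def commutator_algebra cscale_algebra)
  also have "\<dots> = mk (br y H) (- br x H)"
    by (simp add: emb_simps br cscale_minus_right commutator_antisym [of "emb H"])
  finally show ?thesis .
qed

lemma emb_H_V: "emb H \<in> V"
proof -
  have "mk H 0 \<in> V"
    by (simp only: mk_in_V) (simp add: s_simps J_simps s_H)
  then show ?thesis
    by (simp add: emb_simps)
qed

lemma T_V: "X \<in> V \<Longrightarrow> T X \<in> V"
  using V_commutator [OF emb_H_V] complex_subspace_V unfolding i_ad_def complex_subspace_def by blast

section \<open>The metric and the spectrum of \<open>T\<close>\<close>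

abbreviation "kmetric u v \<equiv> \<Omega> u (J v)"

lemma metric_sym: "kmetric u v = kmetric v u"
  using \<Omega>_J [of u "J v"] \<Omega>_antisym [of "J u" v] by (simp add: J_simps \<Omega>_simps)

lemma metric_0: "kmetric u u = 0 \<longleftrightarrow> u = 0"
  using \<Omega>_pos [of u] by (cases "u = 0") (auto simp: \<Omega>_simps J_simps dest: less_imp_neq)

lemma metric_ge_0: "kmetric u u \<ge> 0"
  using \<Omega>_pos [of u] by (cases "u = 0") (auto simp: \<Omega>_simps J_simps)

text \<open>On \<open>V\<close> the operator \<open>T\<close> is symmetric and negative for the form \<open>kmetric (s y) (s y')\<close>.\<close>

lemma metric_T:
  assumes "s x = - J (s y)"
  shows "kmetric (s y) (s (- br x' H)) = - \<Omega> (s x) (s (br x' H))"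
proof -
  have "J (s y) = - s x"
    using assms by simp
  then have "kmetric (s (- br x' H)) (s y) = \<Omega> (s (br x' H)) (s x)"
    by (simp add: s_simps \<Omega>_simps)
  then show ?thesis
    using metric_sym [of "s y" "s (- br x' H)"] \<Omega>_antisym [of "s x" "s (br x' H)"] by linarith
qed

text \<open>\<open>- br x H\<close> is the imaginary part of \<open>T (mk x y)\<close>, so this is
  the self-adjointness of \<open>T\<close> on \<open>V\<close>, inherited from the symmetry of the
  Hessian.\<close>

lemma metric_T_sym:
  assumes "s x = - J (s y)" "s x' = - J (s y')"
  shows "kmetric (s y) (s (- br x' H)) = kmetric (s (- br x H)) (s y')"
  using metric_T [OF assms(1), of x'] metric_T [OF assms(2), of x] hess_sym [of x x']
    metric_sym [of "s y'"] by simp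

lemma stab_T_0: "s x = 0 \<Longrightarrow> s y = 0 \<Longrightarrow> T (mk x y) = 0"
  unfolding T_mk using s_0 [of x] s_0 [of y] by (simp add: emb_simps)

lemma V_snd_0:
  assumes "mk x y \<in> V" "s y = 0"
  shows "s x = 0"
  using assms unfolding mk_in_V by (simp add: J_simps)

text \<open>Under the first hypothesis \<open>\<Omega> (s x) (s y)\<close> is, up to sign, the
  squared length of \<open>s y\<close>.\<close>

lemma hess_0_stab:
  assumes "s x = - J (s y)" "\<Omega> (s x) (s (br x H)) = 0"
  shows "s y = 0"
proof -
  have "\<Omega> (s x) (s y) = 0"
    using hess_0 [OF assms(2)] .
  then have "kmetric (s y) (s y) = 0"
    using \<Omega>_antisym [of "s y" "J (s y)"] by (simp add: assms(1) \<Omega>_simps)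
  then show ?thesis
    using metric_0 by blast
qed

text \<open>If \<open>s y = 0\<close>, then \<open>X\<close> lies in the complexified stabilizer and
  a = 0. Otherwise pairing the eigenvalue equation with \<open>s y\<close> shows Re a \<le> 0, and
  self-adjointness shows Im a = 0.\<close>

lemma T_eigenvalue:
  assumes X: "X \<in> V" "X \<noteq> 0" and eig: "T X = cscale a X"
  shows "\<exists>l\<in>{l. l \<le> 0}. a = complex_of_real l"
proof -
  obtain x y where xy: "X = mk x y" "s x = - J (s y)" "J (s x) = s y"
    using V_cases [OF X(1)] .
  have eqs: "br y H = Re a *\<^sub>R x - Im a *\<^sub>R y" "- br x H = Re a *\<^sub>R y + Im a *\<^sub>R x"
    using eig unfolding xy(1) T_mk cscale_mk mk_eq by blast+
  \<comment> \<open>This orthogonality removes the cross terms in the computations of both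
    \<open>Re a\<close> and \<open>Im a\<close>.\<close>
  have yx: "kmetric (s y) (s x) = 0"
    using \<Omega>_antisym [of "s y" "s y"] by (simp add: xy(3))
  show ?thesis
  proof (cases "s y = 0")
    case True
    then have "T X = 0"
      using xy stab_T_0 by (simp add: J_simps)
    then have "a = 0"
      using eig X(2) by (simp add: cscale_eq_0_iff)
    then show ?thesis by auto
  next
    case False
    have "Re a * kmetric (s y) (s y) = kmetric (s y) (s (- br x H))"
      unfolding eqs by (simp add: s_simps J_simps \<Omega>_simps yx)
    also have "\<dots> \<le> 0"
      using metric_T [OF xy(2)] hess_nonneg by simp
    finally have "Re a \<le> 0"
      using \<Omega>_pos [OF False] by (simp add: mult_le_0_iff)
    \<comment> \<open>Self-adjointness is applied to \<open>X\<close> and its multiple by i, which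
      is \<open>mk (- y) x\<close>.\<close>
    moreover have "kmetric (s y) (s (- br (- y) H)) = kmetric (s (- br x H)) (s x)"
      by (rule metric_T_sym [OF xy(2)]) (simp only: s_simps xy(3))
    then have "Im a * (kmetric (s x) (s x) + kmetric (s y) (s y)) = 0"
    proof -
      have "br (- y) H = - br y H"
        by (rule injD [of emb])
          (use iso in \<open>simp_all add: lie_algebra_iso_def br emb_simps commutator_algebra\<close>)
      then have "kmetric (s y) (s (br y H)) = kmetric (s (- br x H)) (s x)"
        using \<open>kmetric (s y) (s (- br (- y) H)) = kmetric (s (- br x H)) (s x)\<close> by simp
      then show ?thesis
        unfolding eqs using yx by (simp add: s_simps J_simps \<Omega>_simps algebra_simps)
    qed
    then have "Im a = 0"
      using \<Omega>_pos [OF False] metric_ge_0 [of "s x"] by simp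
    ultimately show ?thesis
      by (intro bexI [of _ "Re a"]) (auto simp: complex_eq_iff)
  qed
qed

text \<open>For a self-adjoint operator, (T - l)^2 X = 0 forces (T - l) X to have length zero. The
  form is degenerate along the complexified stabilizer, where \<open>T\<close> vanishes, so l = 0
  needs a separate argument.\<close>

lemma T_semisimple:
  assumes X: "X \<in> V" and W: "T (T X - l *\<^sub>R X) = l *\<^sub>R (T X - l *\<^sub>R X)"
  shows "T X = l *\<^sub>R X"
proof -
  obtain x y where xy: "X = mk x y" "s x = - J (s y)" "J (s x) = s y"
    using V_cases [OF X] .
  define w1 where "w1 = br y H - l *\<^sub>R x"
  define w2 where "w2 = - br x H - l *\<^sub>R y"
  have TX: "T X - l *\<^sub>R X = mk w1 w2"
    unfolding xy(1) T_mk w1_def w2_def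
    by (simp add: emb_simps cscale_algebra algebra_simps)
  moreover have "T X - l *\<^sub>R X \<in> V"
    using X T_V by (intro subspace_diff subspace_scale subspace_V)
  ultimately have wV: "mk w1 w2 \<in> V" by simp
  then have w: "s w1 = - J (s w2)"
    unfolding mk_in_V by (simp add: eq_neg_iff_add_eq_0)
  have "- br w1 H = l *\<^sub>R w2"
    using W cscale_mk [of "complex_of_real l" w1 w2] unfolding TX T_mk cscale_of_real by (simp add: mk_eq)
  \<comment> \<open>Moving T - l across the form turns the squared length of \<open>s w2\<close>
    into the pairing of \<open>s y\<close> with (T - l) applied to the vector
    \<open>mk w1 w2\<close>, which is zero.\<close>
  then have "kmetric (s y) (l *\<^sub>R s w2) = kmetric (s (- br x H)) (s w2)"
    using metric_T_sym [OF xy(2) w] by (simp add: s_simps)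
  moreover have "kmetric (s w2) u = kmetric (s (- br x H)) u - l * kmetric (s y) u" for u
    by (simp add: w2_def s_simps \<Omega>_simps)
  ultimately have "kmetric (s w2) (s w2) = 0"
    by (simp add: J_simps \<Omega>_simps)
  then have w2: "s w2 = 0"
    using metric_0 by blast
  then have "T (mk w1 w2) = 0"
    using V_snd_0 [OF wV] stab_T_0 by blast
  then have "l = 0 \<or> T X - l *\<^sub>R X = 0"
    using W unfolding TX by auto
  \<comment> \<open>Here \<open>w2\<close> is \<open>- br x H\<close>, so the Hessian form vanishes
    at \<open>x\<close>; its definiteness puts \<open>X\<close> into the complexified
    stabilizer.\<close>
  moreover have "T X = 0" if "l = 0"
  proof -
    have "s (- br x H) = 0"
      using w2 that by (simp add: w2_def)
    then have "\<Omega> (s x) (s (br x H)) = 0"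
      using metric_T [OF xy(2), of x] by (simp add: J_simps \<Omega>_simps)
    then have "s y = 0"
      by (rule hess_0_stab [OF xy(2)])
    then show ?thesis
      using xy stab_T_0 by (simp add: J_simps)
  qed
  ultimately show ?thesis
    by auto
qed

section \<open>Eigenspace decomposition of \<open>V\<close>\<close>

lemma E_complex_subspace: "complex_subspace (E l)"
  using complex_subspace_V unfolding complex_subspace_def ad_eigenspace_eq
  by (auto simp: i_ad_cscale cscale_scaleR scaleR_add_right linear_0 [OF linear_i_ad]
      linear_add [OF linear_i_ad])

lemma E_subset: "E l \<subseteq> V"
  by (auto simp: ad_eigenspace_def)

lemma E_commutator:
  assumes "X \<in> E l" "Y \<in> E m"
  shows "commutator X Y \<in> E (l + m)"
  using assms V_commutator
  by (auto simp: ad_eigenspace_eq i_ad_commutator commutator_algebra scaleR_add_left)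

lemma V_span: "V \<subseteq> span (\<Union>l\<in>{l. l \<le> 0}. E l)"
proof
  fix v assume "v \<in> V"
  from T_V T_eigenvalue T_semisimple this
  show "v \<in> span (\<Union>l\<in>{l. l \<le> 0}. E l)"
    unfolding ad_eigenspace_eq
    by (rule span_eigenvectors [where T = T, OF linear_i_ad i_ad_cscale complex_subspace_V])
qed

lemma V_decomposition:
  assumes "v \<in> V"
  shows "\<exists>x. (\<forall>l\<in>{l. l \<le> 0}. x l \<in> E l) \<and> (\<forall>l. l \<notin> {l. l \<le> 0} \<longrightarrow> x l = 0) \<and>
    finite {l. x l \<noteq> 0} \<and> v = (\<Sum>l | x l \<noteq> 0. x l)"
  using V_span assms
  by (intro span_Union_decomposition subspace_complex_subspace E_complex_subspace) blast

lemma direct_sum: "is_direct_sum V {l. l \<le> 0} E"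
  unfolding is_direct_sum_def
proof (intro conjI ballI E_subset E_complex_subspace complex_subspace_V)
  fix v assume "v \<in> V"
  let ?P = "\<lambda>x. (\<forall>l\<in>{l. l \<le> 0}. x l \<in> E l) \<and> (\<forall>l. l \<notin> {l. l \<le> 0} \<longrightarrow> x l = 0) \<and>
    finite {l. x l \<noteq> 0} \<and> v = (\<Sum>l | x l \<noteq> 0. x l)"
  have "x = y" if x: "?P x" and y: "?P y" for x y
  proof -
    let ?F = "{l. x l \<noteq> 0} \<union> {l. y l \<noteq> 0}"
    have fin: "finite ?F"
      using x y by blast
    have "(\<Sum>l | x l \<noteq> 0. x l) = (\<Sum>l\<in>?F. x l)" "(\<Sum>l | y l \<noteq> 0. y l) = (\<Sum>l\<in>?F. y l)"
      using fin by (auto intro!: sum.mono_neutral_left)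
    then have "(\<Sum>l\<in>?F. x l) = (\<Sum>l\<in>?F. y l)"
      using x y by metis
    then have "(\<Sum>l\<in>?F. x l - y l) \<in> {0}"
      by (simp add: sum_subtractf)
    moreover have "T (x l - y l) = l *\<^sub>R (x l - y l)" for l
    proof -
      have "T (x l) = l *\<^sub>R x l" "T (y l) = l *\<^sub>R y l"
        using x y linear_0 [OF linear_i_ad] unfolding ad_eigenspace_eq
        by (metis (mono_tags, lifting) mem_Collect_eq scaleR_zero_right)+
      then show ?thesis
        by (simp add: linear_diff [OF linear_i_ad] scaleR_diff_right)
    qed
    \<comment> \<open>The difference of two decompositions is a sum of eigenvectors for distinct
      eigenvalues lying in the zero subspace, so each summand is zero.\<close>
    ultimately have *: "(\<Sum>l\<in>?F. x l - y l) \<in> {0}" "\<forall>l\<in>?F. T (x l - y l) = l *\<^sub>R (x l - y l)"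
      by blast+
    have "\<forall>l\<in>?F. x l - y l \<in> {0}"
    proof (rule eigenvector_components [OF linear_i_ad subspace_single_0 _ fin *(2,1)])
      show "T w \<in> {0}" if "w \<in> {0}" for w
        using that by (simp add: linear_0 [OF linear_i_ad])
    qed
    then have xy: "x l - y l = 0" if "l \<in> ?F" for l
      using that by blast
    have "x l = y l" for l
      using xy [of l] by (cases "l \<in> ?F") simp_all
    then show ?thesis
      by (rule ext)
  qed
  then show "\<exists>!x. ?P x"
    by (intro ex_ex1I V_decomposition [OF \<open>v \<in> V\<close>])
qed

text \<open>For \<open>mk x y\<close> in the kernel of \<open>T\<close> the bracket
  \<open>br x H\<close> is 0, so the Hessian form vanishes at \<open>x\<close>; this gives
  \<open>s y = 0\<close> and then \<open>s x = 0\<close>.\<close>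

lemma E_0: "E 0 = complexification emb {x. s x = 0}"
proof (intro subset_antisym subsetI)
  fix X assume "X \<in> E 0"
  then have X: "X \<in> V" "T X = 0"
    by (auto simp: ad_eigenspace_eq)
  obtain x y where xy: "X = mk x y" "s x = - J (s y)"
    using V_cases [OF X(1)] by metis
  have "mk (br y H) (- br x H) = 0"
    using X(2) unfolding xy(1) T_mk .
  then have "br x H = 0"
    using mk_eq_0 by fastforce
  then have "s y = 0"
    using hess_0_stab [OF xy(2)] by (simp add: s_simps \<Omega>_simps)
  then show "X \<in> complexification emb {x. s x = 0}"
    using xy by (auto simp: complexification_def J_simps)
next
  fix X assume "X \<in> complexification emb {x. s x = 0}"
  then obtain x y where xy: "X = mk x y" "s x = 0" "s y = 0"
    unfolding complexification_def by blast
  then have "X \<in> V" "T X = 0"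
    using stab_T_0 by (simp_all add: mk_in_V J_simps)
  then show "X \<in> E 0"
    by (simp add: ad_eigenspace_eq)
qed

section \<open>The nilpotent ideal of negative weights\<close>

definition "neg_part = span (\<Union>l\<in>{..<0}. E l)"

lemma neg_part_subset: "neg_part \<subseteq> V"
  unfolding neg_part_def using E_subset by (intro span_minimal subspace_V) blast

text \<open>Weights add under brackets and \<open>V\<close> has no positive weights, so a bracket
  with an element of \<open>V\<close> keeps a negative weight negative. Linearity extends this in
  each argument.\<close>

lemma neg_part_ideal: "lie_ideal neg_part V"
  unfolding lie_ideal_def complex_subspace_def
proof (intro conjI ballI allI neg_part_subset)
  show "0 \<in> neg_part"
    by (simp add: neg_part_def span_zero)
  show "x + y \<in> neg_part" if "x \<in> neg_part" "y \<in> neg_part" for x y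
    using that by (simp add: neg_part_def span_add)
  show "cscale c x \<in> neg_part" if "x \<in> neg_part" for c x
  proof -
    have "neg_part \<subseteq> {x. cscale c x \<in> neg_part}"
      unfolding neg_part_def
    proof (rule span_minimal)
      show "(\<Union>l\<in>{..<0}. E l) \<subseteq> {x. cscale c x \<in> span (\<Union>l\<in>{..<0}. E l)}"
        using E_complex_subspace unfolding complex_subspace_def by (blast intro: span_base)
      show "subspace {x. cscale c x \<in> span (\<Union>l\<in>{..<0}. E l)}"
        using linear_subspace_vimage [OF linear_cscale subspace_span] by (simp add: vimage_def)
    qed
    then show ?thesis
      using that by blast
  qed
  show "commutator v n \<in> neg_part" if "v \<in> V" "n \<in> neg_part" for v n
  proof -
    have *: "commutator v n \<in> neg_part" if "v \<in> E l" "l \<le> 0" for v l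
    proof -
      have "neg_part \<subseteq> {n. commutator v n \<in> neg_part}"
        unfolding neg_part_def
      proof (rule span_minimal)
        show "(\<Union>m\<in>{..<0}. E m) \<subseteq> {n. commutator v n \<in> span (\<Union>m\<in>{..<0}. E m)}"
        proof clarify
          fix m n assume "m < 0" "n \<in> E m"
          then have "commutator v n \<in> E (l + m)" "l + m \<in> {..<0}"
            using E_commutator [OF that(1)] that(2) by auto
          then show "commutator v n \<in> span (\<Union>m\<in>{..<0}. E m)"
            by (blast intro: span_base)
        qed
        show "subspace {n. commutator v n \<in> span (\<Union>m\<in>{..<0}. E m)}"
          using linear_subspace_vimage [OF linear_commutator subspace_span] by (simp add: vimage_def)
      qed
      then show ?thesis
        using \<open>n \<in> neg_part\<close> by blast
    qed
    have "linear (\<lambda>v. commutator v n)"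
      by (auto intro!: linearI simp: commutator_algebra)
    then have "subspace {v. commutator v n \<in> neg_part}"
      using linear_subspace_vimage [of "\<lambda>v. commutator v n" neg_part]
      by (simp add: neg_part_def vimage_def)
    then have "span (\<Union>l\<in>{l. l \<le> 0}. E l) \<subseteq> {v. commutator v n \<in> neg_part}"
      using * by (intro span_minimal) blast+
    then show ?thesis
      using V_span that by blast
  qed
qed

lemma neg_part_weight:
  obtains e where "e > 0" "neg_part \<subseteq> weight_le (emb H) (- e)"
proof -
  obtain e where e: "e > 0" "\<And>X l. l < 0 \<Longrightarrow> T X = l *\<^sub>R X \<Longrightarrow> X \<in> weight_le (emb H) (- e)"
    using negative_weights by blast
  have "neg_part \<subseteq> weight_le (emb H) (- e)"
    unfolding neg_part_def using e(2)
    by (intro span_minimal subspace_weight_le) (auto simp: ad_eigenspace_eq)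
  with e(1) that show ?thesis by blast
qed

text \<open>Since \<open>emb H\<close> lies in \<open>V\<close>, the ideal is
  \<open>T\<close>-invariant and contains the weight components of its elements. Compactness of
  \<open>K\<close> rules out a nonzero component of weight 0.\<close>

lemma nilpotent_ideal_subset:
  assumes ideal: "lie_ideal N V" and nil: "\<And>X. X \<in> N \<Longrightarrow> \<exists>k. mpow X k = 0"
  shows "N \<subseteq> neg_part"
proof
  fix X assume "X \<in> N"
  have N: "complex_subspace N" "N \<subseteq> V" "\<And>v X. v \<in> V \<Longrightarrow> X \<in> N \<Longrightarrow> commutator v X \<in> N"
    using ideal unfolding lie_ideal_def by blast+
  have TN: "T X \<in> N" if "X \<in> N" for X
    using N(3) [OF emb_H_V that] N(1) unfolding i_ad_def complex_subspace_def by blast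
  obtain x where x: "\<And>l. l \<le> 0 \<Longrightarrow> x l \<in> E l" "\<And>l. \<not> l \<le> 0 \<Longrightarrow> x l = 0"
    "finite {l. x l \<noteq> 0}" "X = (\<Sum>l | x l \<noteq> 0. x l)"
    using V_decomposition [of X] \<open>X \<in> N\<close> N(2) by blast
  have "\<forall>l\<in>{l. x l \<noteq> 0}. x l \<in> N"
  proof (rule eigenvector_components [OF linear_i_ad _ TN x(3)])
    show "subspace N"
      by (rule subspace_complex_subspace [OF N(1)])
    show "\<forall>l\<in>{l. x l \<noteq> 0}. T (x l) = l *\<^sub>R x l"
      using x(1,2) unfolding ad_eigenspace_eq by force
    show "(\<Sum>l | x l \<noteq> 0. x l) \<in> N"
      using \<open>X \<in> N\<close> x(4) by simp
  qed
  then have "x 0 \<in> N"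
    using N(1) unfolding complex_subspace_def by (cases "x 0 = 0") auto
  have "x 0 = 0"
  proof -
    obtain a b where ab: "x 0 = mk a b" "s a = 0" "s b = 0"
      using x(1) [of 0] unfolding E_0 complexification_def by auto
    \<comment> \<open>This is minus the complex conjugate of \<open>x 0\<close>. Its bracket with
      \<open>x 0\<close> is -2i times the bracket of \<open>emb a\<close> and \<open>emb b\<close>,
      and the factor i/2 normalizes it to an element of Lie(K).\<close>
    have "mk (- a) b \<in> V"
      unfolding mk_in_V using ab by (simp add: s_simps J_simps)
    then have "cscale (\<i> / 2) (commutator (mk (- a) b) (x 0)) \<in> N"
      using N \<open>x 0 \<in> N\<close> unfolding complex_subspace_def by blast
    also have "cscale (\<i> / 2) (commutator (mk (- a) b) (x 0)) = commutator (emb a) (emb b)"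
    proof -
      have "commutator (mk (- a) b) (x 0) = cscale (- 2 * \<i>) (commutator (emb a) (emb b))"
        unfolding ab(1)
        by (simp add: emb_simps commutator_algebra cscale_algebra commutator_antisym [of "emb b" "emb a"])
          (simp add: vec_eq_iff cscale_def)
      then show ?thesis
        by (simp add: cscale_cscale)
    qed
    finally have "emb (br a b) \<in> N"
      by (simp add: br)
    then have "emb (br a b) = 0"
      using nil compact_nilpotent [OF compact emb_lie] by blast
    then have "emb a ** emb b = emb b ** emb a"
      by (simp add: br commutator_def)
    moreover obtain m where "mpow (mk a b) m = 0"
      using nil [OF \<open>x 0 \<in> N\<close>] ab by metis
    ultimately show ?thesis
      using compact_complex_nilpotent [OF compact emb_lie emb_lie] ab(1) by (metis add_0 cscale_zero_right)
  qed
  then have "x l \<in> neg_part" for l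
  proof (cases "l < 0")
    case True
    then show ?thesis
      using x(1) [of l] unfolding neg_part_def by (intro span_base) auto
  next
    case False
    then have "x l = 0"
      using x(2) [of l] \<open>x 0 = 0\<close> by (cases "l = 0") auto
    then show ?thesis
      by (simp add: neg_part_def span_zero)
  qed
  then show "X \<in> neg_part"
    unfolding x(4) neg_part_def by (intro span_sum) simp
qed

lemma solv_part_neg_part: "solv_part neg_part V"
proof -
  obtain e where e: "e > 0" "neg_part \<subseteq> weight_le (emb H) (- e)"
    by (rule neg_part_weight)
  then show ?thesis
    unfolding solv_part_def
  proof (intro conjI ballI allI impI neg_part_ideal weight_le_neg_solvable [OF e])
    show "\<exists>k. mpow X k = 0" if "X \<in> neg_part" for X
      using e that by (intro weight_le_neg_nilpotent [of e X "emb H"]) auto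
    show "N \<subseteq> neg_part" if "lie_ideal N V \<and> lie_solvable N \<and> (\<forall>X\<in>N. \<exists>k. mpow X k = 0)" for N
      using that nilpotent_ideal_subset [of N] by simp
  qed
qed

section \<open>The quotient by the negative part\<close>

lemma V_split:
  assumes "v \<in> V"
  shows "\<exists>a\<in>E 0. \<exists>n\<in>neg_part. v = a + n"
proof -
  have "span (\<Union>l\<in>{l. l \<le> 0}. E l) \<subseteq> {a + n | a n. a \<in> E 0 \<and> n \<in> neg_part}"
  proof (intro span_minimal subspace_sums subspace_complex_subspace [OF E_complex_subspace])
    show "subspace neg_part"
      by (simp add: neg_part_def)
    show "(\<Union>l\<in>{l. l \<le> 0}. E l) \<subseteq> {a + n | a n. a \<in> E 0 \<and> n \<in> neg_part}"
    proof clarify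
      fix l :: real and X assume "l \<le> 0" "X \<in> E l"
      have "0 \<in> E 0" "0 \<in> neg_part"
        using E_complex_subspace by (auto simp: complex_subspace_def neg_part_def span_zero)
      moreover have "X \<in> neg_part" if "l < 0"
        using that \<open>X \<in> E l\<close> unfolding neg_part_def by (blast intro: span_base)
      ultimately show "\<exists>a n. X = a + n \<and> a \<in> E 0 \<and> n \<in> neg_part"
        using \<open>X \<in> E l\<close> \<open>l \<le> 0\<close> by (cases "l = 0") force+
    qed
  qed
  then show ?thesis
    using V_span assms by blast
qed

text \<open>The eigencomponents of an element of the intersection have negative weights, yet lie in
  the invariant subspace \<open>E 0\<close>; hence they vanish.\<close>

lemma E_0_neg_part: "E 0 \<inter> neg_part = {0}"
proof -
  have "X = 0" if X: "X \<in> E 0" "X \<in> neg_part" for X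
  proof -
    obtain x where x: "\<forall>l\<in>{..<0}. x l \<in> E l" "\<forall>l. l \<notin> {..<0} \<longrightarrow> x l = 0"
      "finite {l. x l \<noteq> 0}" "X = (\<Sum>l | x l \<noteq> 0. x l)"
      using span_Union_decomposition [where I = "{..<0}" and E = E,
          OF subspace_complex_subspace [OF E_complex_subspace]] X(2)
      unfolding neg_part_def by blast
    have eig: "T (x l) = l *\<^sub>R x l \<and> l < 0" if "x l \<noteq> 0" for l
      using x(1,2) that unfolding ad_eigenspace_eq by blast
    have "\<forall>l\<in>{l. x l \<noteq> 0}. x l \<in> E 0"
    proof (rule eigenvector_components [OF linear_i_ad _ _ x(3)])
      show "subspace (E 0)"
        by (rule subspace_complex_subspace [OF E_complex_subspace])
      then show "T Y \<in> E 0" if "Y \<in> E 0" for Y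
        using that subspace_0 by (auto simp: ad_eigenspace_eq)
    qed (use eig X x(4) in auto)
    then have "x l = 0" for l
      using eig [of l] by (auto simp: ad_eigenspace_eq)
    then show ?thesis
      by (simp add: x(4))
  qed
  moreover have "0 \<in> E 0" "0 \<in> neg_part"
    using E_complex_subspace by (auto simp: complex_subspace_def neg_part_def span_zero)
  ultimately show ?thesis by blast
qed

text \<open>The coset map restricted to \<open>E 0\<close> is bijective because \<open>E 0\<close>
  and \<open>neg_part\<close> are complementary in \<open>V\<close>; it respects brackets because
  \<open>neg_part\<close> is an ideal.\<close>

lemma isomorphic_quotient: "isomorphic_to_quotient (E 0) V neg_part"
  unfolding isomorphic_to_quotient_def
proof (intro exI conjI ballI allI)
  let ?\<phi> = "\<lambda>X. (+) X ` neg_part"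
  have sub: "subspace neg_part"
    by (simp add: neg_part_def)
  have mem: "Y \<in> ?\<phi> X \<longleftrightarrow> Y - X \<in> neg_part" for X Y
    by (force simp: image_iff algebra_simps intro: bexI [of _ "Y - X"])
  have coset: "?\<phi> X = ?\<phi> Y" if "X - Y \<in> neg_part" for X Y
  proof (intro set_eqI)
    fix W
    show "W \<in> ?\<phi> X \<longleftrightarrow> W \<in> ?\<phi> Y"
      unfolding mem
    proof
      assume "W - X \<in> neg_part"
      from subspace_add [OF sub this that] show "W - Y \<in> neg_part" by simp
    next
      assume "W - Y \<in> neg_part"
      from subspace_diff [OF sub this that] show "W - X \<in> neg_part" by simp
    qed
  qed
  show "bij_betw ?\<phi> (E 0) (lie_quotient V neg_part)"
  proof (intro bij_betw_imageI inj_onI)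
    fix X Y assume "X \<in> E 0" "Y \<in> E 0" "?\<phi> X = ?\<phi> Y"
    then have "X \<in> ?\<phi> Y"
      using mem [of X X] subspace_0 [OF sub] by simp
    then have "X - Y \<in> neg_part"
      using mem by blast
    moreover have "X - Y \<in> E 0"
      using \<open>X \<in> E 0\<close> \<open>Y \<in> E 0\<close>
      by (intro subspace_diff subspace_complex_subspace [OF E_complex_subspace])
    ultimately have "X - Y \<in> E 0 \<inter> neg_part" by blast
    then show "X = Y"
      unfolding E_0_neg_part by simp
  next
    show "?\<phi> ` E 0 = lie_quotient V neg_part"
      unfolding lie_quotient_def
    proof (rule subset_antisym)
      show "?\<phi> ` E 0 \<subseteq> ?\<phi> ` V"
        by (intro image_mono E_subset)
    next
      show "?\<phi> ` V \<subseteq> ?\<phi> ` E 0"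
      proof
        fix C assume "C \<in> ?\<phi> ` V"
        then obtain v where v: "v \<in> V" "C = ?\<phi> v" by blast
        obtain a n where "a \<in> E 0" "n \<in> neg_part" "v = a + n"
          using V_split [OF v(1)] by blast
        then show "C \<in> ?\<phi> ` E 0"
        using v(2) coset [of v a] by auto
      qed
    qed
  qed
  have ideal: "complex_subspace neg_part" "\<And>v n. v \<in> V \<Longrightarrow> n \<in> neg_part \<Longrightarrow> commutator v n \<in> neg_part"
    using neg_part_ideal unfolding lie_ideal_def by blast+
  show "a + b \<in> ?\<phi> (X + Y)" if "a \<in> ?\<phi> X" "b \<in> ?\<phi> Y" for X Y a b
  proof -
    have "a + b - (X + Y) = (a - X) + (b - Y)" by simp
    then show ?thesis
      using that unfolding mem by (metis subspace_add [OF sub])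
  qed
  show "commutator a b \<in> ?\<phi> (commutator X Y)"
    if "X \<in> E 0" "Y \<in> E 0" "a \<in> ?\<phi> X" "b \<in> ?\<phi> Y" for X Y a b
  proof -
    have "commutator a b - commutator X Y
        = commutator X (b - Y) - commutator Y (a - X) + commutator (a - X) (b - Y)"
      by (simp add: commutator_def matrix_mul_algebra)
    moreover have "X \<in> V" "Y \<in> V" "a - X \<in> neg_part" "b - Y \<in> neg_part" "a - X \<in> V"
      using that E_subset neg_part_subset unfolding mem by blast+
    then have "commutator X (b - Y) \<in> neg_part" "commutator Y (a - X) \<in> neg_part"
      "commutator (a - X) (b - Y) \<in> neg_part"
      by (simp_all add: ideal(2))
    then have "commutator X (b - Y) - commutator Y (a - X) + commutator (a - X) (b - Y) \<in> neg_part"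
      by (intro subspace_add subspace_diff sub)
    ultimately show ?thesis
      unfolding mem by metis
  qed
  show "cscale c a \<in> ?\<phi> (cscale c X)" if "a \<in> ?\<phi> X" for X c a
    using that ideal(1) unfolding mem complex_subspace_def by (metis cscale_diff_right)
qed

theorem stabilizer_structure:
  "is_direct_sum V {l. l \<le> 0} E \<and> E 0 = complexification emb {x. s x = 0} \<and>
    (\<exists>S. solv_part S V \<and> isomorphic_to_quotient (E 0) V S)"
  by (intro conjI exI [of _ neg_part] direct_sum E_0 solv_part_neg_part isomorphic_quotient)

end

section \<open>Tangent vectors in coordinates\<close>

locale complex_manifold_atlas =
  fixes J0 :: "'e::real_normed_vector \<Rightarrow> 'e"
    and A :: "('z::{t2_space, second_countable_topology}, 'e) chart set"
  assumes manifold: "complex_manifold J0 A"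
begin

abbreviation dtransition :: "('z, 'e) chart \<Rightarrow> ('z, 'e) chart \<Rightarrow> 'z \<Rightarrow> 'e \<Rightarrow> 'e" where
  "dtransition c c' z \<equiv> frechet_derivative (transition c c') (at (chart_map c z))"

lemma bounded_linear_J0: "bounded_linear J0"
  and J0_J0: "J0 (J0 v) = - v"
  using manifold by (auto simp: complex_manifold_def complex_model_space_def)

lemma linear_J0: "linear J0"
  by (rule bounded_linear.linear [OF bounded_linear_J0])

lemma chart_at_mem: "chart_at A z \<in> charts_at A z"
proof -
  have "z \<in> (\<Union>c\<in>A. chart_dom c)"
    using manifold by (auto simp: complex_manifold_def)
  then have "\<exists>c. c \<in> charts_at A z"
    by (auto simp: charts_at_def)
  then show ?thesis
    unfolding chart_at_def by (rule someI_ex)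
qed

lemma open_chart_dom: "c \<in> charts_at A z \<Longrightarrow> open (chart_dom c)"
  and open_chart_image: "c \<in> charts_at A z \<Longrightarrow> open (chart_map c ` chart_dom c)"
  and chart_homeomorphism: "c \<in> charts_at A z \<Longrightarrow>
    homeomorphism (chart_dom c) (chart_map c ` chart_dom c) (chart_map c) (chart_inv c)"
  using manifold by (auto simp: complex_manifold_def charts_at_def)

lemma charts_at_dom: "c \<in> charts_at A z \<Longrightarrow> z \<in> chart_dom c"
  by (simp add: charts_at_def)

lemma charts_at_iff: "c \<in> charts_at A z \<Longrightarrow> c \<in> charts_at A w \<longleftrightarrow> w \<in> chart_dom c"
  by (simp add: charts_at_def)

lemma chart_inv_map:
  assumes "c \<in> charts_at A z" "w \<in> chart_dom c"
  shows "chart_inv c (chart_map c w) = w"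
  using chart_homeomorphism [OF assms(1)] assms(2) unfolding homeomorphism_def by blast

lemma chart_inv_map': "c \<in> charts_at A z \<Longrightarrow> chart_inv c (chart_map c z) = z"
  using chart_inv_map charts_at_dom by blast

lemma dtransition:
  assumes "c \<in> charts_at A z" "c' \<in> charts_at A z"
  shows "(transition c c' has_derivative dtransition c c' z) (at (chart_map c z))"
    and "dtransition c c' z (J0 v) = J0 (dtransition c c' z v)"
proof -
  have "complex_differentiable_at J0 (transition c c') (chart_map c z)"
    using manifold assms unfolding complex_manifold_def charts_at_def by blast
  then obtain D where D: "(transition c c' has_derivative D) (at (chart_map c z))"
    "\<forall>v. D (J0 v) = J0 (D v)"
    unfolding complex_differentiable_at_def by blast
  moreover have "D = dtransition c c' z"
    by (rule frechet_derivative_at [OF D(1)])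
  ultimately show "(transition c c' has_derivative dtransition c c' z) (at (chart_map c z))"
    and "dtransition c c' z (J0 v) = J0 (dtransition c c' z v)"
    by simp_all
qed

lemma linear_dtransition:
  "c \<in> charts_at A z \<Longrightarrow> c' \<in> charts_at A z \<Longrightarrow> linear (dtransition c c' z)"
  by (rule has_derivative_linear [OF dtransition(1)])

lemma dtransition_self:
  assumes "c \<in> charts_at A z"
  shows "dtransition c c z v = v"
proof -
  have "(transition c c has_derivative (\<lambda>v. v)) (at (chart_map c z))"
  proof (rule has_derivative_transform_within_open [OF has_derivative_ident open_chart_image [OF assms]])
    show "chart_map c z \<in> chart_map c ` chart_dom c"
      using charts_at_dom [OF assms] by blast
  qed (use chart_inv_map [OF assms] in auto)
  from frechet_derivative_at [OF this] show ?thesis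
    by metis
qed

lemma dtransition_trans:
  assumes c: "c1 \<in> charts_at A z" "c2 \<in> charts_at A z" "c3 \<in> charts_at A z"
  shows "dtransition c1 c3 z v = dtransition c2 c3 z (dtransition c1 c2 z v)"
proof -
  let ?U = "chart_map c1 ` chart_dom c1 \<inter> chart_inv c1 -` chart_dom c2"
  have "continuous_on (chart_map c1 ` chart_dom c1) (chart_inv c1)"
    using chart_homeomorphism [OF c(1)] unfolding homeomorphism_def by blast
  then have "open ?U"
    using open_chart_image [OF c(1)] open_chart_dom [OF c(2)] continuous_on_open_vimage
    by (metis Int_commute)
  have 1: "transition c1 c2 (chart_map c1 z) = chart_map c2 z"
    by (simp add: chart_inv_map' [OF c(1)])
  have "((\<lambda>x. transition c2 c3 (transition c1 c2 x)) has_derivative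
      (\<lambda>v. dtransition c2 c3 z (dtransition c1 c2 z v))) (at (chart_map c1 z))"
    using has_derivative_compose [OF dtransition(1) [OF c(1,2)], of "transition c2 c3"]
      dtransition(1) [OF c(2,3)] 1 by simp
  then have "(transition c1 c3 has_derivative
      (\<lambda>v. dtransition c2 c3 z (dtransition c1 c2 z v))) (at (chart_map c1 z))"
  proof (rule has_derivative_transform_within_open [OF _ \<open>open ?U\<close>])
    show "chart_map c1 z \<in> ?U"
      using c charts_at_dom chart_inv_map' by auto
    show "transition c2 c3 (transition c1 c2 x) = transition c1 c3 x" if "x \<in> ?U" for x
      using that chart_inv_map [OF c(2)] by simp
  qed
  from frechet_derivative_at [OF this] show ?thesis
    by metis
qed

text \<open>The model space serves as the tangent space at \<open>z\<close> through one fixed chart,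
  so all tangent computations become computations in \<open>'e\<close>.\<close>

abbreviation coords :: "'z \<Rightarrow> 'e \<Rightarrow> ('z, 'e) tangent" where
  "coords z \<equiv> coordinate_vector A (chart_at A z) z"

lemma coords_tangent: "coords z u \<in> tangent_space A z"
  unfolding tangent_space_def
proof (intro CollectI conjI ballI allI impI)
  fix c c' assume "c \<in> charts_at A z" "c' \<in> charts_at A z"
  then show "coords z u c' = dtransition c c' z (coords z u c)"
    using dtransition_trans [OF chart_at_mem, of c z c' u] by (simp add: coordinate_vector_def)
qed (simp add: coordinate_vector_def)

lemma coords_at: "coords z u (chart_at A z) = u"
  by (simp add: coordinate_vector_def chart_at_mem dtransition_self)

lemma coords_add: "coords z (u + v) = coords z u + coords z v"
  by (rule ext) (simp add: coordinate_vector_def linear_add [OF linear_dtransition [OF chart_at_mem]])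

lemma coords_eq_0_iff: "coords z u = 0 \<longleftrightarrow> u = 0"
proof
  assume "coords z u = 0"
  then show "u = 0"
    using coords_at [of z u] by (metis zero_fun_apply)
next
  assume "u = 0"
  then show "coords z u = 0"
    by (intro ext) (simp add: coordinate_vector_def linear_0 [OF linear_dtransition [OF chart_at_mem]])
qed

lemma tangent_J_coords: "tangent_J J0 (coords z u) = coords z (J0 u)"
  by (rule ext) (simp add: tangent_J_def coordinate_vector_def dtransition(2) [OF chart_at_mem]
      linear_0 [OF linear_J0])

text \<open>The ordinary chain rule in the chart. The chart inverts only on its domain, so
  continuity of \<open>\<gamma>\<close> is needed to remain there near \<open>t0\<close>.\<close>

lemma curve_chain:
  assumes \<gamma>: "continuous_on UNIV \<gamma>" and c: "c \<in> charts_at A (\<gamma> t0)"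
    and u: "((\<lambda>t. chart_map c (\<gamma> t)) has_vector_derivative u) (at t0)"
    and F: "((\<lambda>x. F (chart_inv c x)) has_derivative F') (at (chart_map c (\<gamma> t0)))"
  shows "((\<lambda>t. F (\<gamma> t)) has_vector_derivative F' u) (at t0)"
proof -
  have "((\<lambda>t. F (chart_inv c (chart_map c (\<gamma> t)))) has_derivative (\<lambda>h. F' (h *\<^sub>R u))) (at t0)"
    using has_derivative_compose [OF u [unfolded has_vector_derivative_def] F] .
  then have "((\<lambda>t. F (chart_inv c (chart_map c (\<gamma> t)))) has_vector_derivative F' u) (at t0)"
    by (simp add: has_vector_derivative_def linear_scale [OF has_derivative_linear [OF F]])
  moreover have "open (\<gamma> -` chart_dom c)"
    using \<gamma> open_chart_dom [OF c] continuous_on_open_vimage [of UNIV \<gamma>] by simp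
  ultimately show ?thesis
    by (rule has_vector_derivative_transform_within_open)
      (use charts_at_dom [OF c] chart_inv_map [OF c] in auto)
qed

end

section \<open>Stabilizers of a holomorphic action\<close>

locale holomorphic_action_on_manifold = complex_manifold_atlas J0 A
  for J0 :: "'e::real_normed_vector \<Rightarrow> 'e"
    and A :: "('z::{t2_space, second_countable_topology}, 'e) chart set" +
  fixes G :: "'n::finite cmat set" and act :: "'n cmat \<Rightarrow> 'z \<Rightarrow> 'z"
  assumes G: "matrix_group G" and hol: "holomorphic_action J0 A G act"
begin

lemma act_one: "act (mat 1) z = z"
  and act_mult: "g \<in> G \<Longrightarrow> h \<in> G \<Longrightarrow> act (g ** h) z = act g (act h z)"
  using hol by (auto simp: holomorphic_action_def group_action_def)

lemma act_stable_inv: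
  assumes "g \<in> G" "act g z = z"
  shows "act (matrix_inv g) z = z"
proof -
  have "invertible g" "matrix_inv g \<in> G"
    using G assms(1) by (auto simp: matrix_group_def)
  then have "act (matrix_inv g) (act g z) = z"
    using act_mult [of "matrix_inv g" g z] assms(1) by (simp add: matrix_inv_mult act_one)
  then show ?thesis
    by (simp add: assms(2))
qed

lemma one_in_G: "mat 1 \<in> G"
  using G by (simp add: matrix_group_def)

lemma continuous_on_orbit:
  assumes "X \<in> lie_algebra G"
  shows "continuous_on UNIV (\<lambda>t. act (mexp (t *\<^sub>R X)) z)"
proof -
  have "continuous_on UNIV (\<lambda>t. (mexp (t *\<^sub>R X), z))"
    using has_vector_derivative_continuous [OF mexp_has_vector_derivative]
    by (intro continuous_intros) (auto simp: continuous_on_eq_continuous_at)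
  moreover have "continuous_on (G \<times> UNIV) (\<lambda>(g, z). act g z)"
    using hol by (simp add: holomorphic_action_def)
  ultimately show ?thesis
    using continuous_on_compose2 [of "G \<times> UNIV" "\<lambda>(g, z). act g z" UNIV "\<lambda>t. (mexp (t *\<^sub>R X), z)"]
      mexp_lie_algebra [OF assms] by auto
qed

lemma act_derivative:
  assumes "g \<in> G" "c \<in> charts_at A z" "c' \<in> charts_at A (act g z)"
  obtains D where "bounded_linear D"
    "((\<lambda>(X, x). chart_map c' (act (mexp X ** g) (chart_inv c x))) has_derivative D)
      (at (0, chart_map c z) within lie_algebra G \<times> UNIV)"
    "\<And>X v. X \<in> lie_algebra G \<Longrightarrow> D (cscale \<i> X, J0 v) = J0 (D (X, v))"
  using hol assms unfolding holomorphic_action_def by (metis has_derivative_bounded_linear)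

text \<open>The joint derivative is restricted to the slice where the Lie algebra variable is
  0.\<close>

lemma act_differentiable:
  assumes "g \<in> G" "c \<in> charts_at A z" "c' \<in> charts_at A (act g z)"
  obtains D where "bounded_linear D"
    "((\<lambda>x. chart_map c' (act g (chart_inv c x))) has_derivative D) (at (chart_map c z))"
proof -
  obtain D where D: "bounded_linear D"
    "((\<lambda>(X, x). chart_map c' (act (mexp X ** g) (chart_inv c x))) has_derivative D)
      (at (0, chart_map c z) within lie_algebra G \<times> UNIV)"
    using act_derivative [OF assms] by metis
  have "0 \<in> lie_algebra G"
    using one_in_G by (simp add: lie_algebra_def)
  then have "range (Pair 0) \<subseteq> lie_algebra G \<times> UNIV"
    by auto
  have "((\<lambda>x. (0, x)) has_derivative (\<lambda>v. (0, v))) (at (chart_map c z))"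
    by (auto intro!: derivative_eq_intros)
  from has_derivative_in_compose [OF this has_derivative_subset [OF D(2)
      \<open>range (Pair 0) \<subseteq> lie_algebra G \<times> UNIV\<close>]]
  have "((\<lambda>x. chart_map c' (act g (chart_inv c x))) has_derivative (\<lambda>v. D (0, v))) (at (chart_map c z))"
    by simp
  then show ?thesis
    using that has_derivative_bounded_linear by blast
qed

text \<open>The derivative of the orbit map at the identity, in the coordinates \<open>chart_at A z\<close>.\<close>

definition orbit_derivative :: "'z \<Rightarrow> 'n cmat \<Rightarrow> 'e" where
  "orbit_derivative z = (SOME L. bounded_linear L \<and>
    (\<forall>X\<in>lie_algebra G. L (cscale \<i> X) = J0 (L X)) \<and>
    (\<forall>X\<in>lie_algebra G.
      ((\<lambda>t. chart_map (chart_at A z) (act (mexp (t *\<^sub>R X)) z)) has_vector_derivative L X) (at 0)))"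

text \<open>The witness is \<open>D (X, 0)\<close>, with D the joint derivative of the action at the
  identity and \<open>z\<close>; its compatibility with \<i> is the holomorphy of the
  action.\<close>

lemma orbit_derivative:
  shows bounded_linear_orbit_derivative: "bounded_linear (orbit_derivative z)"
    and orbit_derivative_cscale:
      "X \<in> lie_algebra G \<Longrightarrow> orbit_derivative z (cscale \<i> X) = J0 (orbit_derivative z X)"
    and orbit_has_vector_derivative: "X \<in> lie_algebra G \<Longrightarrow>
      ((\<lambda>t. chart_map (chart_at A z) (act (mexp (t *\<^sub>R X)) z)) has_vector_derivative
        orbit_derivative z X) (at 0)"
proof -
  let ?c = "chart_at A z"
  obtain D where D: "bounded_linear D"
    "((\<lambda>(X, x). chart_map ?c (act (mexp X ** mat 1) (chart_inv ?c x))) has_derivative D)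
      (at (0, chart_map ?c z) within lie_algebra G \<times> UNIV)"
    "\<And>X v. X \<in> lie_algebra G \<Longrightarrow> D (cscale \<i> X, J0 v) = J0 (D (X, v))"
    using act_derivative [OF one_in_G chart_at_mem [of z]] chart_at_mem [of z] act_one by metis
  have "bounded_linear (\<lambda>X. D (X, 0))"
    by (intro bounded_linear_compose [OF D(1)] bounded_linear_Pair bounded_linear_ident
        bounded_linear_zero)
  moreover have "D (cscale \<i> X, 0) = J0 (D (X, 0))" if "X \<in> lie_algebra G" for X
    using D(3) [OF that, of 0] by (simp add: linear_0 [OF linear_J0])
  moreover have "((\<lambda>t. chart_map ?c (act (mexp (t *\<^sub>R X)) z)) has_vector_derivative D (X, 0)) (at 0)"
    if "X \<in> lie_algebra G" for X
  proof -
    let ?f = "\<lambda>t::real. (t *\<^sub>R X, chart_map ?c z)"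
    have f: "(?f has_derivative (\<lambda>h. (h *\<^sub>R X, 0))) (at 0)"
      by (auto intro!: derivative_eq_intros)
    have "range ?f \<subseteq> lie_algebra G \<times> UNIV"
      using lie_algebra_scaleR [OF that] by auto
    moreover have "?f 0 = (0, chart_map ?c z)"
      by simp
    ultimately have "((\<lambda>(X, x). chart_map ?c (act (mexp X ** mat 1) (chart_inv ?c x))) has_derivative D)
        (at (?f 0) within range ?f)"
      using has_derivative_subset [OF D(2)] by metis
    from has_derivative_in_compose [OF f this]
    have "((\<lambda>t. chart_map ?c (act (mexp (t *\<^sub>R X)) z)) has_derivative (\<lambda>h. D (h *\<^sub>R X, 0))) (at 0)"
      by (simp add: chart_inv_map' [OF chart_at_mem])
    moreover have "D (h *\<^sub>R X, 0) = h *\<^sub>R D (X, 0)" for h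
      using linear_scale [OF bounded_linear.linear [OF D(1)], of h "(X, 0)"] by simp
    ultimately show ?thesis
      by (simp add: has_vector_derivative_def)
  qed
  ultimately have "\<exists>L. bounded_linear L \<and> (\<forall>X\<in>lie_algebra G. L (cscale \<i> X) = J0 (L X)) \<and>
    (\<forall>X\<in>lie_algebra G.
      ((\<lambda>t. chart_map ?c (act (mexp (t *\<^sub>R X)) z)) has_vector_derivative L X) (at 0))"
    by (intro exI [of _ "\<lambda>X. D (X, 0)"] conjI ballI)
  from someI_ex [OF this, folded orbit_derivative_def]
  show "bounded_linear (orbit_derivative z)"
    "X \<in> lie_algebra G \<Longrightarrow> orbit_derivative z (cscale \<i> X) = J0 (orbit_derivative z X)"
    "X \<in> lie_algebra G \<Longrightarrow>
      ((\<lambda>t. chart_map (chart_at A z) (act (mexp (t *\<^sub>R X)) z)) has_vector_derivative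
        orbit_derivative z X) (at 0)"
    by blast+
qed

lemma curve_velocity_orbit:
  assumes X: "X \<in> lie_algebra G"
  shows "curve_velocity A (\<lambda>t. act (mexp (t *\<^sub>R X)) z) = coords z (orbit_derivative z X)"
proof
  fix c
  let ?\<gamma> = "\<lambda>t. act (mexp (t *\<^sub>R X)) z"
  have \<gamma>0: "?\<gamma> 0 = z"
    by (simp add: act_one)
  show "curve_velocity A ?\<gamma> c = coords z (orbit_derivative z X) c"
  proof (cases "c \<in> charts_at A z")
    case True
    have "((\<lambda>t. chart_map c (?\<gamma> t)) has_vector_derivative
        dtransition (chart_at A z) c z (orbit_derivative z X)) (at 0)"
      by (rule curve_chain [OF continuous_on_orbit [OF X], of "chart_at A z"])
        (simp_all add: act_one chart_at_mem orbit_has_vector_derivative [OF X]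
          dtransition(1) [OF chart_at_mem True])
    then show ?thesis
      using True \<gamma>0 by (simp add: curve_velocity_def coordinate_vector_def vector_derivative_at)
  next
    case False
    then show ?thesis
      using \<gamma>0 by (simp add: curve_velocity_def coordinate_vector_def)
  qed
qed

text \<open>The velocity at time t is the image of the velocity at time 0 under the differential of
  exp(t X), hence zero throughout. The curve is therefore locally constant in charts, and the real
  line is connected.\<close>

lemma orbit_constant:
  assumes X: "X \<in> lie_algebra G" and 0: "orbit_derivative z X = 0"
  shows "act (mexp (t *\<^sub>R X)) z = z"
proof -
  let ?\<gamma> = "\<lambda>t. act (mexp (t *\<^sub>R X)) z"
  have cont: "continuous_on UNIV ?\<gamma>"
    by (rule continuous_on_orbit [OF X])
  have der: "((\<lambda>t. chart_map c (?\<gamma> t)) has_vector_derivative 0) (at t)" if c: "c \<in> charts_at A (?\<gamma> t)" for c t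
  proof -
    let ?g = "mexp (t *\<^sub>R X)"
    have g: "?g \<in> G"
      by (rule mexp_lie_algebra [OF X])
    obtain D where D: "bounded_linear D"
      "((\<lambda>x. chart_map c (act ?g (chart_inv (chart_at A z) x))) has_derivative D)
        (at (chart_map (chart_at A z) z))"
      using act_differentiable [OF g chart_at_mem c] .
    have "((\<lambda>h. chart_map c (act ?g (?\<gamma> h))) has_vector_derivative D 0) (at 0)"
      by (rule curve_chain [OF cont, of "chart_at A z"])
        (use orbit_has_vector_derivative [OF X, of z] D(2) in \<open>simp_all add: act_one chart_at_mem 0\<close>)
    moreover have "act ?g (?\<gamma> h) = ?\<gamma> (t + h)" for h
      using g mexp_lie_algebra [OF X] by (simp add: mexp_add act_mult)
    ultimately have "((\<lambda>h. chart_map c (?\<gamma> (t + h))) has_vector_derivative 0) (at 0)"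
      using linear_0 [OF bounded_linear.linear [OF D(1)]] by simp
    moreover have "((\<lambda>s. s - t) has_vector_derivative 1) (at t)"
      by (auto intro!: derivative_eq_intros)
    ultimately show ?thesis
      using vector_diff_chain_at [of "\<lambda>s. s - t" 1 t "\<lambda>h. chart_map c (?\<gamma> (t + h))" 0]
      by (simp add: o_def)
  qed
  have "?\<gamma> 0 = ?\<gamma> t"
  proof (rule connected_local_const [OF connected_UNIV UNIV_I UNIV_I, where f = ?\<gamma>], rule ballI)
    fix t0 :: real
    let ?c = "chart_at A (?\<gamma> t0)"
    have "open (?\<gamma> -` chart_dom ?c)"
      using continuous_on_open_vimage [of UNIV ?\<gamma>] cont open_chart_dom [OF chart_at_mem] by simp
    then obtain e where e: "e > 0" "ball t0 e \<subseteq> ?\<gamma> -` chart_dom ?c"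
      using open_contains_ball charts_at_dom [OF chart_at_mem] by (metis vimageI)
    have "((\<lambda>t. chart_map ?c (?\<gamma> t)) has_derivative (\<lambda>h. 0)) (at s within ball t0 e)"
      if "s \<in> ball t0 e" for s
      using der [of ?c s] e(2) that charts_at_iff [OF chart_at_mem] has_derivative_at_withinI
      by (fastforce simp: has_vector_derivative_def)
    then obtain k where k: "\<And>s. s \<in> ball t0 e \<Longrightarrow> chart_map ?c (?\<gamma> s) = k"
      using has_derivative_zero_constant [OF convex_ball, of t0 e "\<lambda>t. chart_map ?c (?\<gamma> t)"] by blast
    have "?\<gamma> t0 = ?\<gamma> s" if "s \<in> ball t0 e" for s
    proof -
      have "chart_map ?c (?\<gamma> t0) = chart_map ?c (?\<gamma> s)"
        using k that e(1) by simp
      then show ?thesis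
        using e that chart_inv_map [OF chart_at_mem, of "?\<gamma> s" "?\<gamma> t0"]
          chart_inv_map' [OF chart_at_mem, of "?\<gamma> t0"] by auto
    qed
    then show "\<forall>\<^sub>F s in at t0. ?\<gamma> t0 = ?\<gamma> s"
      using e(1) unfolding eventually_at by (metis dist_commute mem_ball)
  qed
  then show ?thesis
    by (simp add: act_one)
qed

text \<open>The one-parameter group of the conjugated element is the conjugate of a group fixing
  \<open>z\<close> by an element fixing \<open>z\<close>, so it fixes \<open>z\<close> too.\<close>

lemma stabilizer_Ad:
  assumes g: "g \<in> G" "act g z = z" and X: "X \<in> lie_algebra G" "orbit_derivative z X = 0"
  shows "orbit_derivative z (g ** X ** matrix_inv g) = 0"
proof -
  let ?Y = "g ** X ** matrix_inv g"
  have inv: "invertible g" "matrix_inv g \<in> G"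
    using G g(1) by (auto simp: matrix_group_def)
  have "act (mexp (t *\<^sub>R ?Y)) z = z" for t
  proof -
    have "t *\<^sub>R ?Y = g ** (t *\<^sub>R X) ** matrix_inv g"
      by (simp add: matrix_mul_algebra)
    then have "mexp (t *\<^sub>R ?Y) = g ** mexp (t *\<^sub>R X) ** matrix_inv g"
      using mexp_conj matrix_inv_mult [OF inv(1)] by metis
    moreover have "g ** mexp (t *\<^sub>R X) \<in> G"
      using G g mexp_lie_algebra [OF X(1)] by (simp add: matrix_group_def)
    ultimately show ?thesis
      using act_mult inv g mexp_lie_algebra [OF X(1)] orbit_constant [OF X] act_stable_inv [OF g]
      by simp
  qed
  then have "((\<lambda>t::real. chart_map (chart_at A z) z) has_vector_derivative orbit_derivative z ?Y) (at 0)"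
    using orbit_has_vector_derivative [OF lie_algebra_Ad [OF G X(1) g(1)], of z] by simp
  then show ?thesis
    using vector_derivative_unique_at has_vector_derivative_const by blast
qed

text \<open>Differentiating Ad(exp(t X)) Y, a curve in the kernel of the orbit derivative, keeps the
  derivative in that kernel.\<close>

lemma stabilizer_commutator:
  assumes X: "X \<in> lie_algebra G" "orbit_derivative z X = 0"
    and Y: "Y \<in> lie_algebra G" "orbit_derivative z Y = 0"
  shows "orbit_derivative z (commutator X Y) = 0"
proof -
  have "orbit_derivative z (mexp (t *\<^sub>R X) ** Y ** mexp (- (t *\<^sub>R X))) = 0" for t
    using stabilizer_Ad [OF mexp_lie_algebra [OF X(1)] orbit_constant [OF X] Y]
    by (simp add: matrix_inv_mexp)
  then have "((\<lambda>t::real. 0) has_vector_derivative orbit_derivative z (commutator X Y)) (at 0)"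
    using bounded_linear.has_vector_derivative [OF bounded_linear_orbit_derivative
        mexp_Ad_has_vector_derivative, of z X Y] by simp
  then show ?thesis
    using vector_derivative_unique_at has_vector_derivative_const by blast
qed

end

section \<open>The coadjoint action\<close>

locale embedded_lie_algebra =
  fixes K :: "'n::finite cmat set" and emb :: "'k::real_normed_vector \<Rightarrow> 'n cmat"
  assumes K: "matrix_group K" and iso: "lie_algebra_iso emb K"
begin

lemma bounded_linear_emb: "bounded_linear emb"
  and inj_emb: "inj emb"
  and range_emb: "range emb = lie_algebra K"
  using iso by (auto simp: lie_algebra_iso_def)

lemma linear_emb: "linear emb"
  by (rule bounded_linear.linear [OF bounded_linear_emb])

lemma emb_lie_algebra: "emb x \<in> lie_algebra K"
  using range_emb by blast

text \<open>A linear left inverse of \<open>emb\<close> on all matrices. Unlike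
  \<open>inv emb\<close>, it is bounded linear on the whole space, so it commutes with
  differentiation.\<close>

definition linv :: "'n cmat \<Rightarrow> 'k" where
  "linv = (SOME g. bounded_linear g \<and> (\<forall>x. g (emb x) = x))"

lemma bounded_linear_linv: "bounded_linear linv"
  and linv_emb: "linv (emb x) = x"
proof -
  obtain g where g: "linear g" "g \<circ> emb = id"
    using linear_injective_left_inverse [OF linear_emb inj_emb] by blast
  then have "bounded_linear g \<and> (\<forall>x. g (emb x) = x)"
    by (simp add: linear_conv_bounded_linear pointfree_idE)
  then have "\<exists>g. bounded_linear g \<and> (\<forall>x. g (emb x) = x)"
    by blast
  from someI_ex [OF this, folded linv_def] have "bounded_linear linv \<and> (\<forall>x. linv (emb x) = x)" .
  then show "bounded_linear linv" "linv (emb x) = x"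
    by blast+
qed

lemma emb_linv: "X \<in> lie_algebra K \<Longrightarrow> emb (linv X) = X"
  using range_emb linv_emb by (metis rangeE)

lemma inv_emb: "X \<in> lie_algebra K \<Longrightarrow> inv emb X = linv X"
  using emb_linv inv_f_f [OF inj_emb] by metis

lemma matrix_inv_K: "k \<in> K \<Longrightarrow> matrix_inv k \<in> K"
  and invertible_K: "k \<in> K \<Longrightarrow> invertible k"
  using K by (auto simp: matrix_group_def)

lemma matrix_inv_inv: "k \<in> K \<Longrightarrow> matrix_inv (matrix_inv k) = k"
  using matrix_inv_mult [OF invertible_K] by (intro matrix_invI) auto

lemma mexp_K: "mexp (t *\<^sub>R emb x) \<in> K"
  by (rule mexp_lie_algebra [OF emb_lie_algebra])

definition br :: "'k \<Rightarrow> 'k \<Rightarrow> 'k" where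
  "br x y = linv (commutator (emb x) (emb y))"

lemma emb_br: "emb (br x y) = commutator (emb x) (emb y)"
  unfolding br_def
proof (rule emb_linv, rule lie_algebra_commutator [OF K _ emb_lie_algebra emb_lie_algebra])
  show "subspace (lie_algebra K)"
    using linear_subspace_image [OF linear_emb subspace_UNIV] range_emb by simp
qed

lemma br_eqI: "emb (br x y) = emb w \<Longrightarrow> br x y = w"
  using inj_emb by (simp add: inj_eq)

lemma emb_Ad: "k \<in> K \<Longrightarrow> emb (Ad emb k x) = k ** emb x ** matrix_inv k"
  using lie_algebra_Ad [OF K emb_lie_algebra] by (simp add: Ad_def inv_emb emb_linv)

lemma Ad_eq: "k \<in> K \<Longrightarrow> Ad emb k x = linv (k ** emb x ** matrix_inv k)"
  using emb_Ad linv_emb by metis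

lemma bounded_linear_Ad:
  assumes "k \<in> K"
  shows "bounded_linear (Ad emb k)"
proof -
  have "bounded_linear (\<lambda>x. linv (k ** emb x ** matrix_inv k))"
    by (intro bounded_linear_compose [OF bounded_linear_linv]
        bounded_linear_compose [OF bounded_bilinear.bounded_linear_left [OF bounded_bilinear_matrix_mul]]
        bounded_linear_compose [OF bounded_bilinear.bounded_linear_right [OF bounded_bilinear_matrix_mul]]
        bounded_linear_emb)
  moreover have "Ad emb k = (\<lambda>x. linv (k ** emb x ** matrix_inv k))"
    using Ad_eq [OF assms] by blast
  ultimately show ?thesis by simp
qed

lemma Ad_star_eq:
  assumes "k \<in> K"
  shows "Ad_star emb k \<alpha> = \<alpha> o\<^sub>L Blinfun (Ad emb (matrix_inv k))"
proof -
  have Ad: "bounded_linear (Ad emb (matrix_inv k))"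
    by (rule bounded_linear_Ad [OF matrix_inv_K [OF assms]])
  have "(\<lambda>\<eta>. blinfun_apply \<alpha> (Ad emb (matrix_inv k) \<eta>)) = blinfun_apply (\<alpha> o\<^sub>L Blinfun (Ad emb (matrix_inv k)))"
    by (simp add: fun_eq_iff bounded_linear_Blinfun_apply [OF Ad])
  then show ?thesis
    by (simp add: Ad_star_def blinfun_apply_inverse)
qed

lemma Ad_star_apply:
  "k \<in> K \<Longrightarrow> blinfun_apply (Ad_star emb k \<alpha>) x = blinfun_apply \<alpha> (Ad emb (matrix_inv k) x)"
  by (simp add: Ad_star_eq bounded_linear_Blinfun_apply bounded_linear_Ad matrix_inv_K)

lemma bounded_linear_Ad_star:
  assumes "k \<in> K"
  shows "bounded_linear (Ad_star emb k)"
proof -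
  have "Ad_star emb k = (\<lambda>\<alpha>. \<alpha> o\<^sub>L Blinfun (Ad emb (matrix_inv k)))"
    using Ad_star_eq [OF assms] by blast
  then show ?thesis
    by (simp add: bounded_bilinear.bounded_linear_left [OF bounded_bilinear_blinfun_compose])
qed

lemma Ad_inv:
  assumes "k \<in> K"
  shows "Ad emb k (Ad emb (matrix_inv k) x) = x"
proof -
  have inv: "k ** matrix_inv k = mat 1"
    by (rule matrix_inv_mult [OF invertible_K [OF assms]])
  have "emb (Ad emb k (Ad emb (matrix_inv k) x))
      = (k ** matrix_inv k) ** emb x ** (k ** matrix_inv k)"
    by (simp add: emb_Ad assms matrix_inv_K matrix_inv_inv matrix_mul_assoc)
  then show ?thesis
    using inj_emb by (simp add: inv inj_eq)
qed

lemma Ad_star_inv: "k \<in> K \<Longrightarrow> Ad_star emb k (Ad_star emb (matrix_inv k) \<beta>) = \<beta>"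
  by (intro blinfun_eqI) (simp add: Ad_star_apply matrix_inv_K matrix_inv_inv Ad_inv)

lemma Ad_mexp_has_vector_derivative:
  "((\<lambda>t. blinfun_apply \<beta> (Ad emb (mexp (t *\<^sub>R emb x)) y)) has_vector_derivative
    blinfun_apply \<beta> (br x y)) (at 0)"
proof -
  have "bounded_linear (\<lambda>M. blinfun_apply \<beta> (linv M))"
    by (rule bounded_linear_compose [OF blinfun.bounded_linear_right bounded_linear_linv])
  from bounded_linear.has_vector_derivative [OF this mexp_Ad_has_vector_derivative [of "emb x" "emb y"]]
  show ?thesis
    by (simp add: Ad_eq [OF mexp_K] matrix_inv_mexp br_def)
qed

lemma br_minus: "br (- x) y = - br x y"
  by (rule br_eqI) (simp add: emb_br linear_neg [OF linear_emb] commutator_minus_left)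

text \<open>The coadjoint action evaluates at the inverse group element, whence \<open>- x\<close>
  and the minus sign.\<close>

lemma Ad_star_mexp_has_vector_derivative:
  "((\<lambda>t. blinfun_apply (Ad_star emb (mexp (t *\<^sub>R emb x)) \<alpha>) y) has_vector_derivative
    - blinfun_apply \<alpha> (br x y)) (at 0)"
  using Ad_mexp_has_vector_derivative [of \<alpha> "- x" y]
  by (simp add: Ad_star_apply mexp_K matrix_inv_mexp linear_neg [OF linear_emb] br_minus blinfun.minus_right)

text \<open>Together with the vectors \<open>linv b\<close> these functionals replace a pair of dual
  bases, as \<open>'k\<close> comes without a chosen basis; they are indexed by the basis of the
  matrix space.\<close>

definition dual_coord :: "'n cmat \<Rightarrow> 'k \<Rightarrow>\<^sub>L real" where
  "dual_coord b = Blinfun (\<lambda>x. emb x \<bullet> b)"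

lemma dual_coord_apply: "blinfun_apply (dual_coord b) x = emb x \<bullet> b"
  by (simp add: dual_coord_def bounded_linear_Blinfun_apply
      bounded_linear_compose [OF bounded_linear_inner_left bounded_linear_emb])

lemma dual_separates: "(\<And>\<beta> :: 'k \<Rightarrow>\<^sub>L real. blinfun_apply \<beta> x = 0) \<Longrightarrow> x = 0"
proof -
  assume "\<And>\<beta> :: 'k \<Rightarrow>\<^sub>L real. blinfun_apply \<beta> x = 0"
  then have "emb x = emb 0"
    using dual_coord_apply [of "emb x" x] linear_0 [OF linear_emb] by simp
  then show "x = 0"
    using inj_emb by (simp add: inj_eq)
qed

text \<open>Expanding a functional over \<open>dual_coord\<close> exhibits the representing vector;
  it also makes the description in \<open>differential\<close> well defined.\<close>

lemma double_dual:
  fixes F :: "('k \<Rightarrow>\<^sub>L real) \<Rightarrow> real"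
  assumes "linear F"
  shows "\<exists>!\<eta>. \<forall>\<beta>. F \<beta> = blinfun_apply \<beta> \<eta>"
proof (rule ex_ex1I)
  have "F \<beta> = blinfun_apply \<beta> (\<Sum>b\<in>Basis. F (dual_coord b) *\<^sub>R linv b)" for \<beta>
  proof -
    have "\<beta> = (\<Sum>b\<in>Basis. blinfun_apply \<beta> (linv b) *\<^sub>R dual_coord b)"
    proof (rule blinfun_eqI)
      fix x
      have "x = linv (\<Sum>b\<in>Basis. (emb x \<bullet> b) *\<^sub>R b)"
        by (simp add: euclidean_representation linv_emb)
      also have "\<dots> = (\<Sum>b\<in>Basis. (emb x \<bullet> b) *\<^sub>R linv b)"
        by (simp add: linear_sum [OF bounded_linear.linear [OF bounded_linear_linv]]
            linear_scale [OF bounded_linear.linear [OF bounded_linear_linv]])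
      finally have "blinfun_apply \<beta> x = blinfun_apply \<beta> (\<Sum>b\<in>Basis. (emb x \<bullet> b) *\<^sub>R linv b)"
        by simp
      then show "blinfun_apply \<beta> x = blinfun_apply (\<Sum>b\<in>Basis. blinfun_apply \<beta> (linv b) *\<^sub>R dual_coord b) x"
        by (simp add: blinfun.sum_right blinfun.sum_left blinfun.scaleR_right blinfun.scaleR_left
            dual_coord_apply mult.commute)
    qed
    then have "F \<beta> = F (\<Sum>b\<in>Basis. blinfun_apply \<beta> (linv b) *\<^sub>R dual_coord b)"
      by simp
    also have "\<dots> = (\<Sum>b\<in>Basis. blinfun_apply \<beta> (linv b) * F (dual_coord b))"
      by (simp add: linear_sum [OF assms] linear_scale [OF assms])
    finally show ?thesis
      by (simp add: blinfun.sum_right blinfun.scaleR_right mult.commute)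
  qed
  then show "\<exists>\<eta>. \<forall>\<beta>. F \<beta> = blinfun_apply \<beta> \<eta>"
    by blast
next
  fix \<eta> \<eta>' assume "\<forall>\<beta>. F \<beta> = blinfun_apply \<beta> \<eta>" "\<forall>\<beta>. F \<beta> = blinfun_apply \<beta> \<eta>'"
  then have "blinfun_apply \<beta> (\<eta> - \<eta>') = 0" for \<beta> :: "'k \<Rightarrow>\<^sub>L real"
    by (simp add: blinfun.diff_right)
  then show "\<eta> = \<eta>'"
    using dual_separates [of "\<eta> - \<eta>'"] by simp
qed

lemma differential_apply:
  fixes f :: "('k \<Rightarrow>\<^sub>L real) \<Rightarrow> real"
  assumes "f differentiable (at \<alpha>)"
  shows "frechet_derivative f (at \<alpha>) \<beta> = blinfun_apply \<beta> (differential f \<alpha>)"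
proof -
  have "\<exists>!\<eta>. \<forall>\<beta>. frechet_derivative f (at \<alpha>) \<beta> = blinfun_apply \<beta> \<eta>"
    by (rule double_dual [OF linear_frechet_derivative [OF assms]])
  from theI' [OF this] show ?thesis
    unfolding differential_def by blast
qed

text \<open>The chain rule for \<open>f\<close> composed with \<open>Ad_star emb k\<close>, which is
  \<open>f\<close> again by invariance; the direction is then moved across by the inverse of
  \<open>k\<close>.\<close>

lemma frechet_derivative_Ad_star:
  assumes f: "\<And>\<alpha>. f differentiable (at \<alpha>)" "Ad_star_invariant emb K f" and k: "k \<in> K"
  shows "frechet_derivative f (at (Ad_star emb k \<alpha>)) \<beta>
    = blinfun_apply \<beta> (Ad emb k (differential f \<alpha>))"
proof -
  have "((\<lambda>a. f (Ad_star emb k a)) has_derivative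
      (\<lambda>b. frechet_derivative f (at (Ad_star emb k \<alpha>)) (Ad_star emb k b))) (at \<alpha>)"
    by (rule has_derivative_compose [OF bounded_linear_imp_has_derivative [OF bounded_linear_Ad_star [OF k]]])
      (use f(1) frechet_derivative_works in blast)
  moreover have "(\<lambda>a. f (Ad_star emb k a)) = f"
    using f(2) k by (auto simp: Ad_star_invariant_def)
  ultimately have "frechet_derivative f (at \<alpha>)
      = (\<lambda>b. frechet_derivative f (at (Ad_star emb k \<alpha>)) (Ad_star emb k b))"
    using frechet_derivative_at by metis
  then have "frechet_derivative f (at (Ad_star emb k \<alpha>)) \<beta>
      = frechet_derivative f (at \<alpha>) (Ad_star emb (matrix_inv k) \<beta>)"
    using Ad_star_inv [OF k] by simp
  then show ?thesis
    by (simp add: differential_apply f(1) Ad_star_apply k matrix_inv_K matrix_inv_inv)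
qed

text \<open>The infinitesimal form of \<open>df(Ad\<^sup>*\<^sub>k \<alpha>) = Ad\<^sub>k (df(\<alpha>))\<close>.\<close>

lemma hessian_coadjoint:
  assumes f: "smooth_on f UNIV" "Ad_star_invariant emb K f"
    and w: "((\<lambda>t. Ad_star emb (mexp (t *\<^sub>R emb x)) \<alpha>) has_vector_derivative w) (at 0)"
  shows "hessian f \<alpha> w \<beta> = blinfun_apply \<beta> (br x (differential f \<alpha>))"
proof -
  let ?F = "\<lambda>a. frechet_derivative f (at a) \<beta>"
  have "C_k (Suc (Suc 0)) f UNIV"
    using f(1) unfolding smooth_on_def by blast
  then have f': "\<And>\<alpha>. f differentiable (at \<alpha>)" and F: "?F differentiable (at \<alpha>)"
    by simp_all
  have 0: "Ad_star emb (mexp (0 *\<^sub>R emb x)) \<alpha> = \<alpha>"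
  proof (rule blinfun_eqI)
    fix y
    have "mat 1 \<in> K"
      using mexp_K [of 0] by simp
    moreover have "matrix_inv (mat 1 :: 'n cmat) = mat 1"
      by (rule matrix_invI) simp_all
    moreover from calculation have "Ad emb (mat 1) y = y"
      using Ad_eq [of "mat 1" y] by (simp add: linv_emb)
    ultimately show "blinfun_apply (Ad_star emb (mexp (0 *\<^sub>R emb x)) \<alpha>) y = blinfun_apply \<alpha> y"
      by (simp add: Ad_star_apply)
  qed
  have "(?F has_derivative frechet_derivative ?F (at \<alpha>)) (at (Ad_star emb (mexp (0 *\<^sub>R emb x)) \<alpha>))"
    using F frechet_derivative_works unfolding 0 by blast
  from has_derivative_compose [OF w [unfolded has_vector_derivative_def] this]
  have "((\<lambda>t. ?F (Ad_star emb (mexp (t *\<^sub>R emb x)) \<alpha>)) has_vector_derivative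
      frechet_derivative ?F (at \<alpha>) w) (at 0)"
    using linear_scale [OF linear_frechet_derivative [OF F]] by (simp add: has_vector_derivative_def)
  \<comment> \<open>The same scalar curve is differentiated in two ways: by the chain rule it gives
    the Hessian, by equivariance of df it gives the bracket.\<close>
  moreover have "(\<lambda>t. ?F (Ad_star emb (mexp (t *\<^sub>R emb x)) \<alpha>))
      = (\<lambda>t. blinfun_apply \<beta> (Ad emb (mexp (t *\<^sub>R emb x)) (differential f \<alpha>)))"
    using frechet_derivative_Ad_star [OF f' f(2) mexp_K] by blast
  ultimately have "((\<lambda>t. blinfun_apply \<beta> (Ad emb (mexp (t *\<^sub>R emb x)) (differential f \<alpha>)))
      has_vector_derivative hessian f \<alpha> w \<beta>) (at 0)"
    by (simp add: hessian_def)
  then show ?thesis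
    by (rule vector_derivative_unique_at [OF _ Ad_mexp_has_vector_derivative])
qed

end

theorem theorem3p3:
  fixes G K :: "'n::finite cmat set"
    and emb :: "'k::real_normed_vector \<Rightarrow> 'n cmat"
    and J0 :: "'e::real_normed_vector \<Rightarrow> 'e"
    and A :: "('z::{t2_space, second_countable_topology}, 'e) chart set"
    and \<omega> :: "'z \<Rightarrow> ('z, 'e) tangent \<Rightarrow> ('z, 'e) tangent \<Rightarrow> real"
    and act :: "'n cmat \<Rightarrow> 'z \<Rightarrow> 'z"
    and \<mu> :: "'z \<Rightarrow> ('k \<Rightarrow>\<^sub>L real)"
    and f :: "('k \<Rightarrow>\<^sub>L real) \<Rightarrow> real"
    and z :: 'z
  defines "H \<equiv> differential f (\<mu> z)"
    and "\<kk>\<^sub>z \<equiv> stab_k A emb act z"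
    and "\<gg>\<^sub>z \<equiv> stab_g J0 A emb G act z"
  assumes "reductive G"
    and "maximal_compact_subgroup K G"
    and "lie_algebra_iso emb K"
    and "complex_manifold J0 A"
    and "kaehler_form J0 A \<omega>"
    and "holomorphic_action J0 A G act"
    and "isometric_action J0 A \<omega> K act"
    and "moment_map A \<omega> emb K act \<mu>"
    and "smooth_on f UNIV"
    and "Ad_star_invariant emb K f"
    and "hessian_positive_definite f"
    and "critical_point A (f \<circ> \<mu>) z"
  shows "H \<in> \<kk>\<^sub>z
    \<and> ad_star emb H (\<mu> z) = 0
    \<and> is_direct_sum \<gg>\<^sub>z {l. l \<le> 0} (ad_eigenspace \<gg>\<^sub>z (emb H))
    \<and> ad_eigenspace \<gg>\<^sub>z (emb H) 0 = complexification emb \<kk>\<^sub>z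
    \<and> (\<exists>S. solv_part S \<gg>\<^sub>z \<and> isomorphic_to_quotient (ad_eigenspace \<gg>\<^sub>z (emb H) 0) \<gg>\<^sub>z S)"
proof -

  \<comment> \<open>Coordinates at \<open>z\<close> and the stabilizer algebras\<close>
  have algG: "linear_algebraic_group G" and mG: "matrix_group G"
    using \<open>reductive G\<close> by (auto simp: reductive_def linear_algebraic_group_def)
  have cK: "matrix_group K" "compact K" "K \<subseteq> G"
    using \<open>maximal_compact_subgroup K G\<close> by (auto simp: maximal_compact_subgroup_def)
  interpret embedded_lie_algebra K emb
    by unfold_locales fact+
  interpret holomorphic_action_on_manifold J0 A G act
    by unfold_locales fact+
  define c where "c = chart_at A z"
  define p where "p = chart_map c z"
  define s where "s x = orbit_derivative z (emb x)" for x
  define \<Omega> where "\<Omega> u v = \<omega> z (coords z u) (coords z v)" for u v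
  define d\<mu> where "d\<mu> = frechet_derivative (\<lambda>x. \<mu> (chart_inv c x)) (at p)"
  have c: "c \<in> charts_at A z"
    unfolding c_def by (rule chart_at_mem)
  have embG: "emb x \<in> lie_algebra G" for x
    using lie_algebra_mono [OF cK(3)] emb_lie_algebra by blast
  have lin_s: "linear s"
    unfolding s_def [abs_def]
    using linear_compose [OF linear_emb bounded_linear.linear [OF bounded_linear_orbit_derivative]]
    by (simp add: o_def)
  have inf: "inf_action A emb act z x = coords z (s x)" for x
    unfolding inf_action_def s_def by (rule curve_velocity_orbit [OF embG])
  have mkG: "emb x + cscale \<i> (emb y) \<in> lie_algebra G" for x y
    by (rule lie_algebra_add_cscale [OF algG embG embG])
  have orbit_mk: "orbit_derivative z (emb x + cscale \<i> (emb y)) = s x + J0 (s y)" for x y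
    by (simp add: s_def linear_add [OF bounded_linear.linear [OF bounded_linear_orbit_derivative]]
        orbit_derivative_cscale embG)
  have kz: "\<kk>\<^sub>z = {x. s x = 0}"
    by (simp add: \<kk>\<^sub>z_def stab_k_def inf coords_eq_0_iff)
  \<comment> \<open>Membership in Lie(G) is automatic here, because the Lie algebra of an algebraic
    group is a complex subspace containing Lie(K).\<close>
  have gz: "\<gg>\<^sub>z = {emb x + cscale \<i> (emb y) | x y. s x + J0 (s y) = 0}"
    using mkG unfolding \<gg>\<^sub>z_def stab_g_def inf tangent_J_coords coords_add [symmetric] coords_eq_0_iff
    by blast

  \<comment> \<open>The Kaehler form in coordinates\<close>
  have \<Omega>: "bilinear \<Omega>" "\<Omega> u v = - \<Omega> v u" "\<Omega> (J0 u) (J0 v) = \<Omega> u v"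
    "u \<noteq> 0 \<Longrightarrow> \<Omega> u (J0 u) > 0" for u v
  proof -
    note kf = \<open>kaehler_form J0 A \<omega>\<close> [unfolded kaehler_form_def]
    show "bilinear \<Omega>"
      unfolding \<Omega>_def [abs_def] using kf [THEN conjunct1] c unfolding c_def by blast
    show "\<Omega> u v = - \<Omega> v u"
      unfolding \<Omega>_def
      by (rule kf [THEN conjunct2, THEN conjunct1, rule_format, OF coords_tangent coords_tangent])
    show "\<Omega> (J0 u) (J0 v) = \<Omega> u v"
      unfolding \<Omega>_def tangent_J_coords [symmetric]
      by (rule kf [THEN conjunct2, THEN conjunct2, THEN conjunct1, rule_format,
            OF coords_tangent coords_tangent])
    show "\<Omega> u (J0 u) > 0" if "u \<noteq> 0"
      unfolding \<Omega>_def tangent_J_coords [symmetric]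
      by (rule kf [THEN conjunct2, THEN conjunct2, THEN conjunct2, THEN conjunct1, rule_format,
            OF coords_tangent]) (simp add: coords_eq_0_iff that)
  qed

  \<comment> \<open>The moment map and the Hessian along the orbit\<close>
  have \<mu>_diff: "(\<lambda>x. \<mu> (chart_inv c x)) differentiable (at p)"
  proof -
    have "C_k (Suc 0) (\<lambda>x. \<mu> (chart_inv c x)) (chart_map c ` chart_dom c)"
      using \<open>moment_map A \<omega> emb K act \<mu>\<close> c
      unfolding moment_map_def smooth_map_def smooth_on_def charts_at_def by blast
    then show ?thesis
      using charts_at_dom [OF c] by (simp add: p_def)
  qed
  then have d\<mu>: "((\<lambda>x. \<mu> (chart_inv c x)) has_derivative d\<mu>) (at p)"
    unfolding d\<mu>_def using frechet_derivative_works by blast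
  have d\<mu>_apply: "blinfun_apply (d\<mu> u) x = \<Omega> u (s x)" for u x
  proof -
    have "mderiv A \<mu> z (coords z u) = d\<mu> u"
      by (simp add: mderiv_def Let_def d\<mu>_def p_def c_def coords_at)
    moreover have "blinfun_apply (mderiv A \<mu> z (coords z u)) x = \<omega> z (coords z u) (inf_action A emb act z x)"
      using \<open>moment_map A \<omega> emb K act \<mu>\<close> coords_tangent unfolding moment_map_def by blast
    ultimately show ?thesis
      by (simp add: inf \<Omega>_def)
  qed
  have \<mu>_orbit: "\<mu> (act (mexp (t *\<^sub>R emb x)) z) = Ad_star emb (mexp (t *\<^sub>R emb x)) (\<mu> z)" for t x
    using \<open>moment_map A \<omega> emb K act \<mu>\<close> mexp_K unfolding moment_map_def by blast
  \<comment> \<open>Equivariance identifies the coadjoint curve with \<open>\<mu>\<close> along the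
    orbit, which makes it differentiable in norm.\<close>
  have Ad_star_der: "((\<lambda>t. Ad_star emb (mexp (t *\<^sub>R emb x)) (\<mu> z)) has_vector_derivative d\<mu> (s x)) (at 0)" for x
  proof -
    have "((\<lambda>t. \<mu> (act (mexp (t *\<^sub>R emb x)) z)) has_vector_derivative d\<mu> (s x)) (at 0)"
      by (rule curve_chain [OF continuous_on_orbit [OF embG], of c])
        (use orbit_has_vector_derivative [OF embG, of z x] d\<mu> c in
          \<open>simp_all add: act_one s_def c_def [symmetric] p_def\<close>)
    then show ?thesis
      by (simp add: \<mu>_orbit)
  qed
  \<comment> \<open>This derivative, evaluated at \<open>y\<close>, is compared with the direct
    pointwise computation.\<close>
  have d\<mu>_br: "blinfun_apply (d\<mu> (s x)) y = - blinfun_apply (\<mu> z) (br x y)" for x y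
    using vector_derivative_unique_at [OF Ad_star_mexp_has_vector_derivative
        bounded_linear.has_vector_derivative [OF blinfun.bounded_linear_left Ad_star_der]] by metis
  have hess: "hessian f (\<mu> z) (d\<mu> (s x)) \<beta> = blinfun_apply \<beta> (br x H)" for x \<beta>
    unfolding H_def
    by (rule hessian_coadjoint [OF \<open>smooth_on f UNIV\<close> \<open>Ad_star_invariant emb K f\<close> Ad_star_der])

  \<comment> \<open>Criticality: \<open>H\<close> stabilizes \<open>z\<close>\<close>
  have s_H: "s H = 0"
  proof (rule ccontr)
    assume "s H \<noteq> 0"
    have "C_k (Suc 0) f UNIV"
      using \<open>smooth_on f UNIV\<close> unfolding smooth_on_def by blast
    then have f: "f differentiable (at (\<mu> z))"
      by simp
    have "((\<lambda>x. f (\<mu> (chart_inv c x))) has_derivative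
        (\<lambda>u. frechet_derivative f (at (\<mu> z)) (d\<mu> u))) (at p)"
      using has_derivative_compose [OF d\<mu>, of f] f frechet_derivative_works chart_inv_map' [OF c]
      by (metis p_def)
    from frechet_derivative_at [OF this, symmetric]
    have "mderiv A (f \<circ> \<mu>) z (coords z u) = frechet_derivative f (at (\<mu> z)) (d\<mu> u)" for u
      unfolding p_def c_def by (simp add: mderiv_def Let_def coords_at o_def)
    \<comment> \<open>Criticality pairs d\<mu> with \<open>H\<close>, and the moment map equation
      turns this into \<open>\<Omega>\<close>. Taking u = J (s H) then contradicts
      positivity.\<close>
    then have "\<Omega> u (s H) = 0" for u
      using \<open>critical_point A (f \<circ> \<mu>) z\<close> coords_tangent
      by (simp add: critical_point_def differential_apply [OF f] H_def [symmetric] d\<mu>_apply)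
    then show False
      using \<Omega>(2) [of "s H" "J0 (s H)"] \<Omega>(4) [OF \<open>s H \<noteq> 0\<close>] by simp
  qed
  have \<mu>_H: "blinfun_apply (\<mu> z) (br H y) = 0" for y
    using d\<mu>_br [of H y] d\<mu>_apply [of "s H" y] by (simp add: s_H bilinear_lzero [OF \<Omega>(1)])

  \<comment> \<open>Verification of the axioms for the stabilizer algebra\<close>
  interpret extremal_stabilizer K emb br H s J0 \<Omega> \<gg>\<^sub>z
  proof unfold_locales
    show "commutator X Y \<in> \<gg>\<^sub>z" if "X \<in> \<gg>\<^sub>z" "Y \<in> \<gg>\<^sub>z" for X Y
    proof -
      obtain x y where X: "X = emb x + cscale \<i> (emb y)" "s x + J0 (s y) = 0"
        using \<open>X \<in> \<gg>\<^sub>z\<close> unfolding gz by blast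
      obtain x' y' where Y: "Y = emb x' + cscale \<i> (emb y')" "s x' + J0 (s y') = 0"
        using \<open>Y \<in> \<gg>\<^sub>z\<close> unfolding gz by blast
      have "orbit_derivative z (commutator X Y) = 0"
        using X Y mkG orbit_mk by (intro stabilizer_commutator) simp_all
      moreover have "commutator X Y = emb (br x x' - br y y') + cscale \<i> (emb (br x y' + br y x'))"
        by (simp add: X Y commutator_algebra cscale_algebra linear_add [OF linear_emb]
            linear_diff [OF linear_emb] emb_br)
      ultimately show ?thesis
        using orbit_mk [of "br x x' - br y y'" "br x y' + br y x'"] unfolding gz by auto
    qed
    show "\<Omega> (s y) (s (br x H)) = \<Omega> (s x) (s (br y H))" for x y
    proof -
      \<comment> \<open>By the Jacobi identity the two nested brackets differ by a bracket with
        \<open>H\<close>, on which \<open>\<mu> z\<close> vanishes; this gives the symmetry of the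
        form.\<close>
      have "br x (br y H) - br y (br x H) = br (br x y) H"
        using inj_emb commutator_jacobi [of "emb x" "emb y" "emb H"]
        by (intro injD [OF inj_emb]) (simp add: linear_diff [OF linear_emb] emb_br)
      moreover have "br (br x y) H = - br H (br x y)"
        by (intro injD [OF inj_emb]) (simp add: linear_neg [OF linear_emb] emb_br commutator_antisym [of "emb H"])
      ultimately have "blinfun_apply (\<mu> z) (br x (br y H)) = blinfun_apply (\<mu> z) (br y (br x H))"
        using \<mu>_H [of "br x y"] by (metis blinfun.diff_right blinfun.minus_right neg_equal_0_iff_equal right_minus_eq)
      then show ?thesis
        by (simp add: d\<mu>_apply [symmetric] d\<mu>_br)
    qed
    have *: "\<Omega> (s x) (s (br x H)) = hessian f (\<mu> z) (d\<mu> (s x)) (d\<mu> (s x))" for x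
      by (simp add: hess d\<mu>_apply)
    have zero: "\<Omega> (s x) w = 0" if "d\<mu> (s x) = 0" "w \<in> range s" for x w
      using that d\<mu>_apply [of "s x"] by auto
    show "\<Omega> (s x) (s (br x H)) \<ge> 0" for x
      using * [of x] zero [of x "s (br x H)"] \<open>hessian_positive_definite f\<close>
      unfolding hessian_positive_definite_def by (cases "d\<mu> (s x) = 0") (auto intro: less_imp_le)
    show "\<Omega> (s x) (s y) = 0" if "\<Omega> (s x) (s (br x H)) = 0" for x y
    proof (rule zero)
      show "d\<mu> (s x) = 0"
      proof (rule ccontr)
        assume "d\<mu> (s x) \<noteq> 0"
        then have "0 < hessian f (\<mu> z) (d\<mu> (s x)) (d\<mu> (s x))"
          using \<open>hessian_positive_definite f\<close> unfolding hessian_positive_definite_def by blast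
        then show False
          using * [of x] that by simp
      qed
    qed simp
    show "br x H = 0" if "s x = 0" for x
    proof (rule dual_separates)
      fix \<beta> :: "'k \<Rightarrow>\<^sub>L real"
      \<comment> \<open>By \<open>hess\<close> the bracket with \<open>H\<close> depends on
        \<open>x\<close> only through \<open>d\<mu> (s x)\<close>, so \<open>x\<close> may be
        replaced by 0.\<close>
      have "d\<mu> (s x) = d\<mu> (s 0)"
        using that linear_0 [OF lin_s] by simp
      then have "blinfun_apply \<beta> (br x H) = blinfun_apply \<beta> (br 0 H)"
        using hess by metis
      also have "br 0 H = 0"
        by (intro injD [OF inj_emb]) (simp add: emb_br linear_0 [OF linear_emb])
      finally show "blinfun_apply \<beta> (br x H) = 0"
        by (simp add: blinfun.zero_right)
    qed
  qed (rule cK(2) iso emb_br linear_add [OF lin_s] linear_scale [OF lin_s] linear_add [OF linear_J0]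
      linear_scale [OF linear_J0] J0_J0 \<Omega> gz s_H | assumption)+

  \<comment> \<open>Coadjoint invariance and conclusion\<close>
  have ad_star: "ad_star emb H (\<mu> z) = 0"
  proof -
    \<comment> \<open>The group of \<open>H\<close> fixes \<open>z\<close>, so by equivariance the
      coadjoint curve is constant.\<close>
    have "Ad_star emb (mexp (t *\<^sub>R emb H)) (\<mu> z) = \<mu> z" for t
      using orbit_constant [OF embG, of z H] s_H \<mu>_orbit unfolding s_def by metis
    then show ?thesis
      by (simp add: ad_star_def)
  qed
  have "H \<in> \<kk>\<^sub>z"
    by (simp add: kz s_H)
  from conjI [OF this conjI [OF ad_star stabilizer_structure [folded kz]]]
  show ?thesis .
qed

end
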